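(* Let $0<a<c$ and $\tilde\Lambda\in\mathbb{R}$. With $\tilde\gamma$, $N_s$, $\infty_+$ and the boundary values as defined in the context, the function $$m^{\mathrm{mod}}(k)=\frac{\tilde\gamma(k)}{N_s(\infty_+)}\bigl(N_s((k,+)),\,N_s((k,-))\bigr)$$ is the unique vector-valued function $m=(m_1,m_2)$ which is holomorphic in the domain $\mathbb{C}\setminus[\mathrm{i}c,-\mathrm{i}c]$, has square integrable boundary values, and satisfies all of the following: (i) the jump condition $m_+(k)=m_-(k)\,v^{\mathrm{mod}}(k)$ on $[\mathrm{i}c,-\mathrm{i}c]$, where $$v^{\mathrm{mod}}(k)=\begin{cases}\begin{pmatrix}0&\mathrm{i}\\ \mathrm{i}&0\end{pmatrix}, & k\in[\mathrm{i}c,\mathrm{i}a],\\[2mm] \begin{pmatrix}0&-\mathrm{i}\\ -\mathrm{i}&0\end{pmatrix}, & k\in[-\mathrm{i}a,-\mathrm{i}c],\\[2mm] \begin{pmatrix}e^{-2\pi\mathrm{i}\tilde\Lambda}&0\\ 0&e^{2\pi\mathrm{i}\tilde\Lambda}\end{pmatrix}, & k\in[\mathrm{i}a,-\mathrm{i}a];\end{cases}$$ (ii) the symmetry condition $m(-k)=m(k)\begin{pmatrix}0&1\\1&0\end{pmatrix}$; (iii) the normalization condition $\lim_{k\to\mathrm{i}\infty}m(k)=(1\ \ 1)$. Specifically, $m^{\mathrm{mod}}(k)$ is continuous up to the boundary except at points of the set $\mathcal{G}=\{\mathrm{i}c,\mathrm{i}a,-\mathrm{i}a,-\mathrm{i}c\}$,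 where it has at most a fourth root singularity: $m^{\mathrm{mod}}(k)=O((k-\kappa)^{-1/4})$ as $k\to\kappa$, for $\kappa\in\mathcal{G}$.
   Context: Contour and boundary values: $[\mathrm{i}c,-\mathrm{i}c]$ is the segment of the imaginary axis oriented from $\mathrm{i}c$ down to $-\mathrm{i}c$, and similarly for its subsegments $[\mathrm{i}c,\mathrm{i}a]$, $[\mathrm{i}a,-\mathrm{i}a]$, $[-\mathrm{i}a,-\mathrm{i}c]$. The subscript $+$ (resp. $-$) denotes the boundary value from the left (resp. right) of the oriented contour, i.e. the limit from $\operatorname{Re}k>0$ (resp. $\operatorname{Re}k<0$). The function $\tilde\gamma$: $\tilde\gamma(k)=\sqrt[4]{\frac{k^2+a^2}{k^2+c^2}}$, with branch cuts along $[\mathrm{i}a,\mathrm{i}c]$ and $[-\mathrm{i}a,-\mathrm{i}c]$ and the branch chosen such that $\tilde\gamma(k)>0$ for $k=\mathrm{i}y$, $y>c$ (one then also has $\tilde\gamma(k)>0$ for $k\in\mathbb{R}$). The Riemann surface: $w(k)=\sqrt{(k^2+c^2)(k^2+a^2)}$, defined on $\mathbb{C}\setminus([-\mathrm{i}c,-\mathrm{i}a]\cup[\mathrm{i}a,\mathrm{i}c])$ with $w(0)>0$. $X$ is the compact two-sheeted elliptic Riemann surface associated with $w$, whose sheets are glued along these cuts. Its points are written $(k,\pm)$, with $(k,+)$ on the upper sheet (identified with $k$) and $(k,-)$ on the lower sheet; $\infty_\pm=(\infty,\pm)$. Put $\Gamma=\left(\int_{\mathbf{a}}\frac{d\zeta}{w(\zeta)}\right)^{-1}$,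 where $\mathbf{a}$ is the cycle surrounding $-\mathrm{i}a,\mathrm{i}a$ that runs on the upper sheet from the cut $[\mathrm{i}c,\mathrm{i}a]$ to the cut $[-\mathrm{i}a,-\mathrm{i}c]$ and returns on the lower sheet, so that $\int_{\mathbf{a}}\frac{d\zeta}{w}=2\int_{\mathrm{i}a}^{-\mathrm{i}a}\frac{d\zeta}{w(\zeta)}$ (upper-sheet integral on the right). Let $d\omega=\Gamma\,d\zeta/w(\zeta)$ and $\tau=\int_{\mathbf{b}}d\omega\in\mathrm{i}\mathbb{R}_+$, where $\mathbf{b}$ surrounds $\mathrm{i}a,\mathrm{i}c$ counterclockwise on the upper sheet. The Abel map: $A(k)=\int_{\mathrm{i}c}^{k}d\omega$ for $k\in\mathbb{C}\setminus[\mathrm{i}c,-\mathrm{i}c]$ on the upper sheet, with path of integration restricted to $\mathbb{C}\setminus[\mathrm{i}c,-\mathrm{i}c]$ (apart from the starting point). One has $A(\infty)=\tfrac14$. On the lower sheet $A((k,-))=-A((k,+))$. Theta functions: $\theta_3(z\,|\,\tau)=\sum_{n\in\mathbb{Z}}\exp\bigl((n^2\tau+2nz)\pi\mathrm{i}\bigr)$, and $$E_s(z)=\frac{\theta_3(z-\frac{\tilde\Lambda}{2}+\frac12\,|\,\tau)\,\theta_3(z-\frac{\tilde\Lambda}{2}\,|\,\tau)}{\theta_3(z+\frac12\,|\,\tau)\,\theta_3(z\,|\,\tau)},\qquad N_s(p)=E_s(A(p)).$$ Thus $N_s((k,\pm))=E_s(\pm A(k))$ and $N_s(\infty_+)=E_s(\tfrac14)$,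 which is nonzero for all real $\tilde\Lambda$.
   Formalization: Uniqueness is false as literally stated (factors 1+exp(k²), exp(1/k²)); here the normalization is the limit as k→∞ in all directions, and square integrable boundary values must also be attained in L² along the lines Re k=±ε, |Im k|≤R, for some R>c. *)

theory Defs
  imports "HOL-Complex_Analysis.Complex_Analysis" "HOL-Library.Landau_Symbols"
begin

definition contour :: "real \<Rightarrow> complex set" where
  "contour c = closed_segment (\<i> * c) (- \<i> * c)"

definition cuts :: "real \<Rightarrow> real \<Rightarrow> complex set" where
  "cuts a c = closed_segment (\<i> * a) (\<i> * c) \<union> closed_segment (- \<i> * a) (- \<i> * c)"

definition exceptional_points :: "real \<Rightarrow> real \<Rightarrow> complex set" where
  "exceptional_points a c = {\<i> * c, \<i> * a, - \<i> * a, - \<i> * c}"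


subsection \<open>The functions with branch cuts\<close>

text \<open>
  The quotient below takes values in the nonpositive reals (or has a vanishing denominator) only
  on the cuts, so the principal branches of the fourth root and of the square root of the quotient
  are holomorphic off the cuts; the lemmas at the end of this subsection confirm that the
  principal branches are the required ones.  The values on the cuts themselves are irrelevant.
\<close>

definition cut_ratio :: "real \<Rightarrow> real \<Rightarrow> complex \<Rightarrow> complex" where
  "cut_ratio a c k = (k\<^sup>2 + (complex_of_real a)\<^sup>2) / (k\<^sup>2 + (complex_of_real c)\<^sup>2)"

definition gamma_tilde :: "real \<Rightarrow> real \<Rightarrow> complex \<Rightarrow> complex" where
  "gamma_tilde a c k = cut_ratio a c k powr (1/4)"

definition w :: "real \<Rightarrow> real \<Rightarrow> complex \<Rightarrow> complex" where
  "w a c k = (k\<^sup>2 + (complex_of_real c)\<^sup>2) * csqrt (cut_ratio a c k)"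

lemma imaginary_in_cuts:
  assumes "0 < a" "a < c" "a \<le> s" "s \<le> c"
  shows "\<i> * complex_of_real s \<in> cuts a c" "- (\<i> * complex_of_real s) \<in> cuts a c"
proof -
  have "s \<in> closed_segment a c"
    using assms by (simp add: closed_segment_eq_real_ivl)
  then obtain u where u: "0 \<le> u" "u \<le> 1" "s = (1 - u) * a + u * c"
    by (auto simp: closed_segment_def)
  have "\<i> * complex_of_real s = (1 - u) *\<^sub>R (\<i> * a) + u *\<^sub>R (\<i> * c)"
    by (simp add: u(3) scaleR_conv_of_real algebra_simps)
  moreover have "- (\<i> * complex_of_real s) = (1 - u) *\<^sub>R (- \<i> * a) + u *\<^sub>R (- \<i> * c)"
    by (simp add: u(3) scaleR_conv_of_real algebra_simps)
  ultimately show "\<i> * complex_of_real s \<in> cuts a c" "- (\<i> * complex_of_real s) \<in> cuts a c"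
    unfolding cuts_def closed_segment_def using u(1,2) by blast+
qed

lemma off_cuts:
  assumes "0 < a" "a < c" "k \<notin> cuts a c"
  shows "k\<^sup>2 + (complex_of_real c)\<^sup>2 \<noteq> 0" "cut_ratio a c k \<notin> \<real>\<^sub>\<le>\<^sub>0"
proof -
  have no_root: "k\<^sup>2 + (complex_of_real s)\<^sup>2 \<noteq> 0" if "a \<le> s" "s \<le> c" for s
  proof
    assume "k\<^sup>2 + (complex_of_real s)\<^sup>2 = 0"
    then have "k\<^sup>2 = (\<i> * complex_of_real s)\<^sup>2"
      by (simp add: power_mult_distrib add_eq_0_iff2)
    then have "k = \<i> * complex_of_real s \<or> k = - (\<i> * complex_of_real s)"
      by (simp add: power2_eq_iff)
    then show False
      using imaginary_in_cuts[OF assms(1,2) that] assms(3) by auto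
  qed
  show nz: "k\<^sup>2 + (complex_of_real c)\<^sup>2 \<noteq> 0"
    using no_root[of c] assms by simp
  show "cut_ratio a c k \<notin> \<real>\<^sub>\<le>\<^sub>0"
  proof
    assume "cut_ratio a c k \<in> \<real>\<^sub>\<le>\<^sub>0"
    then obtain r where r: "cut_ratio a c k = complex_of_real r" "r \<le> 0"
      by (auto elim!: nonpos_Reals_cases)
    define s where "s = sqrt ((a\<^sup>2 - r * c\<^sup>2) / (1 - r))"
    have "a\<^sup>2 \<le> c\<^sup>2" using assms by (simp add: power_mono)
    have "r * c\<^sup>2 \<le> r * a\<^sup>2" using \<open>a\<^sup>2 \<le> c\<^sup>2\<close> r(2) by (rule mult_left_mono_neg)
    then have lo: "a\<^sup>2 \<le> (a\<^sup>2 - r * c\<^sup>2) / (1 - r)"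
      using r(2) by (simp add: field_simps)
    have hi: "(a\<^sup>2 - r * c\<^sup>2) / (1 - r) \<le> c\<^sup>2"
      using r(2) \<open>a\<^sup>2 \<le> c\<^sup>2\<close> by (simp add: field_simps)
    have s: "a \<le> s" "s \<le> c"
      using lo hi assms unfolding s_def by (auto intro: real_le_rsqrt real_le_lsqrt)
    have s2: "s\<^sup>2 = (a\<^sup>2 - r * c\<^sup>2) / (1 - r)"
      unfolding s_def using lo by (meson order_trans real_sqrt_pow2 zero_le_power2)
    then have "(1 - r) * s\<^sup>2 = a\<^sup>2 - r * c\<^sup>2"
      using r(2) by simp
    then have C: "(1 - complex_of_real r) * (complex_of_real s)\<^sup>2
        = (complex_of_real a)\<^sup>2 - complex_of_real r * (complex_of_real c)\<^sup>2"
      by (metis of_real_1 of_real_diff of_real_mult of_real_power)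
    have "k\<^sup>2 + (complex_of_real a)\<^sup>2 = complex_of_real r * (k\<^sup>2 + (complex_of_real c)\<^sup>2)"
      using r(1) nz by (simp add: cut_ratio_def field_simps)
    then have "(1 - complex_of_real r) * (k\<^sup>2 + (complex_of_real s)\<^sup>2) = 0"
      unfolding distrib_left C by (simp add: algebra_simps)
    moreover have "1 - complex_of_real r \<noteq> 0"
      using r(2) by (metis eq_iff_diff_eq_0 not_one_le_zero of_real_eq_1_iff)
    ultimately show False using no_root[OF s] by simp
  qed
qed

lemma cut_ratio_holomorphic:
  assumes "0 < a" "a < c"
  shows "cut_ratio a c holomorphic_on - cuts a c"
  unfolding cut_ratio_def using off_cuts(1)[OF assms] by (auto intro!: holomorphic_intros)

lemma gamma_tilde_branch:
  assumes "0 < a" "a < c"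
  shows "gamma_tilde a c holomorphic_on - cuts a c"
    and "gamma_tilde a c k ^ 4 = cut_ratio a c k"
    and "y > c \<Longrightarrow> \<exists>r>0. gamma_tilde a c (\<i> * complex_of_real y) = complex_of_real r"
proof -
  show "gamma_tilde a c holomorphic_on - cuts a c"
    unfolding gamma_tilde_def
    using off_cuts(2)[OF assms]
    by (intro holomorphic_on_powr cut_ratio_holomorphic[OF assms] holomorphic_on_const) auto
  show "gamma_tilde a c k ^ 4 = cut_ratio a c k"
    by (cases "cut_ratio a c k = 0") (simp_all add: gamma_tilde_def powr_def flip: exp_of_nat_mult)
  assume y: "y > c"
  define r where "r = (y\<^sup>2 - a\<^sup>2) / (y\<^sup>2 - c\<^sup>2)"
  have "c\<^sup>2 < y\<^sup>2" "a\<^sup>2 < y\<^sup>2" using y assms by (auto intro: power_strict_mono)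
  then have "r > 0" by (simp add: r_def)
  have "r = (a\<^sup>2 - y\<^sup>2) / (c\<^sup>2 - y\<^sup>2)"
    using minus_divide_divide[of "y\<^sup>2 - a\<^sup>2" "y\<^sup>2 - c\<^sup>2"] by (simp add: r_def)
  then have "cut_ratio a c (\<i> * complex_of_real y) = complex_of_real r"
    by (simp add: cut_ratio_def power_mult_distrib)
  then have "gamma_tilde a c (\<i> * complex_of_real y) = complex_of_real (r powr (1/4))"
    using \<open>r > 0\<close> powr_of_real[of r "1/4"] by (simp add: gamma_tilde_def)
  then show "\<exists>r>0. gamma_tilde a c (\<i> * complex_of_real y) = complex_of_real r"
    using \<open>r > 0\<close> by (intro exI[of _ "r powr (1/4)"]) simp
qed

lemma w_branch:
  assumes "0 < a" "a < c"
  shows "w a c holomorphic_on - cuts a c"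
    and "k \<notin> cuts a c \<Longrightarrow>
      (w a c k)\<^sup>2 = (k\<^sup>2 + (complex_of_real c)\<^sup>2) * (k\<^sup>2 + (complex_of_real a)\<^sup>2)"
    and "w a c 0 = complex_of_real (a * c)"
proof -
  have "(\<lambda>k. csqrt (cut_ratio a c k)) holomorphic_on - cuts a c"
    using off_cuts(2)[OF assms]
    by (intro holomorphic_on_csqrt' cut_ratio_holomorphic[OF assms]) auto
  then show "w a c holomorphic_on - cuts a c"
    unfolding w_def by (intro holomorphic_on_mult) (auto intro!: holomorphic_intros)
  show "(w a c k)\<^sup>2 = (k\<^sup>2 + (complex_of_real c)\<^sup>2) * (k\<^sup>2 + (complex_of_real a)\<^sup>2)"
    if "k \<notin> cuts a c"
    using off_cuts(1)[OF assms that]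
    by (simp add: w_def power_mult_distrib) (simp add: cut_ratio_def power2_eq_square)
  have "cut_ratio a c 0 = complex_of_real ((a / c)\<^sup>2)"
    by (simp add: cut_ratio_def power_divide)
  then have "csqrt (cut_ratio a c 0) = complex_of_real (a / c)"
    using assms by (simp add: of_real_sqrt)
  then show "w a c 0 = complex_of_real (a * c)"
    using assms by (simp add: w_def power2_eq_square)
qed


subsection \<open>Periods, Abel map and theta quotient\<close>

text \<open>
  The \<open>a\<close>-period is twice the integral over the upper-sheet half of the cycle, from
  \<open>\<i>a\<close> to \<open>-\<i>a\<close>.  The \<open>b\<close>-cycle is the circle with centre \<open>\<i>(a+c)/2\<close> and radius \<open>c/2\<close>:
  since \<open>(c-a)/2 < c/2 < (a+c)/2\<close> it encloses \<open>\<i>a\<close> and \<open>\<i>c\<close> and stays in the upper half-plane.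
\<close>

definition Gam :: "real \<Rightarrow> real \<Rightarrow> complex" where
  "Gam a c = inverse (2 * contour_integral (linepath (\<i> * a) (- \<i> * a)) (\<lambda>\<zeta>. 1 / w a c \<zeta>))"

definition d_omega :: "real \<Rightarrow> real \<Rightarrow> complex \<Rightarrow> complex" where
  "d_omega a c \<zeta> = Gam a c / w a c \<zeta>"

definition tau :: "real \<Rightarrow> real \<Rightarrow> complex" where
  "tau a c = contour_integral (circlepath (\<i> * ((a + c) / 2)) (c / 2)) (d_omega a c)"

text \<open>
  The integral from \<open>\<i>c\<close> to \<open>k\<close> along any path that leaves the contour immediately; it does not
  depend on the path, because \<open>d_omega\<close> has no residue at infinity.
\<close>

definition abel_upper :: "real \<Rightarrow> real \<Rightarrow> complex \<Rightarrow> complex" where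
  "abel_upper a c k = (THE v. \<exists>g. valid_path g \<and> pathstart g = \<i> * c \<and> pathfinish g = k \<and>
     (\<forall>t\<in>{0<..1}. g t \<notin> contour c) \<and> (d_omega a c has_contour_integral v) g)"

datatype sheet = Upper | Lower

text \<open>
  Points of the compact Riemann surface: \<open>Over k s\<close> is the point over \<open>k\<close>, not on the contour,
  on the sheet \<open>s\<close>, and \<open>At_infinity s\<close> is the point at infinity of that sheet.  Points over the
  contour are not needed.
\<close>

datatype surface_point = Over complex sheet | At_infinity sheet

fun abel :: "real \<Rightarrow> real \<Rightarrow> surface_point \<Rightarrow> complex" where
  "abel a c (Over k Upper) = abel_upper a c k"
| "abel a c (Over k Lower) = - abel_upper a c k"
| "abel a c (At_infinity Upper) = Lim at_infinity (abel_upper a c)"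
| "abel a c (At_infinity Lower) = - Lim at_infinity (abel_upper a c)"

definition theta3 :: "complex \<Rightarrow> complex \<Rightarrow> complex" where
  "theta3 z t = (\<Sum>\<^sub>\<infinity>n::int. exp (((of_int n)\<^sup>2 * t + 2 * of_int n * z) * (of_real pi * \<i>)))"

definition E_s :: "real \<Rightarrow> real \<Rightarrow> real \<Rightarrow> complex \<Rightarrow> complex" where
  "E_s a c \<Lambda> z =
     (theta3 (z - of_real \<Lambda> / 2 + 1/2) (tau a c) * theta3 (z - of_real \<Lambda> / 2) (tau a c)) /
     (theta3 (z + 1/2) (tau a c) * theta3 z (tau a c))"

definition N_s :: "real \<Rightarrow> real \<Rightarrow> real \<Rightarrow> surface_point \<Rightarrow> complex" where
  "N_s a c \<Lambda> p = E_s a c \<Lambda> (abel a c p)"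

definition m_mod :: "real \<Rightarrow> real \<Rightarrow> real \<Rightarrow> complex \<Rightarrow> complex ^ 2" where
  "m_mod a c \<Lambda> k = (gamma_tilde a c k / N_s a c \<Lambda> (At_infinity Upper)) *s
     vector [N_s a c \<Lambda> (Over k Upper), N_s a c \<Lambda> (Over k Lower)]"


subsection \<open>The Riemann-Hilbert problem\<close>

text \<open>
  The contour runs downwards, so its left (\<open>+\<close>) side is the right half-plane: the sign
  \<open>s = 1\<close> stands for \<open>+\<close> and \<open>s = -1\<close> for \<open>-\<close>.
\<close>

definition side :: "real \<Rightarrow> complex set" where
  "side s = {z. 0 < s * Re z}"

definition boundary_value :: "real \<Rightarrow> (complex \<Rightarrow> complex ^ 2) \<Rightarrow> complex \<Rightarrow> complex ^ 2" where
  "boundary_value s m k = Lim (at k within side s) m"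

abbreviation "boundary_plus \<equiv> boundary_value 1"
abbreviation "boundary_minus \<equiv> boundary_value (- 1)"

text \<open>
  Square integrable boundary values are understood as usual for Riemann-Hilbert problems in
  \<open>L\<^sup>2\<close>: the boundary values exist almost everywhere, are square integrable, and are also attained
  in \<open>L\<^sup>2\<close> along the parallel lines \<open>Re k = s \<epsilon>\<close>.  The last part cannot be dropped: multiplying a
  solution by an even function \<open>f\<close> without a jump preserves the jump and symmetry conditions,
  and \<open>f k = exp (1 / k\<^sup>2)\<close> is bounded on the imaginary axis and tends to 1 at infinity.  The lines
  extend beyond the end points of the contour (\<open>R > c\<close>), because for \<open>R = c\<close> they would not
  exclude the factor \<open>exp (\<i> / (k - \<i>c) - \<i> / (k + \<i>c))\<close>, which is bounded for \<open>\<bar>Im k\<bar> \<le> c\<close>.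
\<close>

definition L2_boundary_values :: "real \<Rightarrow> real \<Rightarrow> (complex \<Rightarrow> complex ^ 2) \<Rightarrow> bool" where
  "L2_boundary_values R s m \<longleftrightarrow>
     (AE y in lebesgue. \<bar>y\<bar> \<le> R \<longrightarrow>
        (m \<longlongrightarrow> boundary_value s m (Complex 0 y)) (at (Complex 0 y) within side s)) \<and>
     (\<integral>\<^sup>+y\<in>{-R..R}. ennreal ((norm (boundary_value s m (Complex 0 y)))\<^sup>2) \<partial>lebesgue) < \<infinity> \<and>
     ((\<lambda>\<epsilon>. \<integral>\<^sup>+y\<in>{-R..R}. ennreal ((norm (m (Complex (s * \<epsilon>) y) -
          boundary_value s m (Complex 0 y)))\<^sup>2) \<partial>lebesgue) \<longlongrightarrow> 0) (at_right 0)"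

definition square_integrable_boundary_values :: "real \<Rightarrow> (complex \<Rightarrow> complex ^ 2) \<Rightarrow> bool" where
  "square_integrable_boundary_values c m \<longleftrightarrow>
     (\<exists>R>c. L2_boundary_values R 1 m \<and> L2_boundary_values R (- 1) m)"

text \<open>The three segments overlap only at the exceptional points \<open>\<plusminus>\<i>a\<close>.\<close>

definition v_mod :: "real \<Rightarrow> real \<Rightarrow> real \<Rightarrow> complex \<Rightarrow> complex ^ 2 ^ 2" where
  "v_mod a c \<Lambda> k =
     (if k \<in> closed_segment (\<i> * c) (\<i> * a) then vector [vector [0, \<i>], vector [\<i>, 0]]
      else if k \<in> closed_segment (- \<i> * a) (- \<i> * c)
        then vector [vector [0, - \<i>], vector [- \<i>, 0]]
      else vector [vector [exp (- 2 * pi * \<i> * \<Lambda>), 0], vector [0, exp (2 * pi * \<i> * \<Lambda>)]])"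

text \<open>
  Functions are only considered on the complement of the contour.  The jump condition for the
  square integrable boundary values is required almost everywhere.  The normalization is a limit
  at the point \<open>\<infinity>\<close> of the Riemann sphere (through all directions): with a limit along the
  imaginary axis only, the factor \<open>1 + exp (k\<^sup>2)\<close> would destroy uniqueness.
\<close>

definition model_RHP_solution :: "real \<Rightarrow> real \<Rightarrow> real \<Rightarrow> (complex \<Rightarrow> complex ^ 2) \<Rightarrow> bool" where
  "model_RHP_solution a c \<Lambda> m \<longleftrightarrow>
     (\<forall>j. (\<lambda>k. m k $ j) holomorphic_on - contour c) \<and>
     square_integrable_boundary_values c m \<and>
     (AE y in lebesgue. \<bar>y\<bar> \<le> c \<longrightarrow>
        boundary_plus m (Complex 0 y) =
          boundary_minus m (Complex 0 y) v* v_mod a c \<Lambda> (Complex 0 y)) \<and>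
     (\<forall>k\<in>- contour c. m (- k) = m k v* vector [vector [0, 1], vector [1, 0]]) \<and>
     (m \<longlongrightarrow> vector [1, 1]) at_infinity"

definition continuous_up_to_boundary_except ::
    "real \<Rightarrow> complex set \<Rightarrow> (complex \<Rightarrow> complex ^ 2) \<Rightarrow> bool" where
  "continuous_up_to_boundary_except c G m \<longleftrightarrow>
     (\<exists>mp mm. continuous_on ({k. 0 \<le> Re k} - G) mp \<and> continuous_on ({k. Re k \<le> 0} - G) mm \<and>
        (\<forall>k\<in>- contour c. (0 \<le> Re k \<longrightarrow> mp k = m k) \<and> (Re k \<le> 0 \<longrightarrow> mm k = m k)))"

end

theory Submission
  imports Defs "HOL-Real_Asymp.Real_Asymp"
begin

text \<open>
  The model problem is solved on the elliptic curve w^2 = (k^2 + c^2)(k^2 + a^2); the two components of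
  a solution are the values of one function on the two sheets.

  For existence, all multivalued functions have explicit branches on the right half-plane, products and
  quotients of principal roots of \<open>k - \<kappa>\<close> for the four branch points \<open>\<kappa>\<close>, which extend continuously to the
  imaginary axis; the left half-plane is reached through the symmetry \<open>k \<mapsto> - k\<close>. A primitive of
  \<open>1 / w\<close> that vanishes at infinity is automatically odd and real. Its boundary values on the imaginary
  axis are read off from the phase of \<open>w\<close> there, and they give the periods, the Abel map, and its
  jumps: it changes sign across the two cuts, which exchanges the components, and it jumps by \<open>\<tau>\<close>
  across the middle segment. The quotient \<open>E_s\<close> picks up the factor
  \<open>exp (2 \<pi> \<i> \<Lambda>)\<close> under a shift by \<open>\<tau>\<close>, and \<open>gamma_tilde\<close> contributes the factors \<open>\<plusminus> \<i>\<close> on the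
  cuts; together they give \<open>m_mod_jump\<close>. The Abel map sends the right half-plane into the strip
  \<open>\<bar>Im z\<bar> < Im \<tau> / 2\<close> (\<open>Im_Ab_less\<close>), where the theta function has no zeros
  (\<open>theta3_zero_free_strip\<close>). On the boundary of the strip the zeros are met only at
  \<open>k = \<i>a, - \<i>a\<close>. There the denominator has a simple zero (\<open>theta3_simple_zero\<close>) and the Abel map
  behaves like a square root, so \<open>E_s\<close> grows at most like the power \<open>-1/2\<close> of the distance, and the
  zero of \<open>gamma_tilde\<close> of order \<open>1/4\<close> leaves a fourth root singularity. At \<open>\<i>c, - \<i>c\<close> the
  singularity is that of \<open>gamma_tilde\<close>.

  The zeros of theta are located without the product formula: the doubling identity \<open>theta3_doubling\<close> transports a zero
  for \<open>t\<close> to a zero for \<open>2 t\<close>. After iteration the theta series is dominated by its three central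
  terms, and a zero can survive only if two of them cancel in the limit.

  For uniqueness, a function that is holomorphic off the contour, vanishes at infinity and has the same
  \<open>L^1\<close> boundary values from both sides is zero (\<open>L1_no_jump_vanishes\<close>); products of two components
  with \<open>L^2\<close> boundary values are of this kind up to their jump. For two solutions \<open>m, m'\<close> the
  determinant of the matrix with rows \<open>m\<close> and \<open>m'\<close> has no jump, because every jump matrix has
  determinant 1, and it vanishes at infinity by the normalization; so it is zero. With the symmetry this
  forces the difference \<open>n = m - m'\<close> to be \<open>o(1 / k)\<close> at infinity. Then \<open>n\<^sub>1 n\<^sub>2 w\<close> has no jump
  and vanishes at infinity, so \<open>n\<^sub>1 n\<^sub>2 = 0\<close>, and by the identity theorem and the symmetry \<open>n = 0\<close>.
\<close>

section \<open>The theta function\<close>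

definition theta_term :: "complex \<Rightarrow> complex \<Rightarrow> int \<Rightarrow> complex" where
  "theta_term z t n = exp (((of_int n)\<^sup>2 * t + 2 * of_int n * z) * (of_real pi * \<i>))"

lemma theta3_eq_infsum: "theta3 z t = (\<Sum>\<^sub>\<infinity>n. theta_term z t n)"
  by (simp add: theta3_def theta_term_def)

lemma norm_theta_term:
  "norm (theta_term z t n) = exp (- pi * ((of_int n)\<^sup>2 * Im t + 2 * of_int n * Im z))"
  by (simp add: theta_term_def power2_eq_square algebra_simps)

lemma summable_on_geometric_int:
  fixes r :: real
  assumes "0 \<le> r" "r < 1"
  shows "(\<lambda>n::int. r ^ nat \<bar>n\<bar>) summable_on UNIV"
proof -
  have S: "(\<lambda>n. r ^ n) summable_on UNIV"
    using assms by (simp add: summable_on_UNIV_nonneg_real_iff summable_geometric)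
  have 1: "(\<lambda>n::int. r ^ nat \<bar>n\<bar>) summable_on (range int)"
    using S by (subst summable_on_reindex) (auto simp: o_def)
  have 2: "(\<lambda>n::int. r ^ nat \<bar>n\<bar>) summable_on (range (\<lambda>n. - int n))"
    using S by (subst summable_on_reindex) (auto simp: o_def inj_def)
  have "UNIV = range int \<union> range (\<lambda>n. - int n)"
    by (auto simp: image_iff) (metis int_cases4)
  then show ?thesis
    using summable_on_union[OF 1 2] by simp
qed

text \<open>
  Completing the square in \<open>n\<close> bounds the exponent from below by \<open>\<bar>n\<bar>\<close> up to a constant. The resulting
  geometric majorant is uniform in strips, which gives holomorphy by the Weierstrass test.
\<close>

lemma norm_theta_term_le:
  assumes "Im t > 0" "\<bar>Im z\<bar> \<le> K"
  shows "norm (theta_term z t n) \<le> exp (pi * ((2 * K + 1)\<^sup>2 / (4 * Im t))) * exp (- pi) ^ nat \<bar>n\<bar>"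
proof -
  define s where "s = Im t"
  define N where "N = \<bar>real_of_int n\<bar>"
  have s: "s > 0" using assms by (simp add: s_def)
  have "- (n * Im z) \<le> N * K"
  proof -
    have "\<bar>n * Im z\<bar> \<le> N * K"
      unfolding abs_mult N_def using assms(2) by (intro mult_left_mono) auto
    then show ?thesis by linarith
  qed
  moreover have "(of_int n)\<^sup>2 = N\<^sup>2" by (simp add: N_def)
  moreover have "0 \<le> s * (N - (2 * K + 1) / (2 * s))\<^sup>2" using s by simp
  moreover have "s * (N - (2 * K + 1) / (2 * s))\<^sup>2
      = N\<^sup>2 * s - (2 * K + 1) * N + (2 * K + 1)\<^sup>2 / (4 * s)"
    using s by (simp add: power2_eq_square divide_simps) (simp add: algebra_simps)
  ultimately have "N - (2 * K + 1)\<^sup>2 / (4 * s) \<le> (of_int n)\<^sup>2 * s + 2 * of_int n * Im z"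
    by (simp add: algebra_simps)
  then have "- pi * ((of_int n)\<^sup>2 * s + 2 * of_int n * Im z)
      \<le> - pi * (N - (2 * K + 1)\<^sup>2 / (4 * s))"
    by (intro mult_left_mono_neg) auto
  also have "\<dots> = pi * ((2 * K + 1)\<^sup>2 / (4 * s)) + of_nat (nat \<bar>n\<bar>) * (- pi)"
    by (simp add: N_def algebra_simps)
  finally show ?thesis
    unfolding norm_theta_term exp_of_nat_mult[symmetric] exp_add[symmetric]
    by (simp add: s_def)
qed

lemma theta_term_majorant_summable: "(\<lambda>n::int. C * exp (- pi) ^ nat \<bar>n\<bar>) summable_on UNIV"
  by (intro summable_on_cmult_right summable_on_geometric_int) auto

lemma theta_term_abs_summable:
  assumes "Im t > 0"
  shows "(\<lambda>n. norm (theta_term z t n)) summable_on UNIV"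
  using norm_theta_term_le[OF assms order_refl, of z]
  by (intro Infinite_Sum.abs_summable_on_comparison_test'[OF theta_term_majorant_summable]) blast

lemma theta_term_summable: "Im t > 0 \<Longrightarrow> theta_term z t summable_on UNIV"
  using theta_term_abs_summable abs_summable_summable by blast

lemma theta3_holomorphic:
  assumes "Im t > 0"
  shows "(\<lambda>z. theta3 z t) holomorphic_on A"
proof -
  have "(\<lambda>z. theta3 z t) holomorphic_on ball z 1" for z
  proof -
    have "uniform_limit (cball z 1) (\<lambda>X z. \<Sum>n\<in>X. theta_term z t n)
        (\<lambda>z. \<Sum>\<^sub>\<infinity>n. theta_term z t n) (finite_subsets_at_top UNIV)"
    proof (rule Weierstrass_m_test_general[OF _ theta_term_majorant_summable])
      fix n x assume "x \<in> cball z 1"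
      then have "norm (x - z) \<le> 1"
        by (simp add: dist_norm norm_minus_commute)
      then have "\<bar>Im x\<bar> \<le> \<bar>Im z\<bar> + 1"
        using abs_Im_le_cmod[of "x - z"] by simp
      then show "norm (theta_term x t n)
          \<le> exp (pi * ((2 * (\<bar>Im z\<bar> + 1) + 1)\<^sup>2 / (4 * Im t))) * exp (- pi) ^ nat \<bar>n\<bar>"
        by (rule norm_theta_term_le[OF assms])
    qed
    moreover have "\<forall>\<^sub>F X in finite_subsets_at_top UNIV.
        continuous_on (cball z 1) (\<lambda>z. \<Sum>n\<in>X. theta_term z t n) \<and>
        (\<lambda>z. \<Sum>n\<in>X. theta_term z t n) holomorphic_on ball z 1"
      unfolding theta_term_def
      by (intro always_eventually allI conjI continuous_intros holomorphic_intros)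
    ultimately show ?thesis
      unfolding theta3_eq_infsum
      by (elim holomorphic_uniform_limit[rotated]) auto
  qed
  then have "(\<lambda>z. theta3 z t) field_differentiable at z" for z
    by (rule holomorphic_on_imp_differentiable_at[of _ "ball z 1"]) auto
  then have "(\<lambda>z. theta3 z t) holomorphic_on UNIV"
    by (simp add: holomorphic_on_def)
  then show ?thesis
    using holomorphic_on_subset by blast
qed

lemma exp_of_int_2pi: "exp (2 * of_int n * (of_real pi * \<i>)) = 1"
  by (auto simp: exp_eq_1)

lemma theta3_plus_1: "theta3 (z + 1) t = theta3 z t"
proof -
  have "theta_term (z + 1) t n = theta_term z t n" for n
  proof -
    have "theta_term (z + 1) t n = theta_term z t n * exp (2 * of_int n * (of_real pi * \<i>))"
      by (simp add: theta_term_def flip: exp_add) (simp add: algebra_simps)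
    then show ?thesis by (simp add: exp_of_int_2pi)
  qed
  then show ?thesis by (simp add: theta3_eq_infsum)
qed

lemma theta3_minus: "theta3 (- z) t = theta3 z t"
proof -
  have "theta3 (- z) t = (\<Sum>\<^sub>\<infinity>n. theta_term (- z) t (- n))"
    unfolding theta3_eq_infsum
    by (rule infsum_reindex_bij_witness[of _ uminus uminus]) auto
  also have "\<dots> = theta3 z t"
    by (simp add: theta3_eq_infsum theta_term_def)
  finally show ?thesis .
qed

lemma theta3_plus_period:
  "theta3 (z + t) t = exp (- (t + 2 * z) * (of_real pi * \<i>)) * theta3 z t"
proof -
  have "theta3 (z + t) t = (\<Sum>\<^sub>\<infinity>n. exp (- (t + 2 * z) * (of_real pi * \<i>)) * theta_term z t (n + 1))"
    unfolding theta3_eq_infsum theta_term_def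
    by (intro infsum_cong)
      (simp flip: exp_add add: algebra_simps power2_eq_square)
  also have "\<dots> = exp (- (t + 2 * z) * (of_real pi * \<i>)) * (\<Sum>\<^sub>\<infinity>n. theta_term z t (n + 1))"
    by (rule infsum_cmult_right')
  also have "(\<Sum>\<^sub>\<infinity>n. theta_term z t (n + 1)) = theta3 z t"
    unfolding theta3_eq_infsum
    by (rule infsum_reindex_bij_witness[of _ "\<lambda>n. n - 1" "\<lambda>n. n + 1"]) auto
  finally show ?thesis .
qed

lemma theta3_zero: "theta3 (1/2 + t/2) t = 0"
proof -
  have "theta3 (1/2 + t/2) t = theta3 (- (1/2 + t/2) + 1 + t) t"
    by (simp add: algebra_simps)
  also have "\<dots> = exp (- (t + 2 * (- (1/2 + t/2) + 1)) * (of_real pi * \<i>)) * theta3 (- (1/2 + t/2) + 1) t"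
    by (rule theta3_plus_period)
  also have "- (t + 2 * (- (1/2 + t/2) + 1)) * (of_real pi * \<i>) = - (of_real pi * \<i>)"
    by (simp add: field_simps)
  also have "exp (- (of_real pi * \<i>)) = -1"
    by (simp add: exp_minus mult.commute)
  also have "theta3 (- (1/2 + t/2) + 1) t = theta3 (1/2 + t/2) t"
    by (simp only: theta3_plus_1 theta3_minus)
  finally show ?thesis by simp
qed

lemma infsum_mult_pair:
  fixes f :: "'a \<Rightarrow> complex" and g :: "'b \<Rightarrow> complex"
  assumes "(\<lambda>x. norm (f x)) summable_on A" "(\<lambda>y. norm (g y)) summable_on B"
  shows "(\<lambda>(x, y). f x * g y) summable_on A \<times> B"
    and "(\<Sum>\<^sub>\<infinity>(x, y)\<in>A \<times> B. f x * g y) = infsum f A * infsum g B"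
proof -
  have "(\<lambda>p. norm ((\<lambda>(x, y). f x * g y) p)) summable_on A \<times> B"
    using assms
    by (subst Infinite_Sum.abs_summable_on_Sigma_iff)
      (auto simp: norm_mult abs_mult infsum_nonneg infsum_cmult_right'
         intro!: summable_on_cmult_right summable_on_cmult_left)
  then show S: "(\<lambda>(x, y). f x * g y) summable_on A \<times> B"
    by (rule abs_summable_summable)
  show "(\<Sum>\<^sub>\<infinity>(x, y)\<in>A \<times> B. f x * g y) = infsum f A * infsum g B"
    using infsum_Sigma_banach[OF S] by (simp add: infsum_cmult_right' infsum_cmult_left')
qed

text \<open>
  Expand the left side into a double series over \<open>(m, n)\<close>; compared with \<open>theta3 z t * theta3 z t\<close> the
  summands carry the sign of \<open>(-1)^n\<close>. For odd \<open>m + n\<close> the summands at \<open>(m, n)\<close> and \<open>(n, m)\<close> are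
  opposite. For even \<open>m + n\<close> put \<open>m = j + l\<close> and \<open>n = j - l\<close>: the exponent separates, since
  \<open>m\<^sup>2 + n\<^sup>2 = 2 j\<^sup>2 + 2 l\<^sup>2\<close>, and \<open>(-1)^n = (-1)^j (-1)^l\<close>.
\<close>

lemma theta3_doubling:
  assumes "Im t > 0"
  shows "theta3 z t * theta3 (z + 1/2) t = theta3 (1/2) (2 * t) * theta3 (2 * z + 1/2) (2 * t)"
proof -
  define F where "F = (\<lambda>(m, n). theta_term z t m * theta_term (z + 1/2) t n)"
  define E where "E = {(m::int, n::int). even (m + n)}"
  define D where "D = {(m::int, n::int). odd (m + n)}"
  define e where "e n = exp (of_int n * (of_real pi * \<i>))" for n :: int
  have e: "e n = (if even n then 1 else - 1)" for n
  proof (cases "even n")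
    case True
    then obtain m where "n = 2 * m" by blast
    then show ?thesis using exp_of_int_2pi[of m] by (simp add: e_def)
  next
    case False
    then obtain m where m: "n = 2 * m + 1" using oddE by blast
    have "e n = exp (2 * of_int m * (of_real pi * \<i>)) * exp (of_real pi * \<i>)"
      by (simp add: e_def m algebra_simps flip: exp_add)
    then show ?thesis using False by (simp only: exp_of_int_2pi exp_pi_i) simp
  qed
  have F: "F (m, n) = theta_term z t m * theta_term z t n * e n" for m n
    by (simp add: F_def theta_term_def e_def flip: exp_add) (simp add: algebra_simps)
  have "F summable_on UNIV \<times> UNIV" and prod: "infsum F (UNIV \<times> UNIV) = theta3 z t * theta3 (z + 1/2) t"
    unfolding F_def theta3_eq_infsum
    by (intro infsum_mult_pair theta_term_abs_summable assms)+
  then have S: "F summable_on A" for A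
    using summable_on_subset_banach by fastforce
  have split: "infsum F (UNIV \<times> UNIV) = infsum F E + infsum F D"
  proof -
    have "UNIV \<times> UNIV = E \<union> D" "E \<inter> D = {}" by (auto simp: E_def D_def)
    then show ?thesis using infsum_Un_disjoint[OF S S, of E D] by simp
  qed
  have "infsum F D = (\<Sum>\<^sub>\<infinity>p\<in>D. F (prod.swap p))"
    by (rule infsum_reindex_bij_witness[of _ prod.swap prod.swap]) (auto simp: D_def)
  also have "\<dots> = (\<Sum>\<^sub>\<infinity>p\<in>D. - F p)"
    by (intro infsum_cong) (auto simp: D_def F e)
  finally have "infsum F D = - infsum F D" by (simp add: infsum_uminus)
  then have D0: "infsum F D = 0" by (simp add: eq_neg_iff_add_eq_0)
  have half: "(m + n) div 2 + (m - n) div 2 = m" "(m + n) div 2 - (m - n) div 2 = n"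
    if "even m \<longleftrightarrow> even n" for m n :: int
    using that by presburger+
  have "infsum F E = (\<Sum>\<^sub>\<infinity>(l, j)\<in>UNIV \<times> UNIV. F (j + l, j - l))"
    by (rule infsum_reindex_bij_witness[of _ "\<lambda>(l, j). (j + l, j - l)" "\<lambda>(m, n). ((m - n) div 2, (m + n) div 2)"])
       (auto simp: E_def half)
  also have "\<dots> = (\<Sum>\<^sub>\<infinity>(l, j)\<in>UNIV \<times> UNIV. theta_term (1/2) (2 * t) l * theta_term (2 * z + 1/2) (2 * t) j)"
  proof (intro infsum_cong, safe)
    fix l j :: int
    have "theta_term (1/2) (2 * t) l * theta_term (2 * z + 1/2) (2 * t) j
        = F (j + l, j - l) * exp (2 * of_int l * (of_real pi * \<i>))"
      unfolding F_def theta_term_def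
      by (simp flip: exp_add) (simp add: algebra_simps power2_eq_square)
    then show "F (j + l, j - l) = theta_term (1/2) (2 * t) l * theta_term (2 * z + 1/2) (2 * t) j"
      by (simp add: exp_of_int_2pi)
  qed
  also have "\<dots> = theta3 (1/2) (2 * t) * theta3 (2 * z + 1/2) (2 * t)"
    unfolding theta3_eq_infsum using assms by (intro infsum_mult_pair theta_term_abs_summable) auto
  finally show ?thesis using prod split D0 by simp
qed

text \<open>
  The terms with \<open>\<bar>n\<bar> \<ge> 2\<close> are dominated by a geometric series of ratio \<open>exp (- pi * (Im t - 2))\<close>.
  The strip exceeds \<open>\<bar>Im z\<bar> \<le> Im t / 2\<close> by 1 to leave room for a Cauchy estimate on unit discs
  around its boundary points.
\<close>

lemma theta3_approx:
  "\<exists>K. \<forall>z t. 3 \<le> Im t \<longrightarrow> \<bar>Im z\<bar> \<le> Im t / 2 + 1 \<longrightarrow>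
      norm (theta3 z t - (1 + theta_term z t 1 + theta_term z t (- 1))) \<le> K * exp (- pi * (Im t - 2))"
proof -
  define g where "g n = (1/2::real) ^ nat \<bar>n\<bar>" for n :: int
  have gS: "g summable_on A" for A
    unfolding g_def by (rule summable_on_subset_banach[OF summable_on_geometric_int subset_UNIV]) auto
  show ?thesis
  proof (intro exI[of _ "2 * infsum g UNIV"] allI impI)
    fix z t :: complex
    assume t: "3 \<le> Im t" and z: "\<bar>Im z\<bar> \<le> Im t / 2 + 1"
    define s where "s = Im t"
    define \<rho> where "\<rho> = exp (- pi * (s - 2))"
    define S where "S = {-1, 0, 1::int}"
    have "\<rho> \<le> exp (- pi)" using t by (simp add: \<rho>_def s_def)
    also have "exp (- pi) \<le> 1/2"
    proof -
      have "2 \<le> exp pi" using exp_ge_add_one_self[of pi] pi_gt3 by linarith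
      then show ?thesis by (simp add: exp_minus field_simps)
    qed
    finally have \<rho>: "0 < \<rho>" "\<rho> \<le> 1/2" by (auto simp: \<rho>_def)
    have bound: "norm (theta_term z t n) \<le> 2 * \<rho> * g n" if "n \<in> UNIV - S" for n
    proof -
      define N where "N = nat \<bar>n\<bar>"
      have N: "N \<ge> 2" using that by (auto simp: S_def N_def)
      have Nn: "(of_int n)\<^sup>2 = (real N)\<^sup>2" "\<bar>real_of_int n\<bar> = real N" by (simp_all add: N_def)
      have "- (of_int n * Im z) \<le> real N * (s / 2 + 1)"
      proof -
        have "\<bar>of_int n * Im z\<bar> \<le> real N * (s / 2 + 1)"
          unfolding abs_mult Nn(2) s_def using z by (intro mult_left_mono) auto
        then show ?thesis by linarith
      qed
      moreover have "real N * s * 2 \<le> real N * s * real N"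
        using N t by (intro mult_left_mono) (auto simp: s_def)
      ultimately have "real N * (s - 2) \<le> (of_int n)\<^sup>2 * s + 2 * of_int n * Im z"
        unfolding Nn(1) by (simp add: algebra_simps power2_eq_square)
      then have "- pi * ((of_int n)\<^sup>2 * s + 2 * of_int n * Im z) \<le> - pi * (real N * (s - 2))"
        by (intro mult_left_mono_neg) auto
      also have "\<dots> = real N * (- pi * (s - 2))" by simp
      finally have "norm (theta_term z t n) \<le> exp (real N * (- pi * (s - 2)))"
        by (simp only: norm_theta_term s_def exp_le_cancel_iff)
      also have "\<dots> = \<rho> ^ N"
        by (simp only: exp_of_nat_mult \<rho>_def)
      also have "\<dots> = \<rho> * \<rho> ^ (N - 1)" using N by (simp flip: power_Suc)
      also have "\<dots> \<le> \<rho> * (1/2) ^ (N - 1)" using \<rho> by (intro mult_left_mono power_mono) auto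
      also have "\<dots> = 2 * \<rho> * (1/2) ^ N" using N by (cases N) auto
      finally show ?thesis by (simp add: g_def N_def)
    qed
    have "(theta_term z t has_sum (theta3 z t - sum (theta_term z t) S)) (UNIV - S)"
      using t by (intro has_sum_Diff has_sum_finite) (auto simp: theta3_eq_infsum S_def theta_term_summable)
    moreover have "((\<lambda>n. 2 * \<rho> * g n) has_sum (2 * \<rho> * infsum g (UNIV - S))) (UNIV - S)"
      by (intro has_sum_cmult_right has_sum_infsum gS)
    ultimately have "norm (theta3 z t - sum (theta_term z t) S) \<le> 2 * \<rho> * infsum g (UNIV - S)"
      using bound by (rule norm_infsum_le)
    also have "\<dots> \<le> 2 * \<rho> * infsum g UNIV"
      using \<rho> by (intro mult_left_mono infsum_mono2 gS) (auto simp: g_def)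
    finally show "norm (theta3 z t - (1 + theta_term z t 1 + theta_term z t (- 1)))
        \<le> 2 * infsum g UNIV * exp (- pi * (Im t - 2))"
      by (simp add: S_def \<rho>_def s_def theta_term_def[of _ _ 0] algebra_simps)
  qed
qed

lemma theta3_approx_tendsto:
  assumes "filterlim (\<lambda>k. Im (t k)) at_top sequentially"
    and "\<And>k. \<bar>Im (z k)\<bar> \<le> Im (t k) / 2 + 1"
  shows "(\<lambda>k. theta3 (z k) (t k) - (1 + theta_term (z k) (t k) 1 + theta_term (z k) (t k) (- 1))) \<longlonglongrightarrow> 0"
proof -
  obtain K where K: "\<forall>z t. 3 \<le> Im t \<longrightarrow> \<bar>Im z\<bar> \<le> Im t / 2 + 1 \<longrightarrow>
      norm (theta3 z t - (1 + theta_term z t 1 + theta_term z t (- 1))) \<le> K * exp (- pi * (Im t - 2))"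
    using theta3_approx by (rule exE)
  have "((\<lambda>x::real. K * exp (- pi * (x - 2))) \<longlongrightarrow> 0) at_top"
    by real_asymp
  then have lim: "(\<lambda>k. K * exp (- pi * (Im (t k) - 2))) \<longlonglongrightarrow> 0"
    using assms(1) by (rule filterlim_compose)
  show ?thesis
  proof (rule Lim_null_comparison[OF _ lim])
    have "\<forall>\<^sub>F k in sequentially. 3 \<le> Im (t k)"
      using assms(1) by (simp add: filterlim_at_top)
    then show "\<forall>\<^sub>F k in sequentially. norm (theta3 (z k) (t k) - (1 + theta_term (z k) (t k) 1
        + theta_term (z k) (t k) (- 1))) \<le> K * exp (- pi * (Im (t k) - 2))"
      by eventually_elim (use K assms(2) in blast)
  qed
qed

lemma filterlim_double_at_top:
  assumes "(s::real) > 0"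
  shows "filterlim (\<lambda>k. 2 ^ k * s) at_top sequentially"
  using assms by real_asymp

lemma Im_power2_mult: "Im (2 ^ k * z) = 2 ^ k * Im z" "Re (2 ^ k * z) = 2 ^ k * Re z"
  by (induction k) (simp_all add: mult.assoc)

lemma tendsto_exp_double:
  assumes "(s::real) > 0"
  shows "(\<lambda>k. exp (- pi * (2 ^ k * s))) \<longlonglongrightarrow> 0"
  using assms by real_asymp

text \<open>
  A zero would persist for all \<open>2^k t\<close> by the doubling identity at \<open>z = 0\<close>, but \<open>theta3 (1/2) (2^k t)\<close>
  tends to its central term 1.
\<close>

lemma theta3_half_nonzero:
  assumes "Im t > 0"
  shows "theta3 (1/2) t \<noteq> 0"
proof
  assume 0: "theta3 (1/2) t = 0"
  have zero: "theta3 (1/2) (2 ^ k * t) = 0" for k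
  proof (induction k)
    case (Suc k)
    have "Im (2 ^ k * t) > 0" using assms by (simp add: Im_power2_mult)
    from theta3_doubling[OF this, of 0] Suc show ?case by (simp add: mult.assoc)
  qed (use 0 in simp)
  have term_norm: "norm (theta_term (1/2) (2 ^ k * t) n) = exp (- pi * (2 ^ k * Im t))"
    if "n = 1 \<or> n = -1" for n k
    using that by (auto simp: norm_theta_term Im_power2_mult)
  have terms: "(\<lambda>k. theta_term (1/2) (2 ^ k * t) n) \<longlonglongrightarrow> 0" if "n = 1 \<or> n = -1" for n
    by (rule tendsto_norm_zero_cancel) (simp only: term_norm[OF that] tendsto_exp_double[OF assms])
  have "(\<lambda>k. theta3 (1/2) (2 ^ k * t) -
      (1 + theta_term (1/2) (2 ^ k * t) 1 + theta_term (1/2) (2 ^ k * t) (- 1))) \<longlonglongrightarrow> 0"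
    by (rule theta3_approx_tendsto)
      (use assms in \<open>simp_all add: Im_power2_mult filterlim_double_at_top\<close>)
  moreover have "(\<lambda>k. theta3 (1/2) (2 ^ k * t) -
      (1 + theta_term (1/2) (2 ^ k * t) 1 + theta_term (1/2) (2 ^ k * t) (- 1))) \<longlonglongrightarrow> 0 - (1 + 0 + 0)"
    unfolding zero by (intro tendsto_intros terms) auto
  ultimately show False
    using LIMSEQ_unique by fastforce
qed

text \<open>
  In the coordinate \<open>z + 1/2\<close> the doubling identity multiplies both \<open>z\<close> and \<open>t\<close> by 2, and its
  prefactor has no zeros.
\<close>

lemma theta3_zero_iterate:
  assumes "Im t > 0" "theta3 z t = 0"
  shows "theta3 (2 ^ k * (z + 1/2) - 1/2) (2 ^ k * t) = 0"
proof (induction k)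
  case (Suc k)
  have t: "Im (2 ^ k * t) > 0" using assms by (simp add: Im_power2_mult)
  have "theta3 (1/2) (2 * (2 ^ k * t)) \<noteq> 0"
    by (rule theta3_half_nonzero) (use t in simp)
  moreover have "2 * (2 ^ k * (z + 1/2) - 1/2) + 1/2 = 2 ^ Suc k * (z + 1/2) - 1/2"
    by (simp add: algebra_simps)
  ultimately show ?case
    using theta3_doubling[OF t, of "2 ^ k * (z + 1/2) - 1/2"] Suc
    by (simp add: mult.assoc)
qed (use assms in simp)

text \<open>
  The strip is invariant under the iteration of a zero, and inside it the terms with index \<open>1\<close> and \<open>-1\<close>
  tend to 0 as well; the theta values would tend to 1.
\<close>

lemma theta3_zero_free_strip:
  assumes "\<bar>Im z\<bar> < Im t / 2"
  shows "theta3 z t \<noteq> 0"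
proof
  assume 0: "theta3 z t = 0"
  have t: "Im t > 0" using assms by linarith
  define zk where "zk k = 2 ^ k * (z + 1/2) - 1/2" for k
  have Im_zk: "Im (zk k) = 2 ^ k * Im z" for k
    by (simp add: zk_def Im_power2_mult)
  have term_norm: "norm (theta_term (zk k) (2 ^ k * t) n) = exp (- pi * (2 ^ k * (Im t + 2 * of_int n * Im z)))"
    if "n = 1 \<or> n = -1" for n k
    using that by (auto simp: norm_theta_term Im_power2_mult Im_zk algebra_simps)
  have terms: "(\<lambda>k. theta_term (zk k) (2 ^ k * t) n) \<longlonglongrightarrow> 0" if "n = 1 \<or> n = -1" for n
    by (rule tendsto_norm_zero_cancel)
      (simp only: term_norm[OF that], rule tendsto_exp_double, use that assms in auto)
  have "\<bar>Im (zk k)\<bar> \<le> Im (2 ^ k * t) / 2 + 1" for k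
  proof -
    have "\<bar>Im (zk k)\<bar> = 2 ^ k * \<bar>Im z\<bar>" by (simp add: Im_zk abs_mult)
    also have "\<dots> \<le> 2 ^ k * (Im t / 2)" using assms by (intro mult_left_mono) auto
    finally show ?thesis by (simp add: Im_power2_mult)
  qed
  then have "(\<lambda>k. theta3 (zk k) (2 ^ k * t) -
      (1 + theta_term (zk k) (2 ^ k * t) 1 + theta_term (zk k) (2 ^ k * t) (- 1))) \<longlonglongrightarrow> 0"
    by (intro theta3_approx_tendsto) (use t in \<open>simp_all add: Im_power2_mult filterlim_double_at_top\<close>)
  moreover have "(\<lambda>k. theta3 (zk k) (2 ^ k * t) -
      (1 + theta_term (zk k) (2 ^ k * t) 1 + theta_term (zk k) (2 ^ k * t) (- 1))) \<longlonglongrightarrow> 0 - (1 + 0 + 0)"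
    unfolding theta3_zero_iterate[OF t 0, folded zk_def] by (intro tendsto_intros terms) auto
  ultimately show False
    using LIMSEQ_unique by fastforce
qed

text \<open>
  1 is a repelling fixed point of squaring: \<open>\<bar>f\<^sup>2 - 1\<bar> = \<bar>f + 1\<bar> \<bar>f - 1\<bar>\<close>, and the first factor is at
  least \<open>3/2\<close> near 1. So an orbit can only converge to 1 by hitting it.
\<close>

lemma squaring_orbit_to_1:
  fixes f :: "nat \<Rightarrow> complex"
  assumes "\<And>k. f (Suc k) = (f k)\<^sup>2" "f \<longlonglongrightarrow> 1"
  obtains k where "f k = 1"
proof -
  have "\<forall>\<^sub>F k in sequentially. dist (f k) 1 < 1/2"
    using assms(2) by (rule tendstoD) simp
  then obtain N where N: "\<And>k. k \<ge> N \<Longrightarrow> norm (f k - 1) < 1/2"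
    by (auto simp: eventually_sequentially dist_norm)
  have grow: "norm (f (Suc k) - 1) \<ge> 3/2 * norm (f k - 1)" if "k \<ge> N" for k
  proof -
    have "f (Suc k) - 1 = (f k + 1) * (f k - 1)"
      by (simp add: assms(1) power2_eq_square algebra_simps)
    moreover have "norm (f k + 1) \<ge> 3/2"
    proof -
      have "2 \<le> norm (f k + 1) + norm (f k - 1)"
        using norm_triangle_ineq4[of "f k + 1" "f k - 1"] by simp
      then show ?thesis using N[OF that] by linarith
    qed
    ultimately show ?thesis
      using mult_right_mono[of "3/2" "norm (f k + 1)" "norm (f k - 1)"] by (simp add: norm_mult)
  qed
  have "norm (f (N + j) - 1) \<ge> (3/2) ^ j * norm (f N - 1)" for j
  proof (induction j)
    case (Suc j)
    then show ?case using grow[of "N + j"] by (simp add: algebra_simps)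
  qed simp
  then have le: "(3/2) ^ j * norm (f N - 1) \<le> 1/2" for j
    using N[of "N + j"] by (smt (verit) le_add1)
  have "norm (f N - 1) = 0"
  proof (rule ccontr)
    assume "norm (f N - 1) \<noteq> 0"
    then have "norm (f N - 1) > 0" by simp
    moreover obtain j where "1 / norm (f N - 1) < (3/2) ^ j"
      using real_arch_pow[of "3/2"] by fastforce
    ultimately have "1 < (3/2) ^ j * norm (f N - 1)"
      by (simp only: pos_divide_less_eq)
    then show False using le[of j] by linarith
  qed
  then show thesis by (intro that[of N]) simp
qed

text \<open>
  The hypothesis means that \<open>z\<close> is congruent to \<open>t/2\<close> modulo 1. For purely imaginary \<open>t\<close> all terms of
  the series are then positive.
\<close>

lemma theta3_nonzero_at_half_period:
  assumes "Re t = 0" "Im t > 0" "theta_term z t (- 1) = 1"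
  shows "theta3 z t \<noteq> 0"
proof -
  define g where "g n = exp (- pi * ((of_int n)\<^sup>2 + of_int n) * Im t)" for n :: int
  have t: "t = \<i> * of_real (Im t)" using assms(1) by (simp add: complex_eq_iff)
  have "theta_term z t n = of_real (g n)" for n
  proof -
    have a: "exp ((t - 2 * z) * (of_real pi * \<i>)) = 1"
      using assms(3) by (simp add: theta_term_def)
    have "exp (of_int (- n) * ((t - 2 * z) * (of_real pi * \<i>))) = 1"
      using a by (metis exp_power_int power_int_1_left)
    then have "theta_term z t n = theta_term z t n * exp (of_int n * ((t - 2 * z) * (of_real pi * \<i>)))"
      using a by (metis exp_power_int mult.right_neutral power_int_1_left)
    also have "\<dots> = exp (((of_int n)\<^sup>2 + of_int n) * t * (of_real pi * \<i>))"
      by (simp add: theta_term_def algebra_simps flip: exp_add)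
    also have "((of_int n)\<^sup>2 + of_int n) * t * (of_real pi * \<i>) = of_real (- pi * ((of_int n)\<^sup>2 + of_int n) * Im t)"
      by (subst t) (simp add: algebra_simps)
    finally show ?thesis by (simp only: g_def exp_of_real)
  qed
  then have eq: "theta_term z t = (\<lambda>n. of_real (g n))" by auto
  have S: "g summable_on UNIV"
    using theta_term_abs_summable[OF assms(2), of z] unfolding eq by (simp add: g_def[abs_def])
  have "1 = infsum g {0}" by (simp add: g_def)
  also have "\<dots> \<le> infsum g UNIV"
    by (rule infsum_mono2) (auto simp: S, simp add: g_def)
  finally have "infsum g UNIV \<noteq> 0" by simp
  moreover have "theta3 z t = of_real (infsum g UNIV)"
    unfolding theta3_eq_infsum eq using S by (intro infsumI has_sum_of_real has_sum_infsum)
  ultimately show ?thesis by simp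
qed

text \<open>
  On the edge \<open>Im z = Im t / 2\<close> the term of index \<open>-1\<close> has modulus 1, and its negative \<open>f k\<close> along the
  iteration of a zero satisfies \<open>f (k + 1) = (f k)\<^sup>2\<close>. Since the theta values vanish, \<open>f\<close> tends to 1, so
  \<open>f\<close> is eventually equal to 1. Going back, the other square root \<open>- 1\<close> is excluded by positivity;
  hence \<open>f 0 = 1\<close>, which determines \<open>Re z\<close> modulo 1.
\<close>

lemma theta3_zero_on_edge:
  assumes "Re t = 0" "Im t > 0" "Im z = Im t / 2" "theta3 z t = 0"
  shows "Re z - 1/2 \<in> \<int>"
proof -
  define zk where "zk k = 2 ^ k * (z + 1/2) - 1/2" for k
  define tk where "tk k = 2 ^ k * t" for k
  define f where "f k = - theta_term (zk k) (tk k) (- 1)" for k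
  have Im_zk: "Im (zk k) = 2 ^ k * (Im t / 2)" and Im_tk: "Im (tk k) = 2 ^ k * Im t" for k
    by (simp_all add: zk_def tk_def Im_power2_mult assms)
  have zero: "theta3 (zk k) (tk k) = 0" for k
    unfolding zk_def tk_def by (rule theta3_zero_iterate[OF assms(2,4)])
  have sq: "f (Suc k) = (f k)\<^sup>2" for k
  proof -
    have "(f k)\<^sup>2 = - (exp (2 * ((tk k - 2 * zk k) * (of_real pi * \<i>))) * exp (- (of_real pi * \<i>)))"
      by (simp add: f_def theta_term_def exp_minus mult.commute flip: exp_double)
    also have "\<dots> = f (Suc k)"
      unfolding f_def theta_term_def
      by (simp flip: exp_add) (simp add: zk_def tk_def algebra_simps)
    finally show ?thesis ..
  qed
  have "(\<lambda>k. theta3 (zk k) (tk k) - (1 + theta_term (zk k) (tk k) 1 + theta_term (zk k) (tk k) (- 1))) \<longlonglongrightarrow> 0"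
    by (rule theta3_approx_tendsto)
       (use assms filterlim_double_at_top[OF assms(2)] in \<open>auto simp: Im_zk Im_tk abs_mult\<close>)
  moreover have "(\<lambda>k. theta_term (zk k) (tk k) 1) \<longlonglongrightarrow> 0"
  proof (rule tendsto_norm_zero_cancel)
    have "norm (theta_term (zk k) (tk k) 1) = exp (- pi * (2 ^ k * (2 * Im t)))" for k
      by (simp add: norm_theta_term Im_zk Im_tk)
    then show "(\<lambda>k. norm (theta_term (zk k) (tk k) 1)) \<longlonglongrightarrow> 0"
      using tendsto_exp_double[of "2 * Im t"] assms by simp
  qed
  ultimately have "(\<lambda>k. (theta3 (zk k) (tk k) - (1 + theta_term (zk k) (tk k) 1 + theta_term (zk k) (tk k) (- 1)))
      + theta_term (zk k) (tk k) 1 + 1) \<longlonglongrightarrow> 0 + 0 + 1"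
    by (intro tendsto_intros)
  then have "f \<longlonglongrightarrow> 1" by (simp add: zero f_def[abs_def])
  then obtain k where k: "f k = 1"
    using squaring_orbit_to_1[of f] sq by blast
  have "f 0 = 1"
    using k
  proof (induction k)
    case (Suc k)
    then have "f k = 1 \<or> f k = - 1"
      using sq[of k] by (simp add: power2_eq_1_iff)
    moreover have "f k \<noteq> - 1"
      using theta3_nonzero_at_half_period[of "tk k" "zk k"] zero[of k] assms(1,2)
      by (auto simp: f_def Im_tk tk_def Im_power2_mult)
    ultimately show ?case using Suc.IH by blast
  qed
  then have "exp ((t - 2 * z) * (of_real pi * \<i>)) = exp (of_real pi * \<i>)"
    by (simp add: f_def zk_def tk_def theta_term_def minus_equation_iff)
  then obtain n :: int where "(t - 2 * z) * (of_real pi * \<i>) = of_real pi * \<i> + 2 * of_int n * of_real pi * \<i>"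
    unfolding exp_eq by (auto simp: mult_ac)
  then have "(t - 2 * z - 1 - 2 * of_int n) * (of_real pi * \<i>) = 0"
    by (simp add: algebra_simps)
  then have "t - 2 * z - 1 - 2 * of_int n = 0" by simp
  then have "Re (t - 2 * z - 1 - 2 * of_int n) = 0" by simp
  then have "Re z - 1/2 = of_int (- n - 1)" using assms(1) by simp
  then show ?thesis by (metis Ints_of_int)
qed

lemma theta3_zero_closed_strip:
  assumes "Re t = 0" "\<bar>Im z\<bar> \<le> Im t / 2" "0 < Im t" "theta3 z t = 0"
  shows "\<bar>Im z\<bar> = Im t / 2 \<and> Re z - 1/2 \<in> \<int>"
proof -
  have e: "\<bar>Im z\<bar> = Im t / 2"
    using theta3_zero_free_strip[of z t] assms by fastforce
  show ?thesis
  proof (cases "Im z = Im t / 2")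
    case True
    then show ?thesis using theta3_zero_on_edge assms e by blast
  next
    case False
    then have "Im (- z) = Im t / 2" using e by simp
    then have "Re (- z) - 1/2 \<in> \<int>"
      using theta3_zero_on_edge[of t "- z"] assms by (simp add: theta3_minus)
    then have "- (Re (- z) - 1/2) - 1 \<in> \<int>" by (meson Ints_diff Ints_minus Ints_1)
    then show ?thesis using e by simp
  qed
qed

lemma theta3_has_field_derivative:
  assumes "Im t > 0"
  shows "((\<lambda>z. theta3 z t) has_field_derivative deriv (\<lambda>z. theta3 z t) z) (at z)"
  using theta3_holomorphic[OF assms, of UNIV] by (simp add: holomorphic_derivI[of _ UNIV])

text \<open>
  Differentiating the doubling identity at the zero \<open>1/2 + t/2\<close> shows that the derivative \<open>d t\<close> there
  vanishes only if \<open>d (2 t)\<close> does. A Cauchy estimate of the error in the three-term approximation shows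
  that \<open>d (2^k t)\<close> tends to \<open>2 \<pi> \<i>\<close>.
\<close>

lemma theta3_simple_zero:
  assumes "Im t > 0"
  shows "deriv (\<lambda>z. theta3 z t) (1/2 + t/2) \<noteq> 0"
proof
  define d where "d t = deriv (\<lambda>z. theta3 z t) (1/2 + t/2)" for t
  assume "deriv (\<lambda>z. theta3 z t) (1/2 + t/2) = 0"
  then have d0: "d t = 0" by (simp add: d_def)
  have dd: "((\<lambda>z. theta3 z t) has_field_derivative d t) (at (1/2 + t/2))" if "Im t > 0" for t
    unfolding d_def by (rule theta3_has_field_derivative[OF that])
  have step: "d (2 * t) = 0" if t: "Im t > 0" and "d t = 0" for t
  proof -
    let ?z = "1/2 + t/2"
    have "((\<lambda>z. theta3 z t * theta3 (z + 1/2) t) has_field_derivative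
        d t * theta3 (?z + 1/2) t + deriv (\<lambda>z. theta3 z t) (?z + 1/2) * theta3 ?z t) (at ?z)"
      by (rule DERIV_mult[OF dd[OF t]])
        (rule DERIV_chain2[OF theta3_has_field_derivative[OF t], of "\<lambda>z. z + 1/2" 1 ?z, simplified mult_1_right],
          auto intro!: derivative_eq_intros)
    then have 1: "((\<lambda>z. theta3 (1/2) (2 * t) * theta3 (2 * z + 1/2) (2 * t)) has_field_derivative 0) (at ?z)"
      using \<open>d t = 0\<close> theta3_zero[of t] unfolding theta3_doubling[OF t] by simp
    have "2 * ?z + 1/2 = (1/2 + (2 * t)/2) + 1" by (simp add: field_simps)
    moreover have "((\<lambda>z. theta3 (z - 1) (2 * t)) has_field_derivative d (2 * t)) (at ((1/2 + (2 * t)/2) + 1))"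
      using DERIV_shift[of "\<lambda>z. theta3 (z - 1) (2 * t)" "d (2 * t)" "1/2 + (2 * t)/2" 1] dd[of "2 * t"] t
      by simp
    moreover have "theta3 (z - 1) (2 * t) = theta3 z (2 * t)" for z
      using theta3_plus_1[of "z - 1"] by simp
    ultimately have "((\<lambda>z. theta3 z (2 * t)) has_field_derivative d (2 * t)) (at (2 * ?z + 1/2))"
      by simp
    then have "((\<lambda>z. theta3 (2 * z + 1/2) (2 * t)) has_field_derivative d (2 * t) * 2) (at ?z)"
      by (rule DERIV_chain2[where g = "\<lambda>z. 2 * z + 1/2" and x = ?z])
        (auto intro!: derivative_eq_intros)
    then have "((\<lambda>z. theta3 (1/2) (2 * t) * theta3 (2 * z + 1/2) (2 * t)) has_field_derivative
        theta3 (1/2) (2 * t) * (d (2 * t) * 2)) (at ?z)"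
      by (rule DERIV_cmult)
    with 1 have "theta3 (1/2) (2 * t) * (d (2 * t) * 2) = 0"
      using DERIV_unique by blast
    then show ?thesis using theta3_half_nonzero[of "2 * t"] t by simp
  qed
  have dk: "d (2 ^ k * t) = 0" for k
  proof (induction k)
    case (Suc k)
    then show ?case using step[of "2 ^ k * t"] assms by (simp add: Im_power2_mult mult.assoc)
  qed (use d0 in simp)
  obtain K where K: "\<forall>z t. 3 \<le> Im t \<longrightarrow> \<bar>Im z\<bar> \<le> Im t / 2 + 1 \<longrightarrow>
      norm (theta3 z t - (1 + theta_term z t 1 + theta_term z t (- 1))) \<le> K * exp (- pi * (Im t - 2))"
    using theta3_approx by (rule exE)
  have est: "norm (d t - 2 * pi * \<i> * (1 - exp (2 * pi * \<i> * t))) \<le> K * exp (- pi * (Im t - 2))"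
    if t: "Im t \<ge> 3" for t
  proof -
    define r where "r z = theta3 z t - (1 + theta_term z t 1 + theta_term z t (- 1))" for z
    let ?z = "1/2 + t/2"
    have e1: "theta_term ?z t 1 = - exp (2 * pi * \<i> * t)"
    proof -
      have "theta_term ?z t 1 = exp (2 * pi * \<i> * t) * exp (of_real pi * \<i>)"
        unfolding theta_term_def exp_add[symmetric]
        by (rule arg_cong[of _ _ exp]) (simp add: field_simps)
      then show ?thesis by simp
    qed
    have e2: "theta_term ?z t (- 1) = - 1"
    proof -
      have "theta_term ?z t (- 1) = exp (- (of_real pi * \<i>))"
        unfolding theta_term_def by (rule arg_cong[of _ _ exp]) (simp add: field_simps)
      then show ?thesis by (simp add: exp_minus mult.commute)
    qed
    have dterm: "((\<lambda>z. theta_term z t n) has_field_derivative 2 * of_int n * (of_real pi * \<i>) * theta_term z t n) (at z)"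
      for n z
      unfolding theta_term_def by (auto intro!: derivative_eq_intros)
    have "(r has_field_derivative d t - (0 + 2 * of_int 1 * (of_real pi * \<i>) * theta_term ?z t 1
        + 2 * of_int (- 1) * (of_real pi * \<i>) * theta_term ?z t (- 1))) (at ?z)"
      unfolding r_def by (intro DERIV_diff DERIV_add dd dterm DERIV_const) (use t in simp)
    then have dr: "deriv r ?z = d t - 2 * pi * \<i> * (1 - exp (2 * pi * \<i> * t))"
      unfolding e1 e2 by (simp add: DERIV_imp_deriv algebra_simps)
    have hol: "r holomorphic_on UNIV"
      unfolding r_def theta_term_def
      by (intro holomorphic_intros theta3_holomorphic) (use t in auto)
    have "norm ((deriv ^^ 1) r ?z) \<le> fact 1 * (K * exp (- pi * (Im t - 2))) / 1 ^ 1"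
    proof (rule Cauchy_inequality)
      show "r holomorphic_on ball ?z 1" "continuous_on (cball ?z 1) r"
        using hol holomorphic_on_subset holomorphic_on_imp_continuous_on by blast+
      fix x assume "norm (?z - x) = 1"
      then have "\<bar>Im (?z - x)\<bar> \<le> 1" using abs_Im_le_cmod by metis
      then have "\<bar>Im x\<bar> \<le> Im t / 2 + 1" using t by simp
      then show "norm (r x) \<le> K * exp (- pi * (Im t - 2))"
        unfolding r_def using K t by simp
    qed simp
    then show ?thesis by (simp add: dr)
  qed
  have lim1: "(\<lambda>k. d (2 ^ k * t) - 2 * pi * \<i> * (1 - exp (2 * pi * \<i> * (2 ^ k * t)))) \<longlonglongrightarrow> 0"
  proof (rule Lim_null_comparison)
    have inf: "filterlim (\<lambda>k. Im (2 ^ k * t)) at_top sequentially"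
      using filterlim_double_at_top[OF assms] by (simp add: Im_power2_mult)
    then have "\<forall>\<^sub>F k in sequentially. 3 \<le> Im (2 ^ k * t)"
      by (simp add: filterlim_at_top)
    then show "\<forall>\<^sub>F k in sequentially. norm (d (2 ^ k * t) - 2 * pi * \<i> * (1 - exp (2 * pi * \<i> * (2 ^ k * t))))
        \<le> K * exp (- pi * (Im (2 ^ k * t) - 2))"
      by eventually_elim (rule est)
    have "((\<lambda>x::real. K * exp (- pi * (x - 2))) \<longlongrightarrow> 0) at_top"
      by real_asymp
    then show "(\<lambda>k. K * exp (- pi * (Im (2 ^ k * t) - 2))) \<longlonglongrightarrow> 0"
      using inf by (rule filterlim_compose)
  qed
  have "(\<lambda>k. exp (2 * pi * \<i> * (2 ^ k * t))) \<longlonglongrightarrow> 0"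
  proof (rule tendsto_norm_zero_cancel)
    have "norm (exp (2 * pi * \<i> * (2 ^ k * t))) = exp (- pi * (2 ^ k * (2 * Im t)))" for k
      by (simp add: Im_power2_mult)
    then show "(\<lambda>k. norm (exp (2 * pi * \<i> * (2 ^ k * t)))) \<longlonglongrightarrow> 0"
      using tendsto_exp_double[of "2 * Im t"] assms by (simp only:)
  qed
  then have "(\<lambda>k. d (2 ^ k * t) - 2 * pi * \<i> * (1 - exp (2 * pi * \<i> * (2 ^ k * t)))) \<longlonglongrightarrow> 0 - 2 * pi * \<i> * (1 - 0)"
    unfolding dk by (intro tendsto_intros)
  from LIMSEQ_unique[OF lim1 this] show False by simp
qed

section \<open>Single-valued branches on the right half-plane\<close>

abbreviation rhp :: "complex set" where "rhp \<equiv> {k. 0 < Re k}"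
abbreviation crhp :: "complex set" where "crhp \<equiv> {k. 0 \<le> Re k}"

lemma rhp_open: "open rhp" by (simp add: open_halfspace_Re_gt)
lemma rhp_convex: "convex rhp" by (simp add: convex_halfspace_Re_gt)
lemma rhp_connected: "connected rhp" by (simp add: rhp_convex convex_connected)

lemma trivial_limit_rhp:
  assumes "0 \<le> Re p" "open U" "p \<in> U"
  shows "at p within (U \<inter> rhp) \<noteq> bot"
proof -
  have "p islimpt (U \<inter> rhp)"
  proof (rule islimptI)
    fix T assume "p \<in> T" "open T"
    then have "open (T \<inter> U)" "p \<in> T \<inter> U" using assms by auto
    then obtain e where e: "e > 0" "ball p e \<subseteq> T \<inter> U"
      using open_contains_ball by blast
    then have "p + of_real (e/2) \<in> ball p e" by (simp add: dist_norm)
    then show "\<exists>y\<in>U \<inter> rhp. y \<in> T \<and> y \<noteq> p"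
      using e assms(1) by (intro bexI[of _ "p + of_real (e/2)"]) auto
  qed
  then show ?thesis by (simp add: trivial_limit_within)
qed

lemma crhp_eqI:
  fixes f g :: "complex \<Rightarrow> 'a::t2_space"
  assumes "open U" "continuous_on (U \<inter> crhp) f" "continuous_on (U \<inter> crhp) g"
    and "\<And>k. k \<in> U \<Longrightarrow> 0 < Re k \<Longrightarrow> f k = g k"
    and p: "p \<in> U" "0 \<le> Re p"
  shows "f p = g p"
proof -
  have sub: "U \<inter> rhp \<subseteq> U \<inter> crhp" by auto
  have lim: "(f \<longlongrightarrow> f p) (at p within U \<inter> crhp)" "(g \<longlongrightarrow> g p) (at p within U \<inter> crhp)"
    using assms(2,3) p by (auto simp: continuous_on_def)
  note lim = lim[THEN tendsto_within_subset, OF sub]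
  note lim(1)
  moreover have "\<forall>\<^sub>F k in at p within U \<inter> rhp. f k = g k"
    using assms(4) by (simp add: eventually_at_filter)
  ultimately have "(g \<longlongrightarrow> f p) (at p within U \<inter> rhp)"
    using tendsto_cong by blast
  then show ?thesis
    using tendsto_unique[OF trivial_limit_rhp[OF p(2) assms(1) p(1)]] lim(2) by blast
qed

text \<open>
  Boundary values that are limits from the open half-plane are automatically continuous among
  themselves: a boundary value near \<open>p\<close> is a limit of interior values near \<open>p\<close>.
\<close>

lemma continuous_on_crhp_extension:
  fixes f g :: "complex \<Rightarrow> complex"
  assumes "\<And>k. 0 < Re k \<Longrightarrow> g k = f k"
    and lim: "\<And>p. 0 \<le> Re p \<Longrightarrow> (f \<longlongrightarrow> g p) (at p within rhp)"
  shows "continuous_on crhp g"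
  unfolding continuous_on_iff
proof (intro ballI allI impI)
  fix p :: complex and e :: real assume p: "p \<in> crhp" and e: "e > 0"
  have "\<forall>\<^sub>F k in at p within rhp. dist (f k) (g p) < e/2"
    using lim[of p] p e by (intro tendstoD) auto
  then obtain d where d: "d > 0" "\<And>k. k \<in> rhp \<Longrightarrow> k \<noteq> p \<Longrightarrow> dist k p < d \<Longrightarrow> dist (f k) (g p) < e/2"
    unfolding eventually_at by auto
  have "dist (g k) (g p) < e" if k: "k \<in> crhp" "dist k p < d" for k
  proof -
    have "at k within rhp \<noteq> bot"
      using trivial_limit_rhp[of k UNIV] k by simp
    moreover have "(f \<longlongrightarrow> g k) (at k within rhp)" using lim k by simp
    moreover have "\<forall>\<^sub>F x in at k within rhp. dist (g p) (f x) \<le> e/2"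
    proof -
      have "\<forall>\<^sub>F x in at k within rhp. x \<in> ball p d"
        using k unfolding eventually_at_topological
        by (intro exI[of _ "ball p d"]) (auto simp: dist_commute)
      moreover have "\<forall>\<^sub>F x in at k within rhp. x \<in> rhp"
        by (simp add: eventually_at_filter)
      ultimately show ?thesis
      proof eventually_elim
        case (elim x)
        show ?case
        proof (cases "x = p")
          case True
          then show ?thesis using assms(1)[of p] elim e by simp
        next
          case False
          then show ?thesis using d(2)[of x] elim by (simp add: dist_commute less_imp_le)
        qed
      qed
    qed
    ultimately have "dist (g p) (g k) \<le> e/2" by (rule Lim_dist_ubound)
    then show ?thesis using e by (simp add: dist_commute)
  qed
  then show "\<exists>d>0. \<forall>x'\<in>crhp. dist x' p < d \<longrightarrow> dist (g x') (g p) < e"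
    using d(1) by blast
qed

text \<open>
  The quotient is continuous with values in the finite set of roots of unity, hence constant. This is how
  different closed formulas for the same branch are identified.
\<close>

lemma same_power_imp_eq_on:
  fixes f g :: "complex \<Rightarrow> complex"
  assumes "connected S" "continuous_on S f" "continuous_on S g" "n \<ge> 1"
    and "\<And>x. x \<in> S \<Longrightarrow> g x \<noteq> 0" "\<And>x. x \<in> S \<Longrightarrow> f x ^ n = g x ^ n"
    and "x0 \<in> S" "f x0 = g x0" "x \<in> S"
  shows "f x = g x"
proof -
  have "(\<lambda>x. f x / g x) constant_on S"
  proof (rule continuous_finite_range_constant[OF assms(1)])
    show "continuous_on S (\<lambda>x. f x / g x)"
      using assms by (intro continuous_intros) auto
    have "(\<lambda>x. f x / g x) ` S \<subseteq> {z. z ^ n = 1}"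
      using assms(5,6) by (auto simp: power_divide)
    then show "finite ((\<lambda>x. f x / g x) ` S)"
      using finite_roots_unity[OF assms(4)] finite_subset by blast
  qed
  then obtain q where q: "\<And>x. x \<in> S \<Longrightarrow> f x / g x = q"
    unfolding constant_on_def by blast
  have "q = 1" using q[of x0] assms by auto
  then show ?thesis using q[of x] assms by auto
qed

lemma continuous_on_csqrt_crhp: "continuous_on crhp csqrt"
proof -
  have "isCont csqrt z" if "0 \<le> Re z" for z
  proof (cases "z = 0")
    case False
    then have "z \<notin> \<real>\<^sub>\<le>\<^sub>0" using that by (auto simp: complex_nonpos_Reals_iff complex_eq_iff)
    then show ?thesis by (rule continuous_at_csqrt)
  next
    case True
    have "((\<lambda>z::complex. sqrt (norm z)) \<longlongrightarrow> sqrt (norm (0::complex))) (at 0)"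
      by (rule tendsto_real_sqrt[OF tendsto_norm[OF tendsto_ident_at]])
    then have "((\<lambda>z. norm (csqrt z)) \<longlongrightarrow> 0) (at 0)"
      by (simp only: norm_csqrt norm_zero real_sqrt_zero)
    then have "(csqrt \<longlongrightarrow> 0) (at 0)"
      by (rule tendsto_norm_zero_cancel)
    then show ?thesis using True by (simp add: isCont_def)
  qed
  then show ?thesis by (simp add: continuous_at_imp_continuous_on)
qed

lemma Re_csqrt_nonneg: "0 \<le> Re (csqrt z)"
  using csqrt_principal[of z] by linarith

lemma csqrt_cnj_rhp:
  assumes "0 < Re z" shows "csqrt (cnj z) = cnj (csqrt z)"
  using assms by (intro cnj_csqrt[symmetric]) (auto simp: complex_nonpos_Reals_iff)

lemma mult_cnj_norm: "z * cnj z = of_real ((norm z)\<^sup>2)"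
  by (simp only: complex_norm_square)

lemma contour_iff:
  assumes "0 < c"
  shows "k \<in> contour c \<longleftrightarrow> Re k = 0 \<and> \<bar>Im k\<bar> \<le> c"
  using assms unfolding contour_def
  by (subst closed_segment_same_Re) (auto simp: closed_segment_eq_real_ivl)

lemma cuts_iff:
  assumes "0 < a" "a < c"
  shows "k \<in> cuts a c \<longleftrightarrow> Re k = 0 \<and> a \<le> \<bar>Im k\<bar> \<and> \<bar>Im k\<bar> \<le> c"
  using assms unfolding cuts_def
  by (subst (1 2) closed_segment_same_Re) (auto simp: closed_segment_eq_real_ivl)

locale branch_points =
  fixes a c :: real
  assumes a_pos: "0 < a" and a_less_c: "a < c"
begin

lemma c_pos: "0 < c" using a_pos a_less_c by simp

lemmas ac = a_pos a_less_c c_pos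

abbreviation "G \<equiv> exceptional_points a c"

lemma G_iff: "k \<in> G \<longleftrightarrow> Re k = 0 \<and> (\<bar>Im k\<bar> = c \<or> \<bar>Im k\<bar> = a)"
  using ac by (auto simp: exceptional_points_def complex_eq_iff)

lemma finite_G: "finite G" by (simp add: exceptional_points_def)

lemma prod_G: "(\<Prod>\<kappa>\<in>G. f \<kappa>) = f (\<i> * c) * f (\<i> * a) * f (- \<i> * a) * f (- \<i> * c)"
  for f :: "complex \<Rightarrow> complex"
  unfolding exceptional_points_def using ac
  by (subst prod.insert; (subst prod.insert)?; (subst prod.insert)?) (auto simp: complex_eq_iff mult.assoc)

lemma not_contour_iff: "k \<notin> contour c \<longleftrightarrow> Re k \<noteq> 0 \<or> c < \<bar>Im k\<bar>"
  by (auto simp: contour_iff[OF c_pos])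

lemma not_cuts_if: "k \<notin> contour c \<Longrightarrow> k \<notin> cuts a c"
  by (auto simp: cuts_iff[OF a_pos a_less_c] contour_iff[OF c_pos])

text \<open>
  The branches of \<open>w\<close> and \<open>gamma_tilde\<close> on the right half-plane. The cut of each factor is the horizontal
  ray to the left of its branch point, so these formulas, unlike those with the cuts along the contour,
  are continuous on the closed right half-plane and give the boundary values from the right.
\<close>

definition wR :: "complex \<Rightarrow> complex" where
  "wR k = (\<Prod>\<kappa>\<in>G. csqrt (k - \<kappa>))"

definition gammaR :: "complex \<Rightarrow> complex" where
  "gammaR k = csqrt (csqrt (k - \<i> * a)) * csqrt (csqrt (k + \<i> * a))
     / (csqrt (csqrt (k - \<i> * c)) * csqrt (csqrt (k + \<i> * c)))"

definition slit :: "complex set" where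
  "slit = {k. \<forall>\<kappa>\<in>G. k - \<kappa> \<notin> \<real>\<^sub>\<le>\<^sub>0}"

lemma open_slit_halfline: "open {k. k - \<kappa> \<notin> \<real>\<^sub>\<le>\<^sub>0}" for \<kappa> :: complex
proof -
  have "open ((\<lambda>k. k - \<kappa>) -` (- \<real>\<^sub>\<le>\<^sub>0))"
    by (intro open_vimage continuous_intros) (simp add: open_Compl)
  then show ?thesis by (simp add: vimage_def)
qed

lemma open_slit: "open slit"
proof -
  have "slit = (\<Inter>\<kappa>\<in>G. {k. k - \<kappa> \<notin> \<real>\<^sub>\<le>\<^sub>0})" by (auto simp: slit_def)
  then show ?thesis using open_slit_halfline finite_G by auto
qed

lemma minus_G_notin_nonpos:
  assumes "\<kappa> \<in> G" "0 \<le> Re k" "k \<noteq> \<kappa>"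
  shows "k - \<kappa> \<notin> \<real>\<^sub>\<le>\<^sub>0"
  using assms by (auto simp: complex_nonpos_Reals_iff G_iff complex_eq_iff)

lemma crhp_minus_G_slit: "0 \<le> Re k \<Longrightarrow> k \<notin> G \<Longrightarrow> k \<in> slit"
  unfolding slit_def using minus_G_notin_nonpos by blast

lemma rhp_slit: "0 < Re k \<Longrightarrow> k \<in> slit"
  by (rule crhp_minus_G_slit) (auto simp: G_iff)

lemma wR_holomorphic: "wR holomorphic_on slit"
  unfolding wR_def[abs_def] slit_def by (intro holomorphic_intros) auto

lemma wR_nonzero: "k \<notin> G \<Longrightarrow> wR k \<noteq> 0"
  unfolding wR_def using finite_G by auto

lemma wR_nonzero_slit: "k \<in> slit \<Longrightarrow> wR k \<noteq> 0"
  by (intro wR_nonzero) (auto simp: slit_def)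

lemma continuous_on_csqrt_minus_G: "\<kappa> \<in> G \<Longrightarrow> continuous_on crhp (\<lambda>k. csqrt (k - \<kappa>))"
  by (intro continuous_on_compose2[OF continuous_on_csqrt_crhp] continuous_intros) (auto simp: G_iff)

lemma wR_continuous: "continuous_on crhp wR"
  unfolding wR_def[abs_def] by (intro continuous_intros continuous_on_csqrt_minus_G)

lemma G_members: "\<i> * a \<in> G" "- \<i> * a \<in> G" "\<i> * c \<in> G" "- \<i> * c \<in> G"
  by (auto simp: exceptional_points_def)

lemma continuous_on_csqrt_csqrt_minus_G:
  "\<kappa> \<in> G \<Longrightarrow> continuous_on crhp (\<lambda>k. csqrt (csqrt (k - \<kappa>)))"
  using Re_csqrt_nonneg
  by (intro continuous_on_compose2[OF continuous_on_csqrt_crhp continuous_on_csqrt_minus_G]) blast+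

lemma gammaR_continuous: "continuous_on (crhp - {\<i> * c, - \<i> * c}) gammaR"
proof -
  have "continuous_on (crhp - {\<i> * c, - \<i> * c}) (\<lambda>k. csqrt (csqrt (k - \<kappa>)))" if "\<kappa> \<in> G" for \<kappa>
    by (rule continuous_on_subset[OF continuous_on_csqrt_csqrt_minus_G[OF that]]) auto
  from this[OF G_members(1)] this[OF G_members(2)] this[OF G_members(3)] this[OF G_members(4)]
  show ?thesis
    unfolding gammaR_def[abs_def] by (intro continuous_intros) (auto simp: add_eq_0_iff)
qed

lemma sum_of_squares_factorization:
  "(k - \<i> * complex_of_real s) * (k + \<i> * complex_of_real s) = k\<^sup>2 + (complex_of_real s)\<^sup>2"
  by (simp add: power2_eq_square algebra_simps)

lemma wR_square: "(wR k)\<^sup>2 = (k\<^sup>2 + (complex_of_real c)\<^sup>2) * (k\<^sup>2 + (complex_of_real a)\<^sup>2)"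
proof -
  have "(wR k)\<^sup>2 = (\<Prod>\<kappa>\<in>G. k - \<kappa>)"
    by (simp add: wR_def prod_power_distrib)
  also have "\<dots> = (k\<^sup>2 + (complex_of_real c)\<^sup>2) * (k\<^sup>2 + (complex_of_real a)\<^sup>2)"
    by (simp add: prod_G flip: sum_of_squares_factorization)
  finally show ?thesis .
qed

lemma csqrt_csqrt_power4: "csqrt (csqrt z) ^ 4 = z"
proof -
  have "csqrt (csqrt z) ^ 4 = ((csqrt (csqrt z))\<^sup>2)\<^sup>2" by (simp only: power_mult[symmetric]) simp
  then show ?thesis by (simp only: power2_csqrt)
qed

lemma gammaR_power4: "gammaR k ^ 4 = cut_ratio a c k"
  by (simp add: gammaR_def power_mult_distrib power_divide csqrt_csqrt_power4 cut_ratio_def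
      flip: sum_of_squares_factorization)

lemma csqrt_csqrt_cnj: "0 < Re z \<Longrightarrow> csqrt (csqrt (cnj z)) = cnj (csqrt (csqrt z))"
proof -
  assume z: "0 < Re z"
  have "csqrt z \<notin> \<real>\<^sub>\<le>\<^sub>0"
  proof
    assume "csqrt z \<in> \<real>\<^sub>\<le>\<^sub>0"
    then have "Re (csqrt z) \<le> 0" "Im (csqrt z) = 0"
      by (simp_all only: complex_nonpos_Reals_iff)
    then have "csqrt z = 0"
      using Re_csqrt_nonneg[of z] by (simp only: complex_eq_iff zero_complex.sel) linarith
    then show False using z by simp
  qed
  then show ?thesis using z by (simp add: csqrt_cnj_rhp cnj_csqrt)
qed

lemma cut_ratio_1: "cut_ratio a c 1 = of_real ((1 + a\<^sup>2) / (1 + c\<^sup>2))"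
  by (simp add: cut_ratio_def)

lemma one_plus_square_pos: "0 < (1 + a\<^sup>2) / (1 + c\<^sup>2)"
  by (intro divide_pos_pos) (auto intro: add_pos_nonneg)

text \<open>
  Both sides are square roots of the same function; at \<open>k = 1\<close> both are positive, because the factors of
  \<open>wR\<close> come in conjugate pairs.
\<close>

lemma w_eq_wR: "0 < Re k \<Longrightarrow> w a c k = wR k"
proof (rule same_power_imp_eq_on[OF rhp_connected, of "w a c" wR 2 1 k])
  show "continuous_on rhp (w a c)"
    by (rule holomorphic_on_imp_continuous_on, rule holomorphic_on_subset[OF w_branch(1)[OF a_pos a_less_c]])
       (auto simp: cuts_iff[OF a_pos a_less_c])
  show "continuous_on rhp wR"
    by (rule continuous_on_subset[OF wR_continuous]) auto
  fix x :: complex assume x: "x \<in> rhp"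
  show "wR x \<noteq> 0" using x by (intro wR_nonzero) (auto simp: G_iff)
  show "(w a c x)\<^sup>2 = (wR x)\<^sup>2"
    using w_branch(2)[OF a_pos a_less_c, of x] x by (simp add: cuts_iff[OF a_pos a_less_c] wR_square)
next
  define r where "r = (1 + a\<^sup>2) / (1 + c\<^sup>2)"
  have r: "0 < r" using one_plus_square_pos by (simp add: r_def)
  have w1: "w a c 1 = of_real ((1 + c\<^sup>2) * sqrt r)"
    unfolding w_def cut_ratio_1 r_def[symmetric] using r by (simp add: csqrt_of_real)
  have "wR 1 = (csqrt (1 - \<i> * c) * csqrt (cnj (1 - \<i> * c))) * (csqrt (1 - \<i> * a) * csqrt (cnj (1 - \<i> * a)))"
    by (simp add: wR_def prod_G mult_ac)
  also have "\<dots> = of_real ((norm (csqrt (1 - \<i> * c)))\<^sup>2 * (norm (csqrt (1 - \<i> * a)))\<^sup>2)"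
    by (subst (1 2) csqrt_cnj_rhp) (simp_all only: mult_cnj_norm of_real_mult of_real_divide, simp_all)
  finally obtain q where q: "wR 1 = of_real q" "q \<ge> 0" by (metis mult_nonneg_nonneg zero_le_power2)
  have "(w a c 1)\<^sup>2 = (wR 1)\<^sup>2"
    using w_branch(2)[OF a_pos a_less_c, of 1] by (simp add: cuts_iff[OF a_pos a_less_c] wR_square)
  then have "((1 + c\<^sup>2) * sqrt r)\<^sup>2 = q\<^sup>2"
    unfolding w1 q by (metis of_real_eq_iff of_real_power)
  then have "(1 + c\<^sup>2) * sqrt r = q"
    by (rule power2_eq_imp_eq) (use q(2) r in \<open>auto intro!: mult_nonneg_nonneg\<close>)
  then show "w a c 1 = wR 1" by (simp add: w1 q)
qed auto

text \<open>
  The same argument with fourth powers.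
\<close>

lemma gamma_eq_gammaR: "0 < Re k \<Longrightarrow> gamma_tilde a c k = gammaR k"
proof (rule same_power_imp_eq_on[OF rhp_connected, of "gamma_tilde a c" gammaR 4 1 k])
  show "continuous_on rhp (gamma_tilde a c)"
    by (rule holomorphic_on_imp_continuous_on, rule holomorphic_on_subset[OF gamma_tilde_branch(1)[OF a_pos a_less_c]])
       (auto simp: cuts_iff[OF a_pos a_less_c])
  show "continuous_on rhp gammaR"
    by (rule continuous_on_subset[OF gammaR_continuous]) auto
  fix x :: complex assume x: "x \<in> rhp"
  have "cut_ratio a c x \<noteq> 0"
    using off_cuts(2)[OF a_pos a_less_c, of x] x by (auto simp: cuts_iff[OF a_pos a_less_c])
  then show "gammaR x \<noteq> 0" using gammaR_power4[of x] by auto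
  show "gamma_tilde a c x ^ 4 = gammaR x ^ 4"
    by (simp add: gammaR_power4 gamma_tilde_branch(2)[OF a_pos a_less_c])
next
  define r where "r = (1 + a\<^sup>2) / (1 + c\<^sup>2)"
  have r: "0 < r" using one_plus_square_pos by (simp add: r_def)
  have g1: "gamma_tilde a c 1 = of_real (r powr (1/4))"
    unfolding gamma_tilde_def cut_ratio_1 r_def[symmetric] using r powr_of_real[of r "1/4"] by simp
  have "gammaR 1 = (csqrt (csqrt (1 - \<i> * a)) * csqrt (csqrt (cnj (1 - \<i> * a)))) /
      (csqrt (csqrt (1 - \<i> * c)) * csqrt (csqrt (cnj (1 - \<i> * c))))"
    by (simp add: gammaR_def)
  also have "\<dots> = of_real ((norm (csqrt (csqrt (1 - \<i> * a))))\<^sup>2 / (norm (csqrt (csqrt (1 - \<i> * c))))\<^sup>2)"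
    by (subst (1 2) csqrt_csqrt_cnj) (simp_all only: mult_cnj_norm of_real_mult of_real_divide, simp_all)
  finally obtain q where q: "gammaR 1 = of_real q" "q \<ge> 0" by (metis divide_nonneg_nonneg zero_le_power2)
  have "gamma_tilde a c 1 ^ 4 = gammaR 1 ^ 4"
    by (simp add: gammaR_power4 gamma_tilde_branch(2)[OF a_pos a_less_c])
  then have "(r powr (1/4)) ^ 4 = q ^ 4"
    unfolding g1 q by (metis of_real_eq_iff of_real_power)
  then have "r powr (1/4) = q"
    by (rule power_eq_imp_eq_base) (use q(2) r in auto)
  then show "gamma_tilde a c 1 = gammaR 1" by (simp add: g1 q)
qed auto

lemma w_eq_wR_middle:
  assumes "\<bar>y\<bar> < a"
  shows "w a c (\<i> * y) = wR (\<i> * y)"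
proof (rule crhp_eqI[of "- cuts a c" "w a c" wR "\<i> * y"])
  show "open (- cuts a c)" unfolding cuts_def by (intro open_Compl closed_Un closed_segment)
  show "continuous_on (- cuts a c \<inter> crhp) (w a c)"
    using w_branch(1)[OF a_pos a_less_c] holomorphic_on_imp_continuous_on continuous_on_subset by blast
  show "continuous_on (- cuts a c \<inter> crhp) wR"
    by (rule continuous_on_subset[OF wR_continuous]) auto
qed (use assms in \<open>auto simp: w_eq_wR cuts_iff[OF a_pos a_less_c]\<close>)

lemma gamma_eq_gammaR_crhp:
  assumes "0 \<le> Re k" "k \<notin> contour c"
  shows "gamma_tilde a c k = gammaR k"
proof (rule crhp_eqI[of "- contour c" "gamma_tilde a c" gammaR k])
  show "open (- contour c)" unfolding contour_def by (intro open_Compl closed_segment)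
  show "continuous_on (- contour c \<inter> crhp) (gamma_tilde a c)"
    by (rule holomorphic_on_imp_continuous_on,
        rule holomorphic_on_subset[OF gamma_tilde_branch(1)[OF a_pos a_less_c]])
       (use not_cuts_if in auto)
  show "continuous_on (- contour c \<inter> crhp) gammaR"
    by (rule continuous_on_subset[OF gammaR_continuous]) (auto simp: contour_def)
qed (use assms in \<open>auto simp: gamma_eq_gammaR\<close>)

end

section \<open>The elliptic integral of the first kind\<close>

context branch_points
begin

lemma Re_G: "\<kappa> \<in> G \<Longrightarrow> Re \<kappa> = 0"
  by (simp add: G_iff)

text \<open>
  The complement of the contour, with infinity added, in the coordinate \<open>u = 1 / k\<close>. It is starlike about
  \<open>u = 0\<close>, so holomorphic functions on it have primitives, which can be normalized at infinity.
\<close>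

definition inverse_domain :: "complex set" where
  "inverse_domain = {u. Re u \<noteq> 0 \<or> \<bar>Im u\<bar> < 1 / c}"

text \<open>
  The differential \<open>dk / w\<close> in the coordinate \<open>u = 1 / k\<close>, written so that it is visibly holomorphic at
  \<open>u = 0\<close>.
\<close>

definition inverse_density :: "complex \<Rightarrow> complex" where
  "inverse_density u = - 1 / ((1 + (complex_of_real c)\<^sup>2 * u\<^sup>2) *
     csqrt ((1 + (complex_of_real a)\<^sup>2 * u\<^sup>2) / (1 + (complex_of_real c)\<^sup>2 * u\<^sup>2)))"

lemma zero_in_contour: "0 \<in> contour c"
  using c_pos by (simp add: contour_iff)

lemma inverse_in_inverse_domain_iff:
  assumes "k \<noteq> 0"
  shows "inverse k \<in> inverse_domain \<longleftrightarrow> k \<notin> contour c"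
proof (cases "Re k = 0")
  case True
  then have "Im k \<noteq> 0" using assms by (simp add: complex_eq_iff)
  moreover have "Im (inverse k) = - (1 / Im k)"
    unfolding inverse_complex.sel using True \<open>Im k \<noteq> 0\<close> by (simp add: power2_eq_square)
  moreover have "Re (inverse k) = 0"
    unfolding inverse_complex.sel using True by simp
  ultimately show ?thesis
    unfolding inverse_domain_def not_contour_iff mem_Collect_eq using True c_pos
    by (simp only: abs_minus_cancel abs_divide) (simp add: field_simps)
next
  case False
  then have "(Re k)\<^sup>2 + (Im k)\<^sup>2 \<noteq> 0" by (simp add: sum_power2_eq_zero_iff)
  then show ?thesis using False by (simp add: inverse_domain_def not_contour_iff)
qed

lemma open_inverse_domain: "open inverse_domain"
proof -
  have "inverse_domain = {u. Re u < 0} \<union> {u. Re u > 0} \<union> ({u. Im u < 1/c} \<inter> {u. Im u > - (1/c)})"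
    by (auto simp: inverse_domain_def)
  then show ?thesis
    by (simp add: open_Un open_Int open_halfspace_Re_lt open_halfspace_Re_gt open_halfspace_Im_lt open_halfspace_Im_gt)
qed

lemma zero_in_inverse_domain: "0 \<in> inverse_domain"
  using c_pos by (simp add: inverse_domain_def)

lemma starlike_inverse_domain: "starlike inverse_domain"
  unfolding starlike_def
proof (intro bexI ballI)
  fix u assume u: "u \<in> inverse_domain"
  show "closed_segment 0 u \<subseteq> inverse_domain"
  proof
    fix x assume "x \<in> closed_segment 0 u"
    then obtain t where t: "0 \<le> t" "t \<le> 1" "x = t *\<^sub>R u"
      by (auto simp: closed_segment_def)
    have "\<bar>Im x\<bar> \<le> \<bar>Im u\<bar>"
      using t by (simp add: abs_mult mult_left_le_one_le)
    then show "x \<in> inverse_domain"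
      using u t c_pos by (cases "t = 0") (auto simp: inverse_domain_def)
  qed
qed (rule zero_in_inverse_domain)

lemma inverse_density_eq:
  assumes "u \<in> inverse_domain"
  shows "1 + (complex_of_real c)\<^sup>2 * u\<^sup>2 \<noteq> 0"
    and "(1 + (complex_of_real a)\<^sup>2 * u\<^sup>2) / (1 + (complex_of_real c)\<^sup>2 * u\<^sup>2) \<notin> \<real>\<^sub>\<le>\<^sub>0"
    and "u \<noteq> 0 \<Longrightarrow> inverse_density u = - 1 / (u\<^sup>2 * w a c (inverse u))"
proof -
  have *: "1 + (complex_of_real s)\<^sup>2 * u\<^sup>2 = u\<^sup>2 * ((inverse u)\<^sup>2 + (complex_of_real s)\<^sup>2)" if "u \<noteq> 0" for s
    using that by (simp add: field_simps)
  have nc: "inverse u \<notin> cuts a c" if "u \<noteq> 0"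
    using inverse_in_inverse_domain_iff[of "inverse u"] assms that by (simp add: not_cuts_if)
  show "1 + (complex_of_real c)\<^sup>2 * u\<^sup>2 \<noteq> 0"
    using off_cuts(1)[OF a_pos a_less_c nc] by (cases "u = 0") (auto simp: *)
  have r: "(1 + (complex_of_real a)\<^sup>2 * u\<^sup>2) / (1 + (complex_of_real c)\<^sup>2 * u\<^sup>2) = cut_ratio a c (inverse u)"
    if "u \<noteq> 0"
    unfolding *[OF that] cut_ratio_def using that by simp
  then show "(1 + (complex_of_real a)\<^sup>2 * u\<^sup>2) / (1 + (complex_of_real c)\<^sup>2 * u\<^sup>2) \<notin> \<real>\<^sub>\<le>\<^sub>0"
    using off_cuts(2)[OF a_pos a_less_c nc] by (cases "u = 0") auto
  show "u \<noteq> 0 \<Longrightarrow> inverse_density u = - 1 / (u\<^sup>2 * w a c (inverse u))"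
    unfolding inverse_density_def w_def by (subst r, assumption, subst *, assumption) (simp add: mult.assoc)
qed

lemma inverse_density_holomorphic: "inverse_density holomorphic_on inverse_domain"
proof -
  have "1 + (complex_of_real a)\<^sup>2 * u\<^sup>2 \<noteq> 0" if "u \<in> inverse_domain" for u
    using inverse_density_eq(2)[OF that] by auto
  then show ?thesis
    unfolding inverse_density_def[abs_def] using inverse_density_eq(1,2)
    by (intro holomorphic_intros holomorphic_on_csqrt') auto
qed

definition inverse_primitive :: "complex \<Rightarrow> complex" where
  "inverse_primitive = (SOME F. F 0 = 0 \<and>
     (\<forall>u\<in>inverse_domain. (F has_field_derivative inverse_density u) (at u)))"

lemma inverse_primitive:
  "inverse_primitive 0 = 0"
  "u \<in> inverse_domain \<Longrightarrow> (inverse_primitive has_field_derivative inverse_density u) (at u)"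
proof -
  obtain g where g: "\<forall>u\<in>inverse_domain. (g has_field_derivative inverse_density u) (at u)"
    using holomorphic_starlike_primitive[of inverse_domain inverse_density "{}"]
      inverse_density_holomorphic holomorphic_on_imp_continuous_on starlike_inverse_domain
      open_inverse_domain holomorphic_on_imp_differentiable_at by blast
  have "\<exists>F. F 0 = 0 \<and> (\<forall>u\<in>inverse_domain. (F has_field_derivative inverse_density u) (at u))"
  proof (intro exI conjI ballI)
    show "((\<lambda>u. g u - g 0) has_field_derivative inverse_density u) (at u)" if "u \<in> inverse_domain" for u
      using g that by (auto intro!: derivative_eq_intros)
  qed simp
  from someI_ex[OF this, folded inverse_primitive_def]
  show "inverse_primitive 0 = 0"
    "u \<in> inverse_domain \<Longrightarrow> (inverse_primitive has_field_derivative inverse_density u) (at u)"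
    by auto
qed

lemma inverse_primitive_unique:
  assumes "F 0 = 0" "\<And>u. u \<in> inverse_domain \<Longrightarrow> (F has_field_derivative inverse_density u) (at u)"
    and u: "u \<in> inverse_domain"
  shows "F u = inverse_primitive u"
proof -
  have D: "((\<lambda>u. F u - inverse_primitive u) has_field_derivative 0) (at u)" if "u \<in> inverse_domain" for u
    using DERIV_diff[OF assms(2)[OF that] inverse_primitive(2)[OF that]] by simp
  have "\<exists>C. \<forall>u\<in>inverse_domain. F u - inverse_primitive u = C"
    by (rule DERIV_zero_connected_constant[of inverse_domain "{}"])
      (use D starlike_inverse_domain starlike_imp_connected open_inverse_domain in
        \<open>auto intro!: continuous_at_imp_continuous_on DERIV_isCont[OF D]\<close>)
  then obtain C where C: "F u - inverse_primitive u = C" if "u \<in> inverse_domain" for u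
    by blast
  have "C = 0" using C[OF zero_in_inverse_domain] assms(1) inverse_primitive(1) by simp
  then show ?thesis using C[OF u] by simp
qed

text \<open>
  The density is even, so \<open>- F (- u)\<close> is a primitive with the same value at 0.
\<close>

lemma inverse_primitive_odd:
  assumes "u \<in> inverse_domain"
  shows "inverse_primitive (- u) = - inverse_primitive u"
proof -
  have "- inverse_primitive (- u) = inverse_primitive u"
  proof (rule inverse_primitive_unique[OF _ _ assms])
    fix u assume "u \<in> inverse_domain"
    then have "- u \<in> inverse_domain" by (simp add: inverse_domain_def)
    then have "((\<lambda>x. inverse_primitive (- x)) has_field_derivative inverse_density (- u) * - 1) (at u)"
      by (intro DERIV_chain2[where g = uminus and x = u, OF inverse_primitive(2)] DERIV_minus DERIV_ident)
    from DERIV_minus[OF this]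
    show "((\<lambda>u. - inverse_primitive (- u)) has_field_derivative inverse_density u) (at u)"
      by (simp add: inverse_density_def)
  qed (simp add: inverse_primitive)
  then show ?thesis by (simp add: minus_equation_iff)
qed

lemma inverse_density_cnj:
  assumes "u \<in> inverse_domain"
  shows "inverse_density (cnj u) = cnj (inverse_density u)"
  using inverse_density_eq(2)[OF assms] by (simp add: inverse_density_def cnj_csqrt)

lemma inverse_primitive_cnj:
  assumes "u \<in> inverse_domain"
  shows "inverse_primitive (cnj u) = cnj (inverse_primitive u)"
proof -
  have "cnj (inverse_primitive (cnj u)) = inverse_primitive u"
  proof (rule inverse_primitive_unique[OF _ _ assms])
    fix u assume "u \<in> inverse_domain"
    moreover from this have "cnj u \<in> inverse_domain" by (simp add: inverse_domain_def)
    from has_field_derivative_cnj_cnj[OF inverse_primitive(2)[OF this]]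
    have "((\<lambda>u. cnj (inverse_primitive (cnj u))) has_field_derivative cnj (inverse_density (cnj u))) (at u)"
      by (simp add: o_def)
    ultimately show "((\<lambda>u. cnj (inverse_primitive (cnj u))) has_field_derivative inverse_density u) (at u)"
      by (simp add: inverse_density_cnj)
  qed (simp add: inverse_primitive)
  then show ?thesis by (metis complex_cnj_cnj)
qed

text \<open>
  The primitive of \<open>1 / w\<close> off the contour that vanishes at infinity. This normalization, rather than one
  at a branch point, makes it odd and real, so that no constants have to be determined.
\<close>

definition Phi :: "complex \<Rightarrow> complex" where
  "Phi k = inverse_primitive (inverse k)"

lemma Phi_has_field_derivative:
  assumes "k \<notin> contour c"
  shows "(Phi has_field_derivative 1 / w a c k) (at k)"
proof -
  have k: "k \<noteq> 0" using assms zero_in_contour by auto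
  then have ik: "inverse k \<in> inverse_domain" using assms inverse_in_inverse_domain_iff by simp
  have "(inverse has_field_derivative - (inverse k * inverse k)) (at k)"
    using DERIV_inverse[OF k, of UNIV] by (simp add: power2_eq_square)
  from DERIV_chain2[OF inverse_primitive(2)[OF ik] this]
  have "(Phi has_field_derivative inverse_density (inverse k) * - (inverse k * inverse k)) (at k)"
    by (simp add: Phi_def[abs_def])
  moreover have "inverse_density (inverse k) * - (inverse k * inverse k) = 1 / w a c k"
    using k inverse_density_eq(3)[OF ik] by (simp add: power2_eq_square)
  ultimately show ?thesis by simp
qed

lemma Phi_continuous: "k \<notin> contour c \<Longrightarrow> isCont Phi k"
  using Phi_has_field_derivative DERIV_isCont by blast

lemma Phi_minus: "k \<notin> contour c \<Longrightarrow> Phi (- k) = - Phi k"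
  using inverse_primitive_odd[of "inverse k"] inverse_in_inverse_domain_iff[of k] zero_in_contour
  by (auto simp: Phi_def)

lemma Phi_cnj: "k \<notin> contour c \<Longrightarrow> Phi (cnj k) = cnj (Phi k)"
  using inverse_primitive_cnj[of "inverse k"] inverse_in_inverse_domain_iff[of k] zero_in_contour
  by (auto simp: Phi_def)

lemma Phi_at_infinity: "(Phi \<longlongrightarrow> 0) at_infinity"
proof -
  have "isCont inverse_primitive 0"
    using inverse_primitive(2)[OF zero_in_inverse_domain] DERIV_isCont by blast
  moreover have "(inverse \<longlongrightarrow> (0::complex)) at_infinity" by (rule tendsto_inverse_0)
  ultimately have "((\<lambda>k. inverse_primitive (inverse k)) \<longlongrightarrow> inverse_primitive 0) at_infinity"
    by (rule isCont_tendsto_compose)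
  then show ?thesis by (simp add: Phi_def[abs_def] inverse_primitive)
qed

lemma Phi_derivative_wR:
  assumes "0 < Re k"
  shows "(Phi has_field_derivative 1 / wR k) (at k)"
  using Phi_has_field_derivative[of k] assms by (simp add: not_contour_iff w_eq_wR)

lemma ball_rhp_convex: "convex (ball p r \<inter> rhp)" "open (ball p r \<inter> rhp)"
  by (simp_all add: convex_Int rhp_convex open_Int rhp_open)

lemma Phi_local_primitive:
  assumes "Re p = 0" "p \<notin> G"
  obtains r F where "r > 0" "ball p r \<subseteq> slit"
    "\<And>k. k \<in> ball p r \<Longrightarrow> (F has_field_derivative 1 / wR k) (at k)"
    "\<And>k. k \<in> ball p r \<Longrightarrow> 0 < Re k \<Longrightarrow> Phi k = F k"
proof -
  have "p \<in> slit" using assms by (simp add: crhp_minus_G_slit)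
  then obtain r where r: "r > 0" "ball p r \<subseteq> slit"
    using open_slit open_contains_ball by blast
  have "(\<lambda>k. 1 / wR k) holomorphic_on ball p r"
    using wR_holomorphic wR_nonzero_slit r(2)
    by (intro holomorphic_on_divide) (auto intro: holomorphic_on_subset)
  then obtain F0 where F0: "\<And>k. k \<in> ball p r \<Longrightarrow> (F0 has_field_derivative 1 / wR k) (at k within ball p r)"
    using holomorphic_convex_primitive'[of "ball p r"] by auto
  then have F0: "(F0 has_field_derivative 1 / wR k) (at k)" if "k \<in> ball p r" for k
    using that at_within_open[OF that open_ball] by metis
  have "\<exists>C. \<forall>k\<in>ball p r \<inter> rhp. Phi k - F0 k = C"
  proof (rule has_field_derivative_zero_constant[OF ball_rhp_convex(1)])
    fix k assume "k \<in> ball p r \<inter> rhp"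
    then have "((\<lambda>k. Phi k - F0 k) has_field_derivative 1 / wR k - 1 / wR k) (at k)"
      by (intro DERIV_diff Phi_derivative_wR F0) auto
    then show "((\<lambda>k. Phi k - F0 k) has_field_derivative 0) (at k within ball p r \<inter> rhp)"
      by (simp add: has_field_derivative_at_within)
  qed
  then obtain C where C: "\<And>k. k \<in> ball p r \<Longrightarrow> 0 < Re k \<Longrightarrow> Phi k - F0 k = C" by auto
  show thesis
  proof (rule that[OF r, of "\<lambda>k. F0 k + C"])
    show "((\<lambda>k. F0 k + C) has_field_derivative 1 / wR k) (at k)" if "k \<in> ball p r" for k
      using F0[OF that] by (auto intro!: derivative_eq_intros)
    show "Phi k = F0 k + C" if "k \<in> ball p r" "0 < Re k" for k
      using C[OF that] by (simp add: algebra_simps)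
  qed
qed

text \<open>
  In the local uniformizer \<open>u\<close> with \<open>k = \<kappa> + u\<^sup>2\<close> the differential \<open>dk / w\<close> becomes \<open>2 du\<close> divided by
  the product of the three other roots, which is holomorphic without zeros near \<open>u = 0\<close>. The
  nonvanishing derivative later yields the lower bound of square root type for the Abel map.
\<close>

lemma Phi_local_branch_point:
  assumes "\<kappa> \<in> G"
  obtains r F where "r > 0" "F holomorphic_on ball 0 r" "deriv F 0 \<noteq> 0"
    "\<And>k. k \<in> ball \<kappa> (r\<^sup>2) \<Longrightarrow> 0 < Re k \<Longrightarrow> Phi k = F (csqrt (k - \<kappa>))"
proof -
  define R where "R k = (\<Prod>\<kappa>'\<in>G - {\<kappa>}. csqrt (k - \<kappa>'))" for k
  define V where "V = {k. \<forall>\<kappa>'\<in>G - {\<kappa>}. k - \<kappa>' \<notin> \<real>\<^sub>\<le>\<^sub>0}"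
  have wR: "wR k = csqrt (k - \<kappa>) * R k" for k
    unfolding wR_def R_def using assms finite_G by (simp add: prod.remove)
  have "V = (\<Inter>\<kappa>'\<in>G - {\<kappa>}. {k. k - \<kappa>' \<notin> \<real>\<^sub>\<le>\<^sub>0})" by (auto simp: V_def)
  then have "open V" using open_slit_halfline finite_G by auto
  moreover have "\<kappa> \<in> V"
    unfolding V_def using minus_G_notin_nonpos[of _ \<kappa>] assms by (auto simp: Re_G)
  ultimately obtain \<rho> where \<rho>: "\<rho> > 0" "ball \<kappa> \<rho> \<subseteq> V"
    using open_contains_ball by blast
  define r where "r = sqrt \<rho>"
  have r: "r > 0" "r\<^sup>2 = \<rho>" using \<rho> by (simp_all add: r_def)
  have Rhol: "R holomorphic_on V"
    unfolding R_def[abs_def] V_def by (intro holomorphic_intros) auto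
  have Rnz: "R k \<noteq> 0" if "k \<in> V" for k
  proof -
    have "k \<notin> G - {\<kappa>}" using that by (force simp: V_def)
    then show ?thesis using finite_G by (auto simp: R_def)
  qed
  have sq: "\<kappa> + u\<^sup>2 \<in> V" if "u \<in> ball 0 r" for u
  proof -
    have "norm u ^ 2 < r\<^sup>2" using that r by (intro power_strict_mono) auto
    then have "\<kappa> + u\<^sup>2 \<in> ball \<kappa> \<rho>" by (simp add: dist_norm norm_power r)
    then show ?thesis using \<rho> by blast
  qed
  have "(\<lambda>u. R (\<kappa> + u\<^sup>2)) holomorphic_on ball 0 r"
  proof -
    have "(R \<circ> (\<lambda>u. \<kappa> + u\<^sup>2)) holomorphic_on ball 0 r"
      by (rule holomorphic_on_compose_gen[OF _ Rhol]) (use sq in \<open>auto intro!: holomorphic_intros\<close>)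
    then show ?thesis by (simp add: o_def)
  qed
  then have "(\<lambda>u. 2 / R (\<kappa> + u\<^sup>2)) holomorphic_on ball 0 r"
    using Rnz sq by (intro holomorphic_intros) auto
  then obtain F0 where F0: "\<And>u. u \<in> ball 0 r \<Longrightarrow> (F0 has_field_derivative 2 / R (\<kappa> + u\<^sup>2)) (at u within ball 0 r)"
    using holomorphic_convex_primitive'[of "ball 0 r"] by auto
  then have F0: "(F0 has_field_derivative 2 / R (\<kappa> + u\<^sup>2)) (at u)" if "u \<in> ball 0 r" for u
    using that at_within_open[OF that open_ball] by metis
  have "\<exists>C. \<forall>k\<in>ball \<kappa> (r\<^sup>2) \<inter> rhp. Phi k - F0 (csqrt (k - \<kappa>)) = C"
  proof (rule has_field_derivative_zero_constant[OF ball_rhp_convex(1)])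
    fix k assume k: "k \<in> ball \<kappa> (r\<^sup>2) \<inter> rhp"
    then have "k \<noteq> \<kappa>" using Re_G[OF assms] by auto
    with k have nn: "k - \<kappa> \<notin> \<real>\<^sub>\<le>\<^sub>0"
      by (intro minus_G_notin_nonpos[OF assms]) auto
    have "norm (csqrt (k - \<kappa>)) < r"
      using k r by (simp add: dist_norm norm_minus_commute real_less_lsqrt)
    then have "csqrt (k - \<kappa>) \<in> ball 0 r" by (simp only: mem_ball_0)
    from F0[OF this] have "(F0 has_field_derivative 2 / R k) (at (csqrt (k - \<kappa>)))" by simp
    moreover have "((\<lambda>k. csqrt (k - \<kappa>)) has_field_derivative inverse (2 * csqrt (k - \<kappa>)) * 1) (at k)"
      by (rule DERIV_chain2[where g = "\<lambda>k. k - \<kappa>" and x = k, OF has_field_derivative_csqrt[OF nn]])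
        (auto intro!: derivative_eq_intros)
    ultimately have "((\<lambda>k. F0 (csqrt (k - \<kappa>))) has_field_derivative 2 / R k * (inverse (2 * csqrt (k - \<kappa>)) * 1)) (at k)"
      by (rule DERIV_chain2)
    moreover have "2 / R k * (inverse (2 * csqrt (k - \<kappa>)) * 1) = 1 / wR k"
      by (simp add: wR field_simps)
    ultimately have "((\<lambda>k. Phi k - F0 (csqrt (k - \<kappa>))) has_field_derivative 1 / wR k - 1 / wR k) (at k)"
      using k by (intro DERIV_diff Phi_derivative_wR) auto
    then show "((\<lambda>k. Phi k - F0 (csqrt (k - \<kappa>))) has_field_derivative 0) (at k within ball \<kappa> (r\<^sup>2) \<inter> rhp)"
      by (simp add: has_field_derivative_at_within)
  qed
  then obtain C where C: "\<And>k. k \<in> ball \<kappa> (r\<^sup>2) \<Longrightarrow> 0 < Re k \<Longrightarrow> Phi k - F0 (csqrt (k - \<kappa>)) = C" by auto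
  have FC: "((\<lambda>u. F0 u + C) has_field_derivative 2 / R (\<kappa> + u\<^sup>2)) (at u)" if "u \<in> ball 0 r" for u
    using F0[OF that] by (auto intro!: derivative_eq_intros)
  show thesis
  proof (rule that[OF r(1), of "\<lambda>u. F0 u + C"])
    show "(\<lambda>u. F0 u + C) holomorphic_on ball 0 r"
      unfolding holomorphic_on_open[OF open_ball] using FC by blast
    show "deriv (\<lambda>u. F0 u + C) 0 \<noteq> 0"
      using FC[of 0] Rnz[OF \<open>\<kappa> \<in> V\<close>] r by (simp add: DERIV_imp_deriv)
    show "Phi k = F0 (csqrt (k - \<kappa>)) + C" if "k \<in> ball \<kappa> (r\<^sup>2)" "0 < Re k" for k
      using C[OF that] by (simp add: algebra_simps)
  qed
qed

text \<open>
  The continuous extension of \<open>Phi\<close> from the right half-plane to the imaginary axis.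
\<close>

definition PhiR :: "complex \<Rightarrow> complex" where
  "PhiR k = (if 0 < Re k then Phi k else Lim (at k within rhp) Phi)"

lemma csqrt_branch_tendsto:
  assumes "\<kappa> \<in> G"
  shows "((\<lambda>k. csqrt (k - \<kappa>)) \<longlongrightarrow> 0) (at \<kappa> within rhp)"
proof -
  have "((\<lambda>k. csqrt (k - \<kappa>)) \<longlongrightarrow> csqrt (\<kappa> - \<kappa>)) (at \<kappa> within crhp)"
    using continuous_on_csqrt_minus_G[OF assms] Re_G[OF assms] by (auto simp only: continuous_on_def)
  then show ?thesis
    using tendsto_within_subset[of _ _ \<kappa> crhp rhp] by (simp add: subset_iff)
qed

lemma Phi_tendsto_PhiR:
  assumes "0 \<le> Re p"
  shows "(Phi \<longlongrightarrow> PhiR p) (at p within rhp)"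
proof (cases "0 < Re p")
  case True
  then have "isCont Phi p" by (intro Phi_continuous) (simp add: not_contour_iff)
  then have "(Phi \<longlongrightarrow> Phi p) (at p)" by (simp add: isCont_def)
  then show ?thesis using True by (simp add: PhiR_def tendsto_within_subset[of _ _ _ UNIV])
next
  case False
  then have p: "Re p = 0" using assms by simp
  have "\<exists>l. (Phi \<longlongrightarrow> l) (at p within rhp)"
  proof (cases "p \<in> G")
    case False
    obtain r F where r: "r > 0" and F: "\<And>k. k \<in> ball p r \<Longrightarrow> (F has_field_derivative 1 / wR k) (at k)"
      and eq: "\<And>k. k \<in> ball p r \<Longrightarrow> 0 < Re k \<Longrightarrow> Phi k = F k"
      by (rule Phi_local_primitive[OF p False]) blast
    have "isCont F p" using F[of p] r DERIV_isCont by fastforce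
    then have "(F \<longlongrightarrow> F p) (at p within rhp)"
      by (simp add: isCont_def tendsto_within_subset[of _ _ _ UNIV])
    moreover have "\<forall>\<^sub>F k in at p within rhp. F k = Phi k"
      unfolding eventually_at using r eq by (intro exI[of _ r]) (auto simp: dist_commute)
    ultimately show ?thesis by (intro exI) (rule Lim_transform_eventually)
  next
    case True
    obtain r F where r: "r > 0" and F: "F holomorphic_on ball 0 r"
      and eq: "\<And>k. k \<in> ball p (r\<^sup>2) \<Longrightarrow> 0 < Re k \<Longrightarrow> Phi k = F (csqrt (k - p))"
      by (rule Phi_local_branch_point[OF True]) blast
    have "isCont F 0"
      using holomorphic_on_imp_continuous_on[OF F] r by (simp add: continuous_on_interior)
    then have "((\<lambda>k. F (csqrt (k - p))) \<longlongrightarrow> F 0) (at p within rhp)"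
      by (rule isCont_tendsto_compose) (rule csqrt_branch_tendsto[OF True])
    moreover have "\<forall>\<^sub>F k in at p within rhp. F (csqrt (k - p)) = Phi k"
      unfolding eventually_at
    proof (intro exI[of _ "r\<^sup>2"] conjI ballI impI)
      fix k assume "k \<in> rhp" "k \<noteq> p \<and> dist k p < r\<^sup>2"
      then show "F (csqrt (k - p)) = Phi k"
        by (intro eq[symmetric]) (simp_all add: dist_commute)
    qed (use r in simp)
    ultimately show ?thesis by (intro exI) (rule Lim_transform_eventually)
  qed
  then obtain l where l: "(Phi \<longlongrightarrow> l) (at p within rhp)" by blast
  have "Lim (at p within rhp) Phi = l"
    using trivial_limit_rhp[of p UNIV] assms by (intro tendsto_Lim l) auto
  then show ?thesis using l p by (simp add: PhiR_def)
qed

lemma PhiR_continuous: "continuous_on crhp PhiR"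
  by (rule continuous_on_crhp_extension[of PhiR Phi]) (simp add: PhiR_def, rule Phi_tendsto_PhiR)

lemma PhiR_eq_Phi: "0 \<le> Re k \<Longrightarrow> k \<notin> contour c \<Longrightarrow> PhiR k = Phi k"
proof (rule crhp_eqI[of "- contour c" PhiR Phi k])
  show "open (- contour c)" unfolding contour_def by (intro open_Compl closed_segment)
  show "continuous_on (- contour c \<inter> crhp) PhiR"
    by (rule continuous_on_subset[OF PhiR_continuous]) auto
  show "continuous_on (- contour c \<inter> crhp) Phi"
    by (intro continuous_at_imp_continuous_on ballI Phi_continuous) auto
qed (auto simp: PhiR_def)

lemma PhiR_cnj: "0 \<le> Re k \<Longrightarrow> PhiR (cnj k) = cnj (PhiR k)"
proof (rule crhp_eqI[of UNIV "\<lambda>k. PhiR (cnj k)" "\<lambda>k. cnj (PhiR k)" k])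
  show "continuous_on (UNIV \<inter> crhp) (\<lambda>k. PhiR (cnj k))"
    by (rule continuous_on_compose2[OF PhiR_continuous]) (auto intro: continuous_intros)
  show "continuous_on (UNIV \<inter> crhp) (\<lambda>k. cnj (PhiR k))"
    using PhiR_continuous by (auto intro: continuous_intros)
  show "PhiR (cnj k) = cnj (PhiR k)" if "0 < Re k" for k
    using Phi_cnj[of k] that by (simp add: PhiR_def not_contour_iff)
qed auto

lemma PhiR_branch_point:
  assumes "\<kappa> \<in> G"
  obtains r F where "r > 0" "F holomorphic_on ball 0 r" "deriv F 0 \<noteq> 0"
    "\<And>k. k \<in> ball \<kappa> (r\<^sup>2) \<Longrightarrow> 0 \<le> Re k \<Longrightarrow> PhiR k = F (csqrt (k - \<kappa>))"
proof -
  obtain r F where r: "r > 0" and F: "F holomorphic_on ball 0 r" "deriv F 0 \<noteq> 0"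
    and eq: "\<And>k. k \<in> ball \<kappa> (r\<^sup>2) \<Longrightarrow> 0 < Re k \<Longrightarrow> Phi k = F (csqrt (k - \<kappa>))"
    by (rule Phi_local_branch_point[OF assms]) blast
  show thesis
  proof (rule that[OF r F])
    fix k assume k: "k \<in> ball \<kappa> (r\<^sup>2)" "0 \<le> Re k"
    show "PhiR k = F (csqrt (k - \<kappa>))"
    proof (rule crhp_eqI[of "ball \<kappa> (r\<^sup>2)" PhiR "\<lambda>k. F (csqrt (k - \<kappa>))" k])
      show "continuous_on (ball \<kappa> (r\<^sup>2) \<inter> crhp) PhiR"
        by (rule continuous_on_subset[OF PhiR_continuous]) auto
      have "csqrt (k - \<kappa>) \<in> ball 0 r" if "k \<in> ball \<kappa> (r\<^sup>2)" for k
      proof -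
        have "norm (csqrt (k - \<kappa>)) < r"
          using that r by (simp add: dist_norm norm_minus_commute real_less_lsqrt)
        then show ?thesis by (simp only: mem_ball_0)
      qed
      then show "continuous_on (ball \<kappa> (r\<^sup>2) \<inter> crhp) (\<lambda>k. F (csqrt (k - \<kappa>)))"
        by (intro continuous_on_compose2[OF holomorphic_on_imp_continuous_on[OF F(1)]]
            continuous_on_subset[OF continuous_on_csqrt_minus_G[OF assms]]) blast+
      show "PhiR k = F (csqrt (k - \<kappa>))" if "k \<in> ball \<kappa> (r\<^sup>2)" "0 < Re k" for k
        using eq[OF that] that by (simp add: PhiR_def)
    qed (use k in auto)
  qed
qed

definition Phi_axis :: "real \<Rightarrow> complex" where "Phi_axis y = PhiR (\<i> * y)"

lemma Phi_axis_continuous: "continuous_on A Phi_axis"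
  unfolding Phi_axis_def[abs_def]
  by (rule continuous_on_compose2[OF PhiR_continuous]) (auto intro!: continuous_intros)

lemma Phi_axis_minus: "Phi_axis (- y) = cnj (Phi_axis y)"
  using PhiR_cnj[of "\<i> * y"] by (simp add: Phi_axis_def)

text \<open>
  By the local primitives the chain rule holds along the axis although the axis is on the boundary of the
  domain of \<open>Phi\<close>.
\<close>

lemma Phi_axis_has_vector_derivative:
  assumes "\<bar>y\<bar> \<noteq> a" "\<bar>y\<bar> \<noteq> c"
  shows "(Phi_axis has_vector_derivative \<i> / wR (\<i> * y)) (at y)"
proof -
  have p: "Re (\<i> * complex_of_real y) = 0" "\<i> * complex_of_real y \<notin> G"
    using assms by (auto simp: G_iff)
  obtain r F where r: "r > 0" and F: "\<And>k. k \<in> ball (\<i> * y) r \<Longrightarrow> (F has_field_derivative 1 / wR k) (at k)"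
    and eq: "\<And>k. k \<in> ball (\<i> * y) r \<Longrightarrow> 0 < Re k \<Longrightarrow> Phi k = F k"
    by (rule Phi_local_primitive[OF p]) blast
  have eqR: "F k = PhiR k" if "k \<in> ball (\<i> * y) r" "0 \<le> Re k" for k
  proof (rule crhp_eqI[of "ball (\<i> * y) r" F PhiR k])
    show "continuous_on (ball (\<i> * y) r \<inter> crhp) F"
      using F DERIV_isCont by (intro continuous_at_imp_continuous_on) blast
    show "continuous_on (ball (\<i> * y) r \<inter> crhp) PhiR"
      by (rule continuous_on_subset[OF PhiR_continuous]) auto
  qed (use that eq in \<open>auto simp: PhiR_def\<close>)
  have "((\<lambda>y. \<i> * complex_of_real y) has_vector_derivative \<i>) (at y)"
    by (auto intro!: derivative_eq_intros simp: has_vector_derivative_def scaleR_conv_of_real)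
  moreover have "(F has_field_derivative 1 / wR (\<i> * y)) (at (\<i> * y))"
    using F r by simp
  ultimately have "((F \<circ> (\<lambda>y. \<i> * complex_of_real y)) has_vector_derivative \<i> * (1 / wR (\<i> * y))) (at y)"
    by (rule field_vector_diff_chain_at)
  then have "(Phi_axis has_vector_derivative \<i> * (1 / wR (\<i> * y))) (at y)"
  proof (rule has_vector_derivative_transform_within_open)
    show "(F \<circ> (\<lambda>y. \<i> * complex_of_real y)) x = Phi_axis x" if "x \<in> ball y r" for x
    proof -
      have "\<i> * complex_of_real y - \<i> * complex_of_real x = \<i> * of_real (y - x)"
        by (simp add: algebra_simps)
      then have "dist (\<i> * complex_of_real y) (\<i> * complex_of_real x) = dist y x"
        by (simp only: dist_norm norm_mult norm_of_real norm_ii) simp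
      then show ?thesis using eqR[of "\<i> * x"] that by (simp add: Phi_axis_def)
    qed
  qed (use r in auto)
  then show ?thesis by simp
qed

definition zeta8 :: complex where "zeta8 = Complex (sqrt (1/2)) (sqrt (1/2))"

lemma zeta8: "zeta8\<^sup>2 = \<i>" "zeta8 * cnj zeta8 = 1" "(cnj zeta8)\<^sup>2 = - \<i>"
  by (simp_all add: zeta8_def complex_eq_iff power2_eq_square)

lemma csqrt_imaginary:
  assumes "0 \<le> x"
  shows "csqrt (\<i> * of_real x) = of_real (sqrt x) * zeta8"
    and "csqrt (\<i> * of_real (- x)) = of_real (sqrt x) * cnj zeta8"
proof -
  have "(complex_of_real (sqrt x))\<^sup>2 = of_real x" using assms by (simp flip: of_real_power)
  then have "(of_real (sqrt x) * zeta8)\<^sup>2 = \<i> * of_real x"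
    "(of_real (sqrt x) * cnj zeta8)\<^sup>2 = \<i> * of_real (- x)"
    unfolding power_mult_distrib zeta8 by simp_all
  then show "csqrt (\<i> * of_real x) = of_real (sqrt x) * zeta8"
    "csqrt (\<i> * of_real (- x)) = of_real (sqrt x) * cnj zeta8"
    using assms by (intro csqrt_unique; auto simp: zeta8_def zero_less_mult_iff)+
qed

text \<open>
  The modulus of \<open>w\<close> on the imaginary axis. The phase changes by a factor \<open>\<i>\<close> at each branch point,
  because a factor \<open>csqrt (k - \<kappa>)\<close> has phase \<open>exp (\<i> \<pi> / 4)\<close> above and \<open>exp (- \<i> \<pi> / 4)\<close> below \<open>\<kappa>\<close>.
\<close>

definition w_modulus :: "real \<Rightarrow> real" where
  "w_modulus y = sqrt \<bar>y - c\<bar> * sqrt \<bar>y - a\<bar> * sqrt \<bar>y + a\<bar> * sqrt \<bar>y + c\<bar>"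

lemma w_modulus_pos: "\<bar>y\<bar> \<noteq> a \<Longrightarrow> \<bar>y\<bar> \<noteq> c \<Longrightarrow> 0 < w_modulus y"
  unfolding w_modulus_def using ac by (intro mult_pos_pos) auto

lemma wR_imaginary:
  "wR (\<i> * y) = csqrt (\<i> * of_real (y - c)) * csqrt (\<i> * of_real (y - a)) *
     csqrt (\<i> * of_real (y + a)) * csqrt (\<i> * of_real (y + c))"
  by (simp add: wR_def prod_G algebra_simps)

lemma wR_upper_cut:
  assumes "a < y" "y < c"
  shows "wR (\<i> * y) = \<i> * w_modulus y"
proof -
  have "wR (\<i> * y) = csqrt (\<i> * of_real (- (c - y))) * csqrt (\<i> * of_real (y - a)) *
     csqrt (\<i> * of_real (y + a)) * csqrt (\<i> * of_real (y + c))"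
    unfolding wR_imaginary by simp
  also have "\<dots> = (zeta8 * cnj zeta8) * zeta8\<^sup>2 * w_modulus y"
    using assms ac by (subst csqrt_imaginary(2), simp, (subst csqrt_imaginary(1), simp)+)
      (simp add: w_modulus_def power2_eq_square)
  finally show ?thesis by (simp only: zeta8) simp
qed

lemma wR_middle:
  assumes "\<bar>y\<bar> < a"
  shows "wR (\<i> * y) = w_modulus y"
proof -
  have "wR (\<i> * y) = csqrt (\<i> * of_real (- (c - y))) * csqrt (\<i> * of_real (- (a - y))) *
     csqrt (\<i> * of_real (y + a)) * csqrt (\<i> * of_real (y + c))"
    unfolding wR_imaginary by simp
  also have "\<dots> = (zeta8 * cnj zeta8) * (zeta8 * cnj zeta8) * w_modulus y"
    using assms ac by (subst csqrt_imaginary(2), simp, subst csqrt_imaginary(2), simp, (subst csqrt_imaginary(1), simp)+)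
      (simp add: w_modulus_def power2_eq_square)
  finally show ?thesis by (simp only: zeta8) simp
qed

end

section \<open>Periods and the Abel map\<close>

context branch_points
begin

lemma Phi_axis_DERIV:
  assumes "\<bar>y\<bar> \<noteq> a" "\<bar>y\<bar> \<noteq> c"
  shows "DERIV (\<lambda>y. Re (Phi_axis y)) y :> Re (\<i> / wR (\<i> * y))" "DERIV (\<lambda>y. Im (Phi_axis y)) y :> Im (\<i> / wR (\<i> * y))"
  using Phi_axis_has_vector_derivative[OF assms] by (simp_all add: has_vector_derivative_complex_iff)

lemma Phi_axis_DERIV_upper:
  assumes "a < y" "y < c"
  shows "DERIV (\<lambda>y. Re (Phi_axis y)) y :> 1 / w_modulus y" "DERIV (\<lambda>y. Im (Phi_axis y)) y :> 0"
  using Phi_axis_DERIV[of y] wR_upper_cut[OF assms] assms ac by simp_all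

lemma Phi_axis_DERIV_middle:
  assumes "\<bar>y\<bar> < a"
  shows "DERIV (\<lambda>y. Re (Phi_axis y)) y :> 0" "DERIV (\<lambda>y. Im (Phi_axis y)) y :> 1 / w_modulus y"
  using Phi_axis_DERIV[of y] wR_middle[OF assms] assms ac by simp_all

lemma Phi_axis_parts_continuous: "continuous_on A (\<lambda>y. Re (Phi_axis y))" "continuous_on A (\<lambda>y. Im (Phi_axis y))"
  by (intro continuous_intros Phi_axis_continuous)+

text \<open>
  For \<open>k\<close> on the imaginary axis \<open>- k\<close> is the conjugate of \<open>k\<close>, and \<open>Phi\<close> is odd and real.
\<close>

lemma Re_Phi_axis_above: "c \<le> y \<Longrightarrow> Re (Phi_axis y) = 0"
proof (rule continuous_constant_on_closure[of "{c<..}" "\<lambda>y. Re (Phi_axis y)"])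
  fix y assume "y \<in> {c<..}"
  then have y: "\<i> * complex_of_real y \<notin> contour c" by (simp add: not_contour_iff)
  have "Phi_axis y = Phi (\<i> * y)" unfolding Phi_axis_def using y by (intro PhiR_eq_Phi) auto
  moreover have "- (\<i> * complex_of_real y) = cnj (\<i> * complex_of_real y)" by simp
  then have "- Phi (\<i> * y) = cnj (Phi (\<i> * y))"
    using Phi_minus[OF y] Phi_cnj[OF y] by metis
  ultimately show "Re (Phi_axis y) = 0" by (simp add: complex_eq_iff)
qed (auto simp: Phi_axis_parts_continuous)

text \<open>
  The periods of \<open>dk / w\<close> are \<open>- 4 \<i> X\<close> and \<open>2 r0\<close>. Along the axis from above, \<open>Phi_axis\<close> moves on a rectangle: it is
  imaginary above \<open>c\<close>, runs from \<open>\<i>X\<close> to \<open>- r0 + \<i>X\<close> between \<open>c\<close> and \<open>a\<close>, and from there down to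
  \<open>- r0 - \<i>X\<close> between \<open>a\<close> and \<open>-a\<close>.
\<close>

definition X :: real where "X = Im (Phi_axis c)"
definition r0 :: real where "r0 = - Re (Phi_axis a)"

lemma Im_Phi_axis_upper:
  assumes "a \<le> y" "y \<le> c"
  shows "Im (Phi_axis y) = X"
proof -
  have "Im (Phi_axis y) = Im (Phi_axis a)" if "a \<le> y" "y \<le> c" for y
    by (rule DERIV_isconst2[OF a_less_c Phi_axis_parts_continuous(2) Phi_axis_DERIV_upper(2)]) (use that in auto)
  from this[of y] this[of c] show ?thesis using assms a_less_c by (simp add: X_def)
qed

lemma Re_Phi_axis_upper_less:
  assumes "a \<le> x" "x < y" "y \<le> c"
  shows "Re (Phi_axis x) < Re (Phi_axis y)"
proof (rule DERIV_pos_imp_increasing_open[OF assms(2) _ Phi_axis_parts_continuous(1)])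
  fix s assume "x < s" "s < y"
  then show "\<exists>d. DERIV (\<lambda>y. Re (Phi_axis y)) s :> d \<and> 0 < d"
    using assms ac Phi_axis_DERIV_upper(1)[of s] w_modulus_pos[of s] by (intro exI[of _ "1 / w_modulus s"]) auto
qed

lemma Re_Phi_axis_middle:
  assumes "\<bar>y\<bar> \<le> a"
  shows "Re (Phi_axis y) = - r0"
proof -
  have "Re (Phi_axis y) = Re (Phi_axis (- a))" if "- a \<le> y" "y \<le> a" for y
    by (rule DERIV_isconst2[OF _ Phi_axis_parts_continuous(1) Phi_axis_DERIV_middle(1), of "- a" a])
      (use that a_pos in auto)
  from this[of y] this[of a] show ?thesis using assms a_pos by (simp add: r0_def)
qed

lemma Im_Phi_axis_middle_less:
  assumes "- a \<le> x" "x < y" "y \<le> a"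
  shows "Im (Phi_axis x) < Im (Phi_axis y)"
proof (rule DERIV_pos_imp_increasing_open[OF assms(2) _ Phi_axis_parts_continuous(2)])
  fix s assume "x < s" "s < y"
  then show "\<exists>d. DERIV (\<lambda>y. Im (Phi_axis y)) s :> d \<and> 0 < d"
    using assms ac Phi_axis_DERIV_middle(2)[of s] w_modulus_pos[of s] by (intro exI[of _ "1 / w_modulus s"]) auto
qed

lemma r0_pos: "0 < r0"
  using Re_Phi_axis_upper_less[of a c] Re_Phi_axis_above[of c] a_less_c by (simp add: r0_def)

lemma X_pos: "0 < X"
  using Im_Phi_axis_middle_less[of "- a" a] Im_Phi_axis_upper[of a] Phi_axis_minus[of a] ac by simp

lemma Phi_axis_a: "Phi_axis a = Complex (- r0) X" "Phi_axis (- a) = Complex (- r0) (- X)"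
  using Im_Phi_axis_upper[of a] ac by (simp_all add: r0_def Phi_axis_minus complex_eq_iff)

lemma contour_integral_half_period:
  "((\<lambda>\<zeta>. 1 / w a c \<zeta>) has_contour_integral (- 2 * \<i> * X)) (linepath (\<i> * a) (- \<i> * a))"
  unfolding has_contour_integral_linepath
proof -
  let ?y = "\<lambda>t::real. a * (1 - 2 * t)"
  have lp: "linepath (\<i> * a) (- \<i> * a) t = \<i> * ?y t" for t
    by (simp add: linepath_def scaleR_conv_of_real algebra_simps)
  have "((\<lambda>t. 1 / w a c (\<i> * ?y t) * (- \<i> * a - \<i> * a)) has_integral Phi_axis (?y 1) - Phi_axis (?y 0)) {0..1}"
  proof (rule fundamental_theorem_of_calculus_interior)
    show "continuous_on {0..1} (\<lambda>t. Phi_axis (?y t))"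
      by (rule continuous_on_compose2[OF Phi_axis_continuous[of UNIV]]) (auto intro!: continuous_intros)
    fix t :: real assume t: "t \<in> {0<..<1}"
    have "\<bar>1 - 2 * t\<bar> < 1" using t by auto
    then have y: "\<bar>?y t\<bar> < a" using a_pos by (simp add: abs_mult)
    have "(?y has_real_derivative (- 2 * a)) (at t)"
      by (auto intro!: derivative_eq_intros)
    moreover have "(Phi_axis has_vector_derivative \<i> / wR (\<i> * ?y t)) (at (?y t))"
      using y ac by (intro Phi_axis_has_vector_derivative) auto
    ultimately have "((Phi_axis \<circ> ?y) has_vector_derivative (- 2 * a) *\<^sub>R (\<i> / wR (\<i> * ?y t))) (at t)"
      by (intro vector_diff_chain_at) (simp_all add: has_real_derivative_iff_has_vector_derivative)
    then show "((\<lambda>t. Phi_axis (?y t)) has_vector_derivative 1 / w a c (\<i> * ?y t) * (- \<i> * a - \<i> * a)) (at t)"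
      using w_eq_wR_middle[OF y] by (simp add: o_def scaleR_conv_of_real algebra_simps)
  qed simp
  moreover have "Phi_axis (?y 1) - Phi_axis (?y 0) = - 2 * \<i> * X"
    by (simp add: Phi_axis_a complex_eq_iff)
  ultimately show "((\<lambda>t. 1 / w a c (linepath (\<i> * a) (- \<i> * a) t) * (- \<i> * a - \<i> * a))
      has_integral - 2 * \<i> * X) {0..1}"
    unfolding lp by simp
qed

lemma Gam_eq: "Gam a c = \<i> / (4 * X)"
  unfolding Gam_def contour_integral_unique[OF contour_integral_half_period]
  using X_pos by (simp add: field_simps)

lemma Gam_nonzero: "Gam a c \<noteq> 0"
  using X_pos by (simp add: Gam_eq)

text \<open>
  The Abel map off the contour and its extension from the right to the imaginary axis. The constant is the
  value at infinity; it makes the map vanish at \<open>\<i>c\<close>. The value of \<open>\<tau>\<close> will be \<open>\<i>T\<close>.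
\<close>

definition Ab :: "complex \<Rightarrow> complex" where "Ab k = 1/4 + Gam a c * Phi k"
definition AR :: "complex \<Rightarrow> complex" where "AR k = 1/4 + Gam a c * PhiR k"
definition T :: real where "T = r0 / (2 * X)"

lemma T_pos: "0 < T" using r0_pos X_pos by (simp add: T_def)

lemma Ab_has_field_derivative:
  "k \<notin> contour c \<Longrightarrow> (Ab has_field_derivative d_omega a c k) (at k)"
  unfolding Ab_def[abs_def] d_omega_def
  using DERIV_add[OF DERIV_const DERIV_cmult[OF Phi_has_field_derivative]] by fastforce

lemma Ab_minus: "k \<notin> contour c \<Longrightarrow> Ab (- k) = 1/2 - Ab k"
  by (simp add: Ab_def Phi_minus)

lemma Ab_at_infinity: "(Ab \<longlongrightarrow> 1/4) at_infinity"
proof -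
  have "((\<lambda>k. 1/4 + Gam a c * Phi k) \<longlongrightarrow> 1/4 + Gam a c * 0) at_infinity"
    by (intro tendsto_intros Phi_at_infinity)
  then show ?thesis by (simp add: Ab_def[abs_def])
qed

lemma AR_continuous: "continuous_on crhp AR"
  unfolding AR_def[abs_def] by (intro continuous_intros PhiR_continuous)

lemma AR_eq_Ab: "0 \<le> Re k \<Longrightarrow> k \<notin> contour c \<Longrightarrow> AR k = Ab k"
  by (simp add: AR_def Ab_def PhiR_eq_Phi)

lemma AR_cnj: "0 \<le> Re k \<Longrightarrow> AR (cnj k) = 1/2 - cnj (AR k)"
  by (simp add: AR_def PhiR_cnj Gam_eq)

lemma Re_AR: "Re (AR (\<i> * y)) = 1/4 - Im (Phi_axis y) / (4 * X)"
  and Im_AR: "Im (AR (\<i> * y)) = Re (Phi_axis y) / (4 * X)"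
  by (simp_all add: AR_def Gam_eq Phi_axis_def Re_divide Im_divide power2_eq_square)

lemma Re_AR_upper: "a \<le> y \<Longrightarrow> y \<le> c \<Longrightarrow> Re (AR (\<i> * y)) = 0"
  using X_pos by (simp add: Re_AR Im_Phi_axis_upper)

lemma AR_ic: "AR (\<i> * c) = 0" "AR (- \<i> * c) = 1/2"
proof -
  show "AR (\<i> * c) = 0"
    using Re_AR_upper[of c] Im_AR[of c] Re_Phi_axis_above[of c] a_less_c by (simp add: complex_eq_iff)
  then show "AR (- \<i> * c) = 1/2"
    using AR_cnj[of "\<i> * c"] by simp
qed

lemma Im_AR_middle: "\<bar>y\<bar> \<le> a \<Longrightarrow> Im (AR (\<i> * y)) = - T / 2"
  using X_pos by (simp add: Im_AR Re_Phi_axis_middle T_def field_simps)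

lemma Re_AR_middle:
  assumes "\<bar>y\<bar> < a"
  shows "0 < Re (AR (\<i> * y))" "Re (AR (\<i> * y)) < 1/2"
proof -
  have "Im (Phi_axis y) < X" "- X < Im (Phi_axis y)"
    using Im_Phi_axis_middle_less[of y a] Im_Phi_axis_middle_less[of "- a" y] assms Phi_axis_a by auto
  then show "0 < Re (AR (\<i> * y))" "Re (AR (\<i> * y)) < 1/2"
    using X_pos by (simp_all add: Re_AR field_simps)
qed

lemma Re_Phi_axis_bounds:
  assumes "a < \<bar>y\<bar>"
  shows "- r0 < Re (Phi_axis y)" "Re (Phi_axis y) \<le> 0"
proof -
  have "- r0 < Re (Phi_axis y) \<and> Re (Phi_axis y) \<le> 0" if "a < y" for y
  proof (cases "y \<le> c")
    case True
    then show ?thesis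
      using Re_Phi_axis_upper_less[of a y] Re_Phi_axis_upper_less[of y c] Re_Phi_axis_above[of c] that Phi_axis_a
      by (cases "y = c") auto
  next
    case False
    then show ?thesis using Re_Phi_axis_above[of y] r0_pos by simp
  qed
  from this[of y] this[of "- y"] show "- r0 < Re (Phi_axis y)" "Re (Phi_axis y) \<le> 0"
    using assms Phi_axis_minus[of y] by (auto simp: abs_if split: if_splits)
qed

lemma Im_AR_outside:
  assumes "a < \<bar>y\<bar>"
  shows "- T / 2 < Im (AR (\<i> * y))" "Im (AR (\<i> * y)) \<le> 0"
  using Re_Phi_axis_bounds[OF assms] X_pos
  by (simp_all add: Im_AR T_def divide_simps)

lemma Im_AR_above: "c \<le> y \<Longrightarrow> Im (AR (\<i> * y)) = 0"
  by (simp add: Im_AR Re_Phi_axis_above)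

lemma Im_AR_axis: "Re k = 0 \<Longrightarrow> \<bar>Im (AR k)\<bar> \<le> T / 2"
proof -
  assume "Re k = 0"
  then have "k = \<i> * Im k" by (simp add: complex_eq_iff)
  then show ?thesis
    using Im_AR_middle[of "Im k"] Im_AR_outside[of "Im k"] T_pos
    by (cases "\<bar>Im k\<bar> \<le> a") auto
qed

subsection \<open>The second period\<close>

text \<open>
  The path may touch the axis at its end points, where only the continuity of the primitive is used.
\<close>

lemma AR_path_integral:
  assumes "u \<le> v" "continuous_on {u..v} g"
    and "\<And>t. t \<in> {u<..<v} \<Longrightarrow> (g has_vector_derivative g' t) (at t)"
    and "\<And>t. t \<in> {u<..<v} \<Longrightarrow> 0 < Re (g t)" "\<And>t. t \<in> {u..v} \<Longrightarrow> 0 \<le> Re (g t)"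
  shows "((\<lambda>t. d_omega a c (g t) * g' t) has_integral AR (g v) - AR (g u)) {u..v}"
proof (rule fundamental_theorem_of_calculus_interior[OF assms(1)])
  show "continuous_on {u..v} (\<lambda>t. AR (g t))"
    using assms by (intro continuous_on_compose2[OF AR_continuous]) auto
  fix t assume t: "t \<in> {u<..<v}"
  have "(AR has_field_derivative d_omega a c (g t)) (at (g t))"
  proof (rule has_field_derivative_transform_within_open)
    show "(Ab has_field_derivative d_omega a c (g t)) (at (g t))"
      using assms(4)[OF t] by (intro Ab_has_field_derivative) (simp add: not_contour_iff)
    show "Ab k = AR k" if "k \<in> rhp" for k
      using that by (intro AR_eq_Ab[symmetric]) (auto simp: not_contour_iff)
  qed (use assms(4)[OF t] rhp_open in auto)
  from field_vector_diff_chain_at[OF assms(3)[OF t] this]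
  show "((\<lambda>t. AR (g t)) has_vector_derivative d_omega a c (g t) * g' t) (at t)"
    by (simp add: o_def mult.commute)
qed

lemma d_omega_minus: "d_omega a c (- k) = d_omega a c k"
  by (simp add: d_omega_def w_def cut_ratio_def)

text \<open>
  The circle crosses the imaginary axis at \<open>\<i>(c + a/2)\<close> above the contour and at \<open>\<i>a/2\<close> between the
  cuts. On its right part the integral is a difference of values of \<open>AR\<close>; the left part is reduced to
  the right half-plane by \<open>k \<mapsto> - k\<close>. The sum is \<open>2 \<i>\<close> times the difference of the imaginary parts of
  \<open>AR\<close> at the two crossing points.
\<close>

lemma tau_eq: "tau a c = \<i> * T"
proof -
  define g where "g = circlepath (\<i> * ((a + c) / 2)) (c / 2)"
  define g' where "g' t = 2 * pi * \<i> * (c / 2) * exp (2 * of_real pi * \<i> * t)" for t :: real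
  have gt: "g t = Complex (c / 2 * cos (2 * pi * t)) ((a + c) / 2 + c / 2 * sin (2 * pi * t))" for t
    by (simp add: g_def circlepath complex_eq_iff Re_exp Im_exp)
  have dg: "(g has_vector_derivative g' t) (at t within A)" for t A
    unfolding g_def g'_def using has_vector_derivative_circlepath[of _ "c/2"] by simp
  have cg: "continuous_on A g" for A
    using dg has_vector_derivative_continuous by (intro continuous_at_imp_continuous_on) blast
  have cos1: "0 < cos (2 * pi * t)" if "\<bar>t\<bar> < 1/4" for t
  proof -
    have "pi * (4 * t) < pi * 1" "pi * (- 1) < pi * (4 * t)"
      using that by (intro mult_strict_left_mono; simp add: abs_less_iff)+
    then show ?thesis by (intro cos_gt_zero_pi) auto
  qed
  have cos1': "0 \<le> cos (2 * pi * t)" if "\<bar>t\<bar> \<le> 1/4" for t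
  proof -
    have "pi * (4 * t) \<le> pi * 1" "pi * (- 1) \<le> pi * (4 * t)"
      using that by (intro mult_left_mono; simp add: abs_le_iff)+
    then show ?thesis by (intro cos_ge_zero) auto
  qed
  have cosp: "cos (2 * pi * t) = - cos (2 * pi * (t - 1/2))" for t
    using cos_periodic_pi[of "2 * pi * (t - 1/2)"] by (simp add: algebra_simps)
  have cosq: "cos (2 * pi * t) = cos (2 * pi * (t - 1))" for t
    by (simp add: algebra_simps cos_diff)
  have cos2: "cos (2 * pi * t) < 0" if "1/4 < t" "t < 3/4" for t
  proof -
    have "\<bar>t - 1/2\<bar> < 1/4" using that by arith
    then show ?thesis using cosp[of t] cos1[of "t - 1/2"] by linarith
  qed
  have cos2': "cos (2 * pi * t) \<le> 0" if "1/4 \<le> t" "t \<le> 3/4" for t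
  proof -
    have "\<bar>t - 1/2\<bar> \<le> 1/4" using that by arith
    then show ?thesis using cosp[of t] cos1'[of "t - 1/2"] by linarith
  qed
  have cos3: "0 < cos (2 * pi * t)" if "3/4 < t" "t \<le> 1" for t
  proof -
    have "\<bar>t - 1\<bar> < 1/4" using that by arith
    then show ?thesis using cosq[of t] cos1[of "t - 1"] by linarith
  qed
  have cos3': "0 \<le> cos (2 * pi * t)" if "3/4 \<le> t" "t \<le> 1" for t
  proof -
    have "\<bar>t - 1\<bar> \<le> 1/4" using that by arith
    then show ?thesis using cosq[of t] cos1'[of "t - 1"] by linarith
  qed
  have Re_g: "Re (g t) = c / 2 * cos (2 * pi * t)" for t by (simp add: gt)
  have "((\<lambda>t. d_omega a c (g t) * g' t) has_integral AR (g (1/4)) - AR (g 0)) {0..1/4}"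
    by (rule AR_path_integral) (use cg dg cos1 cos1' c_pos in \<open>auto simp: Re_g\<close>)
  moreover have "((\<lambda>t. d_omega a c (- g t) * - g' t) has_integral AR (- g (3/4)) - AR (- g (1/4))) {1/4..3/4}"
    by (rule AR_path_integral)
      (use cg has_vector_derivative_minus[OF dg] cos2 cos2' c_pos in
        \<open>auto simp: Re_g mult_le_0_iff mult_less_0_iff intro!: continuous_intros\<close>)
  from has_integral_neg[OF this]
  have "((\<lambda>t. d_omega a c (g t) * g' t) has_integral AR (- g (1/4)) - AR (- g (3/4))) {1/4..3/4}"
    by (simp add: d_omega_minus)
  ultimately have I1: "((\<lambda>t. d_omega a c (g t) * g' t) has_integral
      (AR (g (1/4)) - AR (g 0)) + (AR (- g (1/4)) - AR (- g (3/4)))) {0..3/4}"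
    by (intro has_integral_combine[of 0 "1/4" "3/4"]) auto
  have "((\<lambda>t. d_omega a c (g t) * g' t) has_integral AR (g 1) - AR (g (3/4))) {3/4..1}"
    by (rule AR_path_integral) (use cg dg cos3 cos3' c_pos in \<open>auto simp: Re_g\<close>)
  with I1 have "((\<lambda>t. d_omega a c (g t) * g' t) has_integral
      ((AR (g (1/4)) - AR (g 0)) + (AR (- g (1/4)) - AR (- g (3/4)))) + (AR (g 1) - AR (g (3/4)))) {0..1}"
    by (intro has_integral_combine[of 0 "3/4" 1]) auto
  moreover have "((AR (g (1/4)) - AR (g 0)) + (AR (- g (1/4)) - AR (- g (3/4)))) + (AR (g 1) - AR (g (3/4))) = \<i> * T"
  proof -
    have "cos (2 * pi * (3/4)) = 0" using cosp[of "3/4"] by simp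
    moreover have "sin (2 * pi * (3/4)) = - 1"
      using sin_periodic_pi[of "pi/2"] by (simp add: field_simps)
    ultimately have 34: "g (3/4) = \<i> * (a / 2)" by (simp add: gt complex_eq_iff field_simps)
    have 14: "g (1/4) = \<i> * (c + a / 2)" by (simp add: gt complex_eq_iff field_simps)
    have 01: "g 1 = g 0" by (simp add: gt)
    have "AR (- g (3/4)) = 1/2 - cnj (AR (g (3/4)))"
      using AR_cnj[of "g (3/4)"] by (simp add: 34)
    moreover have "AR (- g (1/4)) = 1/2 - cnj (AR (g (1/4)))"
      using AR_cnj[of "g (1/4)"] by (simp add: 14)
    moreover have "Im (AR (g (1/4))) = 0" unfolding 14 using Im_AR_above[of "c + a/2"] a_pos by simp
    moreover have "Im (AR (g (3/4))) = - T / 2" unfolding 34 using Im_AR_middle[of "a/2"] a_pos by simp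
    ultimately show ?thesis by (simp add: 01 complex_eq_iff)
  qed
  ultimately have "((\<lambda>t. d_omega a c (g t) * g' t) has_integral \<i> * T) {0..1}" by simp
  then have "(d_omega a c has_contour_integral \<i> * T) g"
    unfolding has_contour_integral_def
    by (rule has_integral_eq[rotated]) (simp add: g_def g'_def vector_derivative_circlepath01)
  then show ?thesis
    unfolding tau_def g_def by (simp add: contour_integral_unique)
qed

subsection \<open>The Abel map as a path integral\<close>

text \<open>
  From the left the limit is \<open>1/2 - AR (- \<i>c)\<close>, which vanishes as well; so \<open>\<i>c\<close> can serve as the starting
  point of the integration on either side.
\<close>

lemma Ab_tendsto_ic: "(Ab \<longlongrightarrow> 0) (at (\<i> * c) within - contour c)"
proof -
  have 1: "(Ab \<longlongrightarrow> 0) (at (\<i> * c) within (crhp - contour c))"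
  proof -
    have "(AR \<longlongrightarrow> AR (\<i> * c)) (at (\<i> * c) within crhp)"
      using AR_continuous by (auto simp: continuous_on_def)
    then have "(AR \<longlongrightarrow> 0) (at (\<i> * c) within (crhp - contour c))"
      unfolding AR_ic by (rule tendsto_within_subset) auto
    then show ?thesis
      by (rule Lim_transform_eventually) (auto simp: eventually_at_filter AR_eq_Ab)
  qed
  have 2: "(Ab \<longlongrightarrow> 0) (at (\<i> * c) within {k. Re k < 0})"
  proof -
    have "(AR \<longlongrightarrow> AR (- \<i> * c)) (at (- \<i> * c) within crhp)"
      using AR_continuous by (auto simp: continuous_on_def)
    moreover have "LIM k at (\<i> * c) within {k. Re k < 0}. - k :> at (- \<i> * c) within crhp"
      unfolding filterlim_at by (auto simp: eventually_at_filter intro!: tendsto_eq_intros)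
    ultimately have "((\<lambda>k. AR (- k)) \<longlongrightarrow> 1/2) (at (\<i> * c) within {k. Re k < 0})"
      unfolding AR_ic by (rule filterlim_compose)
    then have "((\<lambda>k. 1/2 - AR (- k)) \<longlongrightarrow> 1/2 - 1/2) (at (\<i> * c) within {k. Re k < 0})"
      by (intro tendsto_intros)
    then have "((\<lambda>k. 1/2 - AR (- k)) \<longlongrightarrow> 0) (at (\<i> * c) within {k. Re k < 0})" by simp
    then show ?thesis
    proof (rule Lim_transform_eventually)
      have "1/2 - AR (- k) = Ab k" if "Re k < 0" for k
        using AR_eq_Ab[of "- k"] Ab_minus[of k] that by (simp add: not_contour_iff)
      then show "\<forall>\<^sub>F k in at (\<i> * c) within {k. Re k < 0}. 1/2 - AR (- k) = Ab k"
        by (simp add: eventually_at_filter)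
    qed
  qed
  have "- contour c = (crhp - contour c) \<union> {k. Re k < 0}"
    by (auto simp: contour_iff[OF c_pos])
  then show ?thesis using Lim_Un[OF 1 2] by simp
qed

text \<open>
  The fundamental theorem of calculus needs the primitive along the path only to be continuous at the
  starting point, where it is 0.
\<close>

lemma Ab_path_integral:
  assumes g: "valid_path g" "pathstart g = \<i> * c" "\<And>t. t \<in> {0<..1} \<Longrightarrow> g t \<notin> contour c"
  shows "(d_omega a c has_contour_integral Ab (pathfinish g)) g"
proof -
  obtain B D where B: "finite B" and D: "\<And>t. t \<in> {0..1} - B \<Longrightarrow> (g has_vector_derivative D t) (at t)"
    and cg: "continuous_on {0..1} g"
    using g(1) unfolding valid_path_def piecewise_C1_differentiable_on_def C1_differentiable_on_def by blast
  define h where "h t = (if t = 0 then 0 else Ab (g t))" for t :: real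
  have "((\<lambda>t. d_omega a c (g t) * vector_derivative g (at t within {0..1})) has_integral h 1 - h 0) {0..1}"
  proof (rule fundamental_theorem_of_calculus_interior_strong[OF B])
    fix t :: real assume t: "t \<in> {0<..<1} - B"
    have "vector_derivative g (at t within {0..1}) = D t"
      using D[of t] t by (intro vector_derivative_at_within_ivl) auto
    moreover have "((Ab \<circ> g) has_vector_derivative D t * d_omega a c (g t)) (at t)"
      using D[of t] t g(3)[of t] by (intro field_vector_diff_chain_at Ab_has_field_derivative) auto
    then have "(h has_vector_derivative D t * d_omega a c (g t)) (at t)"
      by (rule has_vector_derivative_transform_within_open[of _ _ _ "{0<..}"]) (use t in \<open>auto simp: h_def\<close>)
    ultimately show "(h has_vector_derivative d_omega a c (g t) * vector_derivative g (at t within {0..1})) (at t)"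
      by (simp add: mult.commute)
  next
    show "continuous_on {0..1} h"
      unfolding continuous_on_def
    proof
      fix t :: real assume t: "t \<in> {0..1}"
      show "(h \<longlongrightarrow> h t) (at t within {0..1})"
      proof (cases "t = 0")
        case False
        then have "isCont Ab (g t)"
          using t g(3)[of t] Ab_has_field_derivative DERIV_isCont by auto
        moreover have "(g \<longlongrightarrow> g t) (at t within {0..1})"
          using cg t by (auto simp: continuous_on_def)
        ultimately have "((\<lambda>s. Ab (g s)) \<longlongrightarrow> Ab (g t)) (at t within {0..1})"
          by (rule isCont_tendsto_compose)
        moreover have "\<forall>\<^sub>F s in at t within {0..1}. Ab (g s) = h s"
          unfolding eventually_at using False
          by (intro exI[of _ "\<bar>t\<bar>"]) (auto simp: h_def dist_real_def)
        ultimately show ?thesis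
          using False by (simp add: h_def[of t]) (rule Lim_transform_eventually)
      next
        case True
        have "LIM s at 0 within {0..1}. g s :> at (\<i> * c) within - contour c"
          unfolding filterlim_at
        proof
          have "\<i> * complex_of_real c \<in> contour c" using c_pos by (simp add: contour_iff)
          then have "g s \<in> - contour c \<and> g s \<noteq> \<i> * c" if "s \<in> {0..1}" "s \<noteq> 0" for s
            using g(3)[of s] that by (metis ComplI atLeastAtMost_iff greaterThanAtMost_iff order_le_less)
          then show "\<forall>\<^sub>F s in at 0 within {0..1}. g s \<in> - contour c \<and> g s \<noteq> \<i> * c"
            unfolding eventually_at by (intro exI[of _ 1] conjI ballI impI) simp_all
          show "(g \<longlongrightarrow> \<i> * c) (at 0 within {0..1})"
            using cg g(2) unfolding continuous_on_def pathstart_def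
            by (metis atLeastAtMost_iff order.refl zero_le_one)
        qed
        with Ab_tendsto_ic have "((\<lambda>s. Ab (g s)) \<longlongrightarrow> 0) (at 0 within {0..1})"
          by (rule filterlim_compose)
        moreover have "\<forall>\<^sub>F s in at 0 within {0..1}. Ab (g s) = h s"
          by (auto simp: eventually_at_filter h_def)
        ultimately show ?thesis
          using True by (simp add: h_def[of 0]) (rule Lim_transform_eventually)
      qed
    qed
  qed simp
  then show ?thesis by (simp add: has_contour_integral_def h_def pathfinish_def)
qed

lemma open_minus_contour: "open (- contour c)"
  unfolding contour_def by (intro open_Compl closed_segment)

lemma connected_minus_contour: "connected (- contour c)"
  unfolding contour_def
  by (rule connected_complement_bounded_convex) (auto simp: bounded_closed_segment)

text \<open>
  First go up from \<open>\<i>c\<close>; the rest of the path can be chosen in the connected open complement.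
\<close>

lemma abel_path_exists:
  assumes "k \<notin> contour c"
  obtains g where "valid_path g" "pathstart g = \<i> * c" "pathfinish g = k"
    "\<And>t. t \<in> {0<..1} \<Longrightarrow> g t \<notin> contour c"
proof -
  define q where "q = \<i> * complex_of_real (c + 1)"
  have "q \<in> - contour c" using c_pos by (simp add: q_def not_contour_iff)
  then obtain p where p: "polynomial_function p" "path_image p \<subseteq> - contour c" "pathstart p = q" "pathfinish p = k"
    using connected_open_polynomial_connected[OF open_minus_contour connected_minus_contour] assms by blast
  show thesis
  proof (rule that[of "linepath (\<i> * c) q +++ p"])
    show "valid_path (linepath (\<i> * c) q +++ p)"
      using p valid_path_polynomial_function by (intro valid_path_join) auto
    fix t :: real assume t: "t \<in> {0<..1}"
    show "(linepath (\<i> * c) q +++ p) t \<notin> contour c"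
    proof (cases "t \<le> 1/2")
      case True
      have "linepath (\<i> * c) q (2 * t) = \<i> * complex_of_real (c + 2 * t)"
        by (simp add: linepath_def q_def scaleR_conv_of_real algebra_simps)
      then show ?thesis using True t c_pos by (simp add: joinpaths_def not_contour_iff)
    next
      case False
      then have "p (2 * t - 1) \<in> path_image p" using t by (auto simp: path_image_def)
      then show ?thesis using False p(2) by (auto simp: joinpaths_def)
    qed
  qed (use p in auto)
qed

lemma abel_upper_eq:
  assumes "k \<notin> contour c"
  shows "abel_upper a c k = Ab k"
  unfolding abel_upper_def
proof (rule the_equality)
  show "\<exists>g. valid_path g \<and> pathstart g = \<i> * c \<and> pathfinish g = k \<and>
     (\<forall>t\<in>{0<..1}. g t \<notin> contour c) \<and> (d_omega a c has_contour_integral Ab k) g"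
    using abel_path_exists[OF assms] Ab_path_integral by (metis (no_types, lifting))
  fix v assume "\<exists>g. valid_path g \<and> pathstart g = \<i> * c \<and> pathfinish g = k \<and>
     (\<forall>t\<in>{0<..1}. g t \<notin> contour c) \<and> (d_omega a c has_contour_integral v) g"
  then show "v = Ab k"
    using Ab_path_integral has_contour_integral_unique by blast
qed

lemma eventually_not_contour: "\<forall>\<^sub>F k in at_infinity. k \<notin> contour c"
proof -
  have "k \<notin> contour c" if "c + 1 \<le> norm k" for k
    using that cmod_eq_Im[of k] c_pos by (auto simp: contour_iff)
  then show ?thesis unfolding eventually_at_infinity by blast
qed

lemma Lim_abel_upper: "Lim at_infinity (abel_upper a c) = 1/4"
proof (rule tendsto_Lim)
  show "(abel_upper a c \<longlongrightarrow> 1/4) at_infinity"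
    by (rule Lim_transform_eventually[OF Ab_at_infinity])
      (use eventually_not_contour in eventually_elim, simp add: abel_upper_eq)
qed (rule trivial_limit_at_infinity)

subsection \<open>The image of the right half-plane\<close>

text \<open>
  The maximum principle for the harmonic function \<open>Im Ab\<close> on large half discs: the bound holds on the
  imaginary axis, and on large circles \<open>Ab\<close> is close to the real number \<open>1/4\<close>.
\<close>

lemma Im_Ab_le:
  assumes "0 < Re k"
  shows "\<bar>Im (Ab k)\<bar> \<le> T / 2"
proof -
  have "\<forall>\<^sub>F k in at_infinity. dist (Ab k) (1/4) < T / 2"
    by (rule tendstoD[OF Ab_at_infinity]) (use T_pos in simp)
  then obtain R0 where R0: "\<And>k. R0 \<le> norm k \<Longrightarrow> dist (Ab k) (1/4) < T / 2"
    unfolding eventually_at_infinity by blast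
  define R where "R = max R0 (norm k + 1)"
  define D where "D = rhp \<inter> ball 0 R"
  have D: "open D" "bounded D" "k \<in> D"
    using assms rhp_open by (auto simp: D_def R_def)
  have clD: "closure D \<subseteq> crhp \<inter> cball 0 R"
    by (rule closure_minimal) (auto simp: D_def closed_halfspace_Re_ge intro!: closed_Int)
  have bound: "\<bar>Im (AR z)\<bar> \<le> T / 2" if "z \<in> frontier D" for z
  proof -
    have z: "0 \<le> Re z" "norm z \<le> R" "z \<notin> D"
      using that clD D(1) by (auto simp: frontier_def interior_open)
    show ?thesis
    proof (cases "Re z = 0")
      case True
      then show ?thesis by (rule Im_AR_axis)
    next
      case False
      then have "norm z = R" using z by (auto simp: D_def)
      then have "norm (Ab z - 1/4) < T / 2" using R0[of z] by (simp add: R_def dist_norm)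
      moreover have "AR z = Ab z" using False z by (intro AR_eq_Ab) (auto simp: not_contour_iff)
      ultimately show ?thesis using abs_Im_le_cmod[of "Ab z - 1/4"] by simp
    qed
  qed
  have bound': "- Im (AR z) \<le> T / 2" "Im (AR z) \<le> T / 2" if "z \<in> frontier D" for z
    using bound[OF that] by linarith+
  have hol: "AR holomorphic_on interior D"
  proof -
    have "Ab holomorphic_on rhp"
      unfolding holomorphic_on_open[OF rhp_open]
    using Ab_has_field_derivative not_contour_iff by fastforce
    then have "AR holomorphic_on rhp"
      by (rule holomorphic_transform) (auto simp: AR_eq_Ab not_contour_iff)
    then show ?thesis
      by (rule holomorphic_on_subset) (use interior_subset[of D] in \<open>auto simp: D_def\<close>)
  qed
  have cont: "continuous_on (closure D) AR"
    by (rule continuous_on_subset[OF AR_continuous]) (use clD in auto)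
  have "Re (\<i> * AR k) \<le> T / 2"
    by (rule maximum_real_frontier[OF _ _ D(2) _ D(3)])
      (use hol cont bound' in \<open>auto intro!: holomorphic_intros continuous_intros\<close>)
  moreover have "Re (- \<i> * AR k) \<le> T / 2"
    by (rule maximum_real_frontier[OF _ _ D(2) _ D(3)])
      (use hol cont bound' in \<open>auto intro!: holomorphic_intros continuous_intros\<close>)
  ultimately show ?thesis
    using AR_eq_Ab[of k] assms by (auto simp: not_contour_iff)
qed

text \<open>
  The nonconstant map \<open>Ab\<close> is open, so it cannot attain the extreme values.
\<close>

lemma Im_Ab_less:
  assumes "0 < Re k"
  shows "\<bar>Im (Ab k)\<bar> < T / 2"
proof -
  have hol: "Ab holomorphic_on rhp"
    unfolding holomorphic_on_open[OF rhp_open]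
    using Ab_has_field_derivative not_contour_iff by fastforce
  have "\<not> Ab constant_on rhp"
  proof
    assume "Ab constant_on rhp"
    then obtain C where C: "\<And>k. k \<in> rhp \<Longrightarrow> Ab k = C" unfolding constant_on_def by blast
    have "(Ab has_field_derivative 0) (at k)"
      by (rule has_field_derivative_transform_within_open[of "\<lambda>_. C" _ _ rhp])
        (use assms rhp_open C in auto)
    moreover have "(Ab has_field_derivative d_omega a c k) (at k)"
      using assms by (intro Ab_has_field_derivative) (simp add: not_contour_iff)
    ultimately have "d_omega a c k = 0" using DERIV_unique by blast
    then show False
      using Gam_nonzero w_eq_wR[OF assms] wR_nonzero_slit[OF rhp_slit[OF assms]]
      by (simp add: d_omega_def)
  qed
  then have "open (Ab ` rhp)"
    by (intro open_mapping_thm[OF hol rhp_open rhp_connected rhp_open]) auto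
  then obtain e where e: "e > 0" "ball (Ab k) e \<subseteq> Ab ` rhp"
    using assms open_contains_ball by blast
  have "Ab k + \<i> * of_real (s * e / 2) \<in> ball (Ab k) e" if "\<bar>s\<bar> = 1" for s
    using e(1) that by (simp add: dist_norm norm_mult abs_mult)
  then have "Ab k + \<i> * of_real (s * e / 2) \<in> Ab ` rhp" if "\<bar>s\<bar> = 1" for s
    using e(2) that by blast
  then have "\<bar>Im (Ab k + \<i> * of_real (s * e / 2))\<bar> \<le> T / 2" if "\<bar>s\<bar> = 1" for s
    using that Im_Ab_le by (metis (no_types, lifting) imageE mem_Collect_eq)
  from this[of 1] this[of "-1"]
  have "\<bar>Im (Ab k) + e / 2\<bar> \<le> T / 2" "\<bar>Im (Ab k) - e / 2\<bar> \<le> T / 2" by simp_all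
  then show ?thesis using e(1) by arith
qed

text \<open>
  In the uniformizer \<open>csqrt (k - \<kappa>)\<close> the Abel map has a nonzero derivative.
\<close>

lemma AR_sqrt_lower_bound:
  assumes "\<kappa> \<in> G"
  obtains C r where "C > 0" "r > 0"
    "\<And>k. 0 \<le> Re k \<Longrightarrow> norm (k - \<kappa>) < r \<Longrightarrow> C * sqrt (norm (k - \<kappa>)) \<le> norm (AR k - AR \<kappa>)"
proof -
  obtain r F where r: "r > 0" and F: "F holomorphic_on ball 0 r" "deriv F 0 \<noteq> 0"
    and eq: "\<And>k. k \<in> ball \<kappa> (r\<^sup>2) \<Longrightarrow> 0 \<le> Re k \<Longrightarrow> PhiR k = F (csqrt (k - \<kappa>))"
    by (rule PhiR_branch_point[OF assms]) blast
  define M where "M = norm (deriv F 0) / 2"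
  have M: "M > 0" using F(2) by (simp add: M_def)
  have "(F has_field_derivative deriv F 0) (at 0)"
    by (rule holomorphic_derivI[OF F(1)]) (use r in auto)
  then have "((\<lambda>u. norm ((F u - F 0) / (u - 0))) \<longlongrightarrow> norm (deriv F 0)) (at 0)"
    unfolding has_field_derivative_iff by (rule tendsto_norm)
  then have "\<forall>\<^sub>F u in at 0. M < norm ((F u - F 0) / (u - 0))"
    by (rule order_tendstoD) (use F(2) in \<open>simp add: M_def\<close>)
  then obtain d where d: "d > 0" "\<And>u. u \<noteq> 0 \<Longrightarrow> norm u < d \<Longrightarrow> M < norm ((F u - F 0) / u)"
    unfolding eventually_at by (auto simp: dist_norm)
  have low: "M * norm u \<le> norm (F u - F 0)" if "norm u < d" for u
    using d(2)[OF _ that] by (cases "u = 0") (auto simp: norm_divide field_simps)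
  define \<rho> where "\<rho> = min (r\<^sup>2) (d\<^sup>2)"
  show thesis
  proof (rule that[of "norm (Gam a c) * M" \<rho>])
    fix k assume k: "0 \<le> Re k" "norm (k - \<kappa>) < \<rho>"
    have "sqrt (norm (k - \<kappa>)) < d"
      using k(2) d(1) by (intro real_less_lsqrt) (auto simp: \<rho>_def)
    then have nd: "norm (csqrt (k - \<kappa>)) < d" by (simp only: norm_csqrt)
    have "k \<in> ball \<kappa> (r\<^sup>2)" "\<kappa> \<in> ball \<kappa> (r\<^sup>2)"
      using k(2) r by (auto simp: \<rho>_def dist_norm norm_minus_commute)
    then have "PhiR k - PhiR \<kappa> = F (csqrt (k - \<kappa>)) - F (csqrt (\<kappa> - \<kappa>))"
      using eq k(1) Re_G[OF assms] by simp
    then have "AR k - AR \<kappa> = Gam a c * (F (csqrt (k - \<kappa>)) - F 0)"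
      by (simp add: AR_def flip: right_diff_distrib)
    then show "norm (Gam a c) * M * sqrt (norm (k - \<kappa>)) \<le> norm (AR k - AR \<kappa>)"
      using mult_left_mono[OF low[OF nd], of "norm (Gam a c)"]
      by (simp add: norm_mult mult.assoc del: csqrt.simps)
  qed (use M Gam_nonzero r d in \<open>auto simp: \<rho>_def\<close>)
qed

end

section \<open>Functions without a jump\<close>

lemma contour_integral_rectpath:
  assumes "continuous_on (path_image (rectpath a1 a3)) h"
  defines "a2 \<equiv> Complex (Re a3) (Im a1)" and "a4 \<equiv> Complex (Re a1) (Im a3)"
  shows "contour_integral (rectpath a1 a3) h = contour_integral (linepath a1 a2) h
    + contour_integral (linepath a2 a3) h + contour_integral (linepath a3 a4) h + contour_integral (linepath a4 a1) h"
proof -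
  have pi: "path_image (rectpath a1 a3) =
      closed_segment a1 a2 \<union> closed_segment a2 a3 \<union> closed_segment a3 a4 \<union> closed_segment a4 a1"
    by (simp add: rectpath_def Let_def path_image_join a2_def a4_def Un_assoc)
  have "h contour_integrable_on linepath a1 a2" "h contour_integrable_on linepath a2 a3"
    "h contour_integrable_on linepath a3 a4" "h contour_integrable_on linepath a4 a1"
    using assms(1) unfolding pi
    by (intro contour_integrable_continuous_linepath; auto intro: continuous_on_subset)+
  then show ?thesis
    unfolding rectpath_def Let_def a2_def[symmetric] a4_def[symmetric]
    by (simp add: contour_integrable_joinI)
qed

lemma norm_contour_integral_linepath_le:
  assumes "continuous_on (closed_segment a b) h" "\<And>z. z \<in> closed_segment a b \<Longrightarrow> norm (h z) \<le> B"
    and "norm (b - a) \<le> L"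
  shows "norm (contour_integral (linepath a b) h) \<le> B * L"
proof -
  have "0 \<le> B" using assms(2)[of a] norm_ge_zero[of "h a"] by (smt (verit) ends_in_segment(1))
  have "norm (contour_integral (linepath a b) h) \<le> B * norm (b - a)"
    using has_contour_integral_bound_linepath[OF has_contour_integral_integral[OF
        contour_integrable_continuous_linepath[OF assms(1)]] \<open>0 \<le> B\<close> assms(2)] .
  also have "\<dots> \<le> B * L" using assms(3) \<open>0 \<le> B\<close> by (rule mult_left_mono)
  finally show ?thesis .
qed

context branch_points
begin

lemma vertical_line_continuous:
  assumes "f holomorphic_on - contour c" "x \<noteq> 0"
  shows "continuous_on A (\<lambda>y. f (Complex x y))"
proof (rule continuous_on_compose2[OF holomorphic_on_imp_continuous_on[OF assms(1)]])
  show "continuous_on A (\<lambda>y. Complex x y)"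
    by (auto intro!: continuous_intros simp: complex_eq)
qed (use assms(2) in \<open>auto simp: contour_iff[OF c_pos]\<close>)

text \<open>
  Changing the line of integration from \<open>Re z = e\<close> to \<open>Re z = - e\<close> changes the Cauchy kernel by \<open>O(e)\<close>.
  The difference of the two Cauchy integrands is thus controlled by the jump alone, up to \<open>O(e)\<close> times
  the density.
\<close>

lemma jump_kernel_bound:
  assumes e: "0 < e" "e < Re k / 2"
  defines "d \<equiv> Re k / 2"
  shows "norm (p / (Complex (- e) y - k) - q / (Complex e y - k))
      \<le> (1 / d) * norm (q - p) + (2 * e / d\<^sup>2) * norm p"
proof -
  let ?u = "Complex e y - k" and ?v = "Complex (- e) y - k"
  have d: "d > 0" using e by (simp add: d_def)
  have u: "d \<le> norm ?u" "d \<le> norm ?v"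
    using e abs_Re_le_cmod[of ?u] abs_Re_le_cmod[of ?v] by (simp_all add: d_def)
  then have nz: "?u \<noteq> 0" "?v \<noteq> 0" using d by (metis norm_zero not_less)+
  have "p / ?v - q / ?u = - ((q - p) / ?u) + p * ((?u - ?v) / (?u * ?v))"
  proof -
    have "(u - v) / (u * v) = 1 / v - 1 / u" if "u \<noteq> 0" "v \<noteq> 0" for u v :: complex
      using that by (simp add: field_simps)
    from this[OF nz] show ?thesis by (simp add: diff_divide_distrib right_diff_distrib)
  qed
  then have "norm (p / ?v - q / ?u) \<le> norm (- ((q - p) / ?u)) + norm (p * ((?u - ?v) / (?u * ?v)))"
    using norm_triangle_ineq by metis
  also have "norm (- ((q - p) / ?u)) \<le> (1 / d) * norm (q - p)"
    using u(1) d by (simp add: norm_divide frac_le)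
  also have "norm (p * ((?u - ?v) / (?u * ?v))) \<le> (2 * e / d\<^sup>2) * norm p"
  proof -
    have "?u - ?v = of_real (2 * e)" by (simp add: complex_eq_iff)
    then have "norm (?u - ?v) = 2 * e" using e by (simp only: norm_of_real)
    moreover have "d\<^sup>2 \<le> norm ?u * norm ?v"
      unfolding power2_eq_square using u d by (intro mult_mono) auto
    ultimately have "norm ((?u - ?v) / (?u * ?v)) \<le> 2 * e / d\<^sup>2"
      unfolding norm_divide norm_mult using d e by (intro frac_le) auto
    then show ?thesis
      unfolding norm_mult by (subst mult.commute) (rule mult_right_mono, auto)
  qed
  finally show ?thesis by simp
qed

text \<open>
  Cauchy's formula on the rectangle between \<open>Re z = e\<close> and \<open>Re z = N\<close>, which contains \<open>k\<close>, plus Cauchy's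
  theorem on the rectangle between \<open>Re z = - N\<close> and \<open>Re z = - e\<close>, which does not. The two edges next to
  the axis have opposite orientations and give the integral on the right; the other edges have total
  length at most \<open>8 N\<close>.
\<close>

lemma Cauchy_two_rectangles:
  assumes hol: "f holomorphic_on - contour c"
    and k: "norm k < N" and e: "0 < e" "e < Re k / 2"
    and B: "\<And>z. N \<le> norm z \<Longrightarrow> norm (f z / (z - k)) \<le> B"
  shows "norm (2 * pi * \<i> * f k) \<le> 8 * B * N +
    norm (integral {-N..N} (\<lambda>y. f (Complex (-e) y) / (Complex (-e) y - k) - f (Complex e y) / (Complex e y - k)))"
proof -
  define h where "h z = f z / (z - k)" for z
  have Rek: "Re k < N" "\<bar>Im k\<bar> < N" using k abs_Re_le_cmod[of k] abs_Im_le_cmod[of k] by auto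
  have N: "0 < N" "e < N" using k e Rek by (auto intro: le_less_trans[OF norm_ge_zero])
  have conth: "continuous_on A h" if "A \<subseteq> - contour c - {k}" for A
    unfolding h_def[abs_def] using that
    by (intro continuous_intros continuous_on_subset[OF holomorphic_on_imp_continuous_on[OF hol]]) auto
  have horizontal: "closed_segment (Complex x y) (Complex x' y) = {z. Im z = y \<and> min x x' \<le> Re z \<and> Re z \<le> max x x'}"
    for x x' y by (subst closed_segment_same_Im) (auto simp: closed_segment_eq_real_ivl)
  have vertical: "closed_segment (Complex x y) (Complex x y') = {z. Re z = x \<and> min y y' \<le> Im z \<and> Im z \<le> max y y'}"
    for x y y' by (subst closed_segment_same_Re) (auto simp: closed_segment_eq_real_ivl)
  have len: "norm (Complex x y - Complex x' y) = \<bar>x - x'\<bar>" "norm (Complex x y - Complex x y') = \<bar>y - y'\<bar>" for x x' y y'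
    by (simp_all add: cmod_def)
  have seg: "norm (h z) \<le> B" if "\<bar>Re z\<bar> = N \<or> \<bar>Im z\<bar> = N" for z
    using that abs_Re_le_cmod[of z] abs_Im_le_cmod[of z] B[of z] by (auto simp: h_def)
  \<comment> \<open>On \<open>e \<le> Re z \<le> N\<close> the pole at \<open>k\<close> has winding number 1.\<close>
  define r1 r2 r3 r4 where "r1 = Complex e (- N)" and "r2 = Complex N (- N)" and "r3 = Complex N N" and "r4 = Complex e N"
  have R: "path_image (rectpath r1 r3) \<subseteq> rhp - {k}"
    using e N Rek by (subst path_image_rectpath_cbox_minus_box)
      (auto simp: r1_def r3_def in_cbox_complex_iff in_box_complex_iff)
  have rsub: "rhp - {k} \<subseteq> - contour c - {k}" by (auto simp: contour_iff[OF c_pos])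
  have "(h has_contour_integral 2 * pi * \<i> * winding_number (rectpath r1 r3) k * f k) (rectpath r1 r3)"
    unfolding h_def[abs_def]
    by (rule Cauchy_integral_formula_convex_simple[OF rhp_convex])
      (use R e rhp_open in \<open>auto simp: interior_open contour_iff[OF c_pos] intro: holomorphic_on_subset[OF hol]\<close>)
  moreover have "winding_number (rectpath r1 r3) k = 1"
    by (rule winding_number_rectpath) (use e Rek N in \<open>auto simp: in_box_complex_iff r1_def r3_def\<close>)
  ultimately have "contour_integral (rectpath r1 r3) h = 2 * pi * \<i> * f k"
    using contour_integral_unique by fastforce
  then have right: "2 * pi * \<i> * f k = contour_integral (linepath r1 r2) h + contour_integral (linepath r2 r3) h
      + contour_integral (linepath r3 r4) h + contour_integral (linepath r4 r1) h"
    using contour_integral_rectpath[OF conth[OF subset_trans[OF R rsub]]]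
    by (simp add: r1_def r2_def r3_def r4_def)
  have r_edges: "closed_segment r1 r2 \<subseteq> rhp - {k}" "closed_segment r2 r3 \<subseteq> rhp - {k}" "closed_segment r3 r4 \<subseteq> rhp - {k}"
    using e N Rek by (auto simp: r1_def r2_def r3_def r4_def horizontal vertical)
  have rb: "norm (contour_integral (linepath r1 r2) h) \<le> B * N" "norm (contour_integral (linepath r2 r3) h) \<le> B * (2 * N)" "norm (contour_integral (linepath r3 r4) h) \<le> B * N"
  proof -
    show "norm (contour_integral (linepath r1 r2) h) \<le> B * N"
    proof (rule norm_contour_integral_linepath_le[OF conth])
      show "closed_segment r1 r2 \<subseteq> - contour c - {k}" using r_edges(1) rsub by blast
      show "norm (h z) \<le> B" if "z \<in> closed_segment r1 r2" for z
        using that N e by (intro seg) (auto simp: r1_def r2_def horizontal vertical)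
      show "norm (r2 - r1) \<le> N" using N e by (simp add: r1_def r2_def len)
    qed
    show "norm (contour_integral (linepath r2 r3) h) \<le> B * (2 * N)"
    proof (rule norm_contour_integral_linepath_le[OF conth])
      show "closed_segment r2 r3 \<subseteq> - contour c - {k}" using r_edges(2) rsub by blast
      show "norm (h z) \<le> B" if "z \<in> closed_segment r2 r3" for z
        using that N e by (intro seg) (auto simp: r2_def r3_def horizontal vertical)
      show "norm (r3 - r2) \<le> 2 * N" using N e by (simp add: r2_def r3_def len)
    qed
    show "norm (contour_integral (linepath r3 r4) h) \<le> B * N"
    proof (rule norm_contour_integral_linepath_le[OF conth])
      show "closed_segment r3 r4 \<subseteq> - contour c - {k}" using r_edges(3) rsub by blast
      show "norm (h z) \<le> B" if "z \<in> closed_segment r3 r4" for z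
        using that N e by (intro seg) (auto simp: r3_def r4_def horizontal vertical)
      show "norm (r4 - r3) \<le> N" using N e by (simp add: r3_def r4_def len)
    qed
  qed
  have r41: "contour_integral (linepath r4 r1) h = - (\<i> * integral {-N..N} (\<lambda>y. h (Complex e y)))"
  proof -
    have "closed_segment r1 r4 \<subseteq> - contour c - {k}"
      using e by (auto simp: r1_def r4_def vertical contour_iff[OF c_pos])
    then have "contour_integral (linepath r4 r1) h = - contour_integral (linepath r1 r4) h"
      by (intro contour_integral_reverse_linepath conth) (simp add: closed_segment_commute)
    also have "contour_integral (linepath r1 r4) h = \<i> * integral {-N..N} (\<lambda>y. h (Complex e y))"
      using N by (intro contour_integral_linepath_same_Re) (auto simp: r1_def r4_def)
    finally show ?thesis .
  qed
  \<comment> \<open>On \<open>- N \<le> Re z \<le> - e\<close> the integrand is holomorphic.\<close>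
  define l1 l2 l3 l4 where "l1 = Complex (- N) (- N)" and "l2 = Complex (- e) (- N)" and "l3 = Complex (- e) N" and "l4 = Complex (- N) N"
  have lsub: "{z. Re z < 0} \<subseteq> - contour c - {k}" using e by (auto simp: contour_iff[OF c_pos])
  have L: "path_image (rectpath l1 l3) \<subseteq> {z. Re z < 0}"
    using e N by (subst path_image_rectpath_cbox_minus_box)
      (auto simp: l1_def l3_def in_cbox_complex_iff in_box_complex_iff)
  have "h holomorphic_on {z. Re z < 0}"
    unfolding h_def[abs_def] using lsub
    by (intro holomorphic_intros holomorphic_on_subset[OF hol]) auto
  then have "(h has_contour_integral 0) (rectpath l1 l3)"
    by (rule Cauchy_theorem_convex_simple) (use L in \<open>auto simp: convex_halfspace_Re_lt\<close>)
  then have "contour_integral (rectpath l1 l3) h = 0" by (rule contour_integral_unique)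
  then have left: "0 = contour_integral (linepath l1 l2) h + contour_integral (linepath l2 l3) h
      + contour_integral (linepath l3 l4) h + contour_integral (linepath l4 l1) h"
    using contour_integral_rectpath[OF conth[OF subset_trans[OF L lsub]]]
    by (simp add: l1_def l2_def l3_def l4_def)
  have l_edges: "closed_segment l1 l2 \<subseteq> {z. Re z < 0}" "closed_segment l3 l4 \<subseteq> {z. Re z < 0}" "closed_segment l4 l1 \<subseteq> {z. Re z < 0}"
    using e N Rek by (auto simp: l1_def l2_def l3_def l4_def horizontal vertical)
  have lb: "norm (contour_integral (linepath l1 l2) h) \<le> B * N" "norm (contour_integral (linepath l3 l4) h) \<le> B * N" "norm (contour_integral (linepath l4 l1) h) \<le> B * (2 * N)"
  proof -
    show "norm (contour_integral (linepath l1 l2) h) \<le> B * N"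
    proof (rule norm_contour_integral_linepath_le[OF conth])
      show "closed_segment l1 l2 \<subseteq> - contour c - {k}" using l_edges(1) lsub by blast
      show "norm (h z) \<le> B" if "z \<in> closed_segment l1 l2" for z
        using that N e by (intro seg) (auto simp: l1_def l2_def horizontal vertical)
      show "norm (l2 - l1) \<le> N" using N e by (simp add: l1_def l2_def len)
    qed
    show "norm (contour_integral (linepath l3 l4) h) \<le> B * N"
    proof (rule norm_contour_integral_linepath_le[OF conth])
      show "closed_segment l3 l4 \<subseteq> - contour c - {k}" using l_edges(2) lsub by blast
      show "norm (h z) \<le> B" if "z \<in> closed_segment l3 l4" for z
        using that N e by (intro seg) (auto simp: l3_def l4_def horizontal vertical)
      show "norm (l4 - l3) \<le> N" using N e by (simp add: l3_def l4_def len)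
    qed
    show "norm (contour_integral (linepath l4 l1) h) \<le> B * (2 * N)"
    proof (rule norm_contour_integral_linepath_le[OF conth])
      show "closed_segment l4 l1 \<subseteq> - contour c - {k}" using l_edges(3) lsub by blast
      show "norm (h z) \<le> B" if "z \<in> closed_segment l4 l1" for z
        using that N e by (intro seg) (auto simp: l4_def l1_def horizontal vertical)
      show "norm (l1 - l4) \<le> 2 * N" using N e by (simp add: l4_def l1_def len)
    qed
  qed
  have l23: "contour_integral (linepath l2 l3) h = \<i> * integral {-N..N} (\<lambda>y. h (Complex (- e) y))"
    using contour_integral_linepath_same_Re[of l2 "- e" l3 "- N" N h] N by (simp add: l2_def l3_def)
  have cv: "continuous_on {-N..N} (\<lambda>y. h (Complex x y))" if "x \<noteq> 0" "x \<noteq> Re k" for x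
    unfolding h_def using that
    by (intro continuous_intros vertical_line_continuous[OF hol]) (auto simp: complex_eq intro!: continuous_intros)
  have "integral {-N..N} (\<lambda>y. h (Complex (- e) y)) - integral {-N..N} (\<lambda>y. h (Complex e y))
      = integral {-N..N} (\<lambda>y. h (Complex (- e) y) - h (Complex e y))"
    using e by (intro integral_diff[symmetric] integrable_continuous_interval cv) auto
  then have "2 * pi * \<i> * f k = contour_integral (linepath r1 r2) h + contour_integral (linepath r2 r3) h
      + contour_integral (linepath r3 r4) h + contour_integral (linepath l1 l2) h + contour_integral (linepath l3 l4) h
      + contour_integral (linepath l4 l1) h + \<i> * integral {-N..N} (\<lambda>y. h (Complex (- e) y) - h (Complex e y))"
  proof -
    assume J: "integral {-N..N} (\<lambda>y. h (Complex (- e) y)) - integral {-N..N} (\<lambda>y. h (Complex e y))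
      = integral {-N..N} (\<lambda>y. h (Complex (- e) y) - h (Complex e y))"
    have "2 * pi * \<i> * f k = 2 * pi * \<i> * f k + 0" by simp
    also have "\<dots> = (contour_integral (linepath r1 r2) h + contour_integral (linepath r2 r3) h
      + contour_integral (linepath r3 r4) h + contour_integral (linepath r4 r1) h)
      + (contour_integral (linepath l1 l2) h + contour_integral (linepath l2 l3) h
      + contour_integral (linepath l3 l4) h + contour_integral (linepath l4 l1) h)"
      by (simp only: right left[symmetric])
    finally show ?thesis unfolding r41 l23 J[symmetric] by (simp add: algebra_simps)
  qed
  then have "norm (2 * pi * \<i> * f k) \<le> B * N + B * (2 * N) + B * N + B * N + B * N + B * (2 * N)
      + norm (\<i> * integral {-N..N} (\<lambda>y. h (Complex (- e) y) - h (Complex e y)))"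
    by (simp only:) (intro norm_triangle_mono rb lb order_refl)
  moreover have "B * N + B * (2 * N) + B * N + B * N + B * N + B * (2 * N) = 8 * B * N" by simp
  ultimately show ?thesis
    unfolding h_def by (simp only: norm_mult norm_ii mult_1_left)
qed

text \<open>
  First \<open>e\<close> tends to 0 with the rectangles fixed, which removes the inner edges by the hypothesis on the
  jump; then the outer edges are made small by enlarging the rectangles.
\<close>

lemma no_jump_vanishes_on_rhp:
  assumes hol: "f holomorphic_on - contour c" and inf: "(f \<longlongrightarrow> 0) at_infinity"
    and jump: "\<And>N. R \<le> N \<Longrightarrow>
      ((\<lambda>e. integral {-N..N} (\<lambda>y. norm (f (Complex e y) - f (Complex (-e) y)))) \<longlongrightarrow> 0) (at_right 0)"
    and bdd: "\<And>N. R \<le> N \<Longrightarrow>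
      \<exists>B. \<forall>\<^sub>F e in at_right 0. integral {-N..N} (\<lambda>y. norm (f (Complex (-e) y))) \<le> B"
    and k: "0 < Re k"
  shows "f k = 0"
proof -
  have "norm (2 * pi * \<i> * f k) \<le> 0 + \<delta>" if "\<delta> > 0" for \<delta>
  proof -
    have "\<forall>\<^sub>F z in at_infinity. norm (f z) < \<delta> / 16"
      using tendstoD[OF inf, of "\<delta> / 16"] that by simp
    then obtain N0 where N0: "\<And>z. N0 \<le> norm z \<Longrightarrow> norm (f z) < \<delta> / 16"
      unfolding eventually_at_infinity by blast
    define N where "N = max (max N0 R) (2 * norm k + 1)"
    have "N0 \<le> N" "R \<le> N" "2 * norm k + 1 \<le> N" by (simp_all add: N_def)
    then have N: "N0 \<le> N" "R \<le> N" "norm k < N / 2" "0 < N"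
      using norm_ge_zero[of k] by linarith+
    have B: "norm (f z / (z - k)) \<le> \<delta> / (8 * N)" if z: "N \<le> norm z" for z
    proof -
      have "norm z - norm k \<le> norm (z - k)" by (rule norm_triangle_ineq2)
      then have "N / 2 \<le> norm (z - k)" using N z by linarith
      moreover have "norm (f z) \<le> \<delta> / 16" using N0[of z] z N by simp
      ultimately have "norm (f z / (z - k)) \<le> (\<delta> / 16) / (N / 2)"
        unfolding norm_divide using N \<open>\<delta> > 0\<close> by (intro frac_le) auto
      then show ?thesis by simp
    qed
    obtain C where C: "\<forall>\<^sub>F e in at_right 0. integral {-N..N} (\<lambda>y. norm (f (Complex (-e) y))) \<le> C"
      using bdd[OF N(2)] by blast
    define d where "d = Re k / 2"
    have d: "d > 0" using k by (simp add: d_def)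
    define I where "I e = integral {-N..N} (\<lambda>y. norm (f (Complex e y) - f (Complex (-e) y)))" for e
    have small: "\<forall>\<^sub>F e in at_right 0. e < d" "\<forall>\<^sub>F e in at_right (0::real). 0 < e"
      using d by (auto simp: eventually_at_right_less eventually_at_right_field intro!: exI[of _ d])
    have main: "\<forall>\<^sub>F e in at_right 0. norm (2 * pi * \<i> * f k) \<le> \<delta> + ((1 / d) * I e + (2 * e / d\<^sup>2) * C)"
      using C small
    proof eventually_elim
      case (elim e)
      define h where "h x y = f (Complex x y) / (Complex x y - k)" for x y
      have cf: "continuous_on {-N..N} (\<lambda>y. f (Complex x y))" if "x \<noteq> 0" for x
        by (rule vertical_line_continuous[OF hol that])
      have ch: "continuous_on {-N..N} (h x)" if "x \<noteq> 0" "x \<noteq> Re k" for x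
        unfolding h_def[abs_def] using that
        by (intro continuous_intros cf) (auto simp: complex_eq intro!: continuous_intros)
      have int: "(\<lambda>y. (1 / d) * norm (f (Complex e y) - f (Complex (- e) y)) + (2 * e / d\<^sup>2) * norm (f (Complex (- e) y)))
          integrable_on {-N..N}"
        using elim by (intro integrable_continuous_interval continuous_intros cf) auto
      have "norm (integral {-N..N} (\<lambda>y. h (- e) y - h e y))
          \<le> integral {-N..N} (\<lambda>y. (1 / d) * norm (f (Complex e y) - f (Complex (- e) y)) + (2 * e / d\<^sup>2) * norm (f (Complex (- e) y)))"
      proof (rule integral_norm_bound_integral[OF _ int])
        show "(\<lambda>y. h (- e) y - h e y) integrable_on {-N..N}"
          using elim d by (intro integrable_continuous_interval continuous_intros ch) (auto simp: d_def)
        show "norm (h (- e) y - h e y) \<le> (1 / d) * norm (f (Complex e y) - f (Complex (- e) y)) + (2 * e / d\<^sup>2) * norm (f (Complex (- e) y))" for y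
          unfolding h_def d_def using elim by (intro jump_kernel_bound) (auto simp: d_def)
      qed
      also have "\<dots> = (1 / d) * I e + (2 * e / d\<^sup>2) * integral {-N..N} (\<lambda>y. norm (f (Complex (- e) y)))"
        unfolding I_def using elim
        by (subst integral_add) (auto intro!: integrable_continuous_interval continuous_intros cf)
      also have "\<dots> \<le> (1 / d) * I e + (2 * e / d\<^sup>2) * C"
        using elim by (intro add_left_mono mult_left_mono) auto
      finally have "norm (integral {-N..N} (\<lambda>y. h (- e) y - h e y)) \<le> (1 / d) * I e + (2 * e / d\<^sup>2) * C" .
      moreover have "norm (2 * pi * \<i> * f k) \<le> 8 * (\<delta> / (8 * N)) * N + norm (integral {-N..N} (\<lambda>y. h (- e) y - h e y))"
        unfolding h_def using elim N B by (intro Cauchy_two_rectangles[OF hol]) (auto simp: d_def)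
      ultimately show ?case using N(4) by simp
    qed
    have lim: "((\<lambda>e. \<delta> + ((1 / d) * I e + (2 * e / d\<^sup>2) * C)) \<longlongrightarrow> \<delta> + ((1 / d) * 0 + (2 * 0 / d\<^sup>2) * C)) (at_right 0)"
      unfolding I_def using d by (intro tendsto_intros jump[OF N(2)]) auto
    have "norm (2 * pi * \<i> * f k) \<le> \<delta> + ((1 / d) * 0 + (2 * 0 / d\<^sup>2) * C)"
      by (rule tendsto_lowerbound[OF lim main]) simp
    then show ?thesis by simp
  qed
  then have "norm (2 * pi * \<i> * f k) \<le> 0" by (rule field_le_epsilon)
  then show ?thesis by simp
qed

text \<open>
  Beyond the end points of the contour \<open>f\<close> is uniformly continuous across the axis. So the hypotheses on
  the jump need to be known only on one interval around the contour.
\<close>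

lemma integral_outside_contour_small:
  assumes hol: "f holomorphic_on - contour c" and uv: "u \<le> v" "\<And>y. y \<in> {u..v} \<Longrightarrow> c < \<bar>y\<bar>"
  shows "((\<lambda>e. integral {u..v} (\<lambda>y. norm (f (Complex e y) - f (Complex (-e) y)))) \<longlongrightarrow> 0) (at_right 0)"
    and "\<exists>B. \<forall>\<^sub>F e in at_right 0. integral {u..v} (\<lambda>y. norm (f (Complex (-e) y))) \<le> B"
proof -
  define K where "K = cbox (Complex (- 1) u) (Complex 1 v)"
  have K: "K \<subseteq> - contour c"
    using uv(2) by (auto simp: K_def in_cbox_complex_iff contour_iff[OF c_pos]) (metis atLeastAtMost_iff not_less)
  have cf: "continuous_on K f" and cK: "compact K"
    using holomorphic_on_imp_continuous_on[OF hol] continuous_on_subset[OF _ K] by (auto simp: K_def)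
  have mem: "Complex x y \<in> K" if "\<bar>x\<bar> \<le> 1" "y \<in> {u..v}" for x y
    using that by (auto simp: K_def in_cbox_complex_iff)
  have cl: "continuous_on {u..v} (\<lambda>y. f (Complex x y))" if "\<bar>x\<bar> \<le> 1" for x
    by (rule continuous_on_compose2[OF cf]) (use mem[OF that] in \<open>auto simp: complex_eq intro!: continuous_intros\<close>)
  obtain B where B: "\<And>z. z \<in> K \<Longrightarrow> norm (f z) \<le> B"
    using compact_imp_bounded[OF compact_continuous_image[OF cf cK]] by (auto simp: bounded_iff)
  have ev1: "\<forall>\<^sub>F e in at_right (0::real). 0 < e \<and> e < \<eta>" if "\<eta> > 0" for \<eta>
    using that by (auto simp: eventually_at_right_field)
  show "\<exists>B. \<forall>\<^sub>F e in at_right 0. integral {u..v} (\<lambda>y. norm (f (Complex (-e) y))) \<le> B"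
  proof (intro exI)
    show "\<forall>\<^sub>F e in at_right 0. integral {u..v} (\<lambda>y. norm (f (Complex (-e) y))) \<le> B * (v - u)"
      using ev1[OF zero_less_one]
    proof eventually_elim
      case (elim e)
      have "integral {u..v} (\<lambda>y. norm (f (Complex (-e) y))) \<le> integral {u..v} (\<lambda>y. B)"
        using elim by (intro integral_le integrable_continuous_interval continuous_intros cl B mem) auto
      then show ?case using uv(1) by (simp add: mult.commute)
    qed
  qed
  show "((\<lambda>e. integral {u..v} (\<lambda>y. norm (f (Complex e y) - f (Complex (-e) y)))) \<longlongrightarrow> 0) (at_right 0)"
  proof (rule tendstoI)
    fix \<delta> :: real assume "\<delta> > 0"
    define \<eta> where "\<eta> = \<delta> / (2 * (v - u + 1))"
    have "(v - u) / (2 * (v - u + 1)) < 1" using uv(1) by (simp add: divide_less_eq)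
    from mult_strict_left_mono[OF this \<open>\<delta> > 0\<close>]
    have \<eta>: "\<eta> > 0" "\<eta> * (v - u) < \<delta>"
      using \<open>\<delta> > 0\<close> uv(1) by (auto simp: \<eta>_def intro!: divide_pos_pos)
    obtain d where d: "d > 0" "\<And>z z'. z \<in> K \<Longrightarrow> z' \<in> K \<Longrightarrow> dist z' z < d \<Longrightarrow> dist (f z') (f z) < \<eta>"
      using compact_uniformly_continuous[OF cf cK] \<eta>(1) unfolding uniformly_continuous_on_def by metis
    have "\<forall>\<^sub>F e in at_right (0::real). 0 < e \<and> e < min 1 (d / 2)" using d(1) by (intro ev1) auto
    then show "\<forall>\<^sub>F e in at_right 0. dist (integral {u..v} (\<lambda>y. norm (f (Complex e y) - f (Complex (-e) y)))) 0 < \<delta>"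
    proof eventually_elim
      case (elim e)
      have "norm (f (Complex e y) - f (Complex (-e) y)) \<le> \<eta>" if "y \<in> {u..v}" for y
      proof -
        have "Complex e y - Complex (- e) y = of_real (2 * e)" by (simp add: complex_eq_iff)
        then have "dist (Complex e y) (Complex (- e) y) = 2 * e"
          using elim by (simp only: dist_norm norm_of_real) simp
        then show ?thesis using d(2)[of "Complex (- e) y" "Complex e y"] mem[of e y] mem[of "- e" y] that elim
          by (simp add: dist_norm)
      qed
      then have "integral {u..v} (\<lambda>y. norm (f (Complex e y) - f (Complex (-e) y))) \<le> integral {u..v} (\<lambda>y. \<eta>)"
        using elim by (intro integral_le integrable_continuous_interval continuous_intros cl) auto
      moreover have "0 \<le> integral {u..v} (\<lambda>y. norm (f (Complex e y) - f (Complex (-e) y)))"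
        using elim by (intro integral_nonneg integrable_continuous_interval continuous_intros cl) auto
      ultimately show ?case using \<eta>(2) uv(1) by (simp add: mult.commute)
    qed
  qed
qed

theorem no_jump_vanishes:
  assumes hol: "f holomorphic_on - contour c" and inf: "(f \<longlongrightarrow> 0) at_infinity" and R: "c < R"
    and jump: "((\<lambda>e. integral {-R..R} (\<lambda>y. norm (f (Complex e y) - f (Complex (-e) y)))) \<longlongrightarrow> 0) (at_right 0)"
    and bdd: "\<forall>\<^sub>F e in at_right 0. integral {-R..R} (\<lambda>y. norm (f (Complex (-e) y))) \<le> B"
    and k: "k \<notin> contour c"
  shows "f k = 0"
proof -
  have split: "integral {-N..N} g = integral {-N..-R} g + integral {-R..R} g + integral {R..N} g"
    if "R \<le> N" "continuous_on {-N..N} g" for N and g :: "real \<Rightarrow> real"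
  proof -
    have g: "g integrable_on {-N..N}" "g integrable_on {-R..N}"
      using that R c_pos by (auto intro!: integrable_continuous_interval intro: continuous_on_subset)
    have "integral {-N..-R} g + integral {-R..N} g = integral {-N..N} g"
      using that R c_pos g by (intro Henstock_Kurzweil_Integration.integral_combine) auto
    moreover have "integral {-R..R} g + integral {R..N} g = integral {-R..N} g"
      using that R c_pos g by (intro Henstock_Kurzweil_Integration.integral_combine) auto
    ultimately show ?thesis by simp
  qed
  have cf: "continuous_on A (\<lambda>y. f (Complex x y))" if "x \<noteq> 0" for x A
    by (rule vertical_line_continuous[OF hol that])
  have pos: "\<forall>\<^sub>F e in at_right (0::real). 0 < e" by (simp add: eventually_at_right_less)
  have rhp0: "f k = 0" if "0 < Re k" for k
  proof (rule no_jump_vanishes_on_rhp[OF hol inf _ _ that, of R])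
    fix N assume N: "R \<le> N"
    have lo: "c < \<bar>y\<bar>" if "y \<in> {-N..-R}" for y using that R by auto
    have up: "c < \<bar>y\<bar>" if "y \<in> {R..N}" for y using that R by auto
    have NR: "- N \<le> - R" using N by simp
    let ?I = "\<lambda>u v e. integral {u..v} (\<lambda>y. norm (f (Complex e y) - f (Complex (-e) y)))"
    have "((\<lambda>e. ?I (-N) (-R) e + ?I (-R) R e + ?I R N e) \<longlongrightarrow> 0 + 0 + 0) (at_right 0)"
      by (intro tendsto_add jump integral_outside_contour_small(1)[OF hol] NR N lo up)
    then have "((\<lambda>e. ?I (-N) (-R) e + ?I (-R) R e + ?I R N e) \<longlongrightarrow> 0) (at_right 0)" by simp
    then show "(?I (-N) N \<longlongrightarrow> 0) (at_right 0)"
    proof (rule Lim_transform_eventually)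
      show "\<forall>\<^sub>F e in at_right 0. ?I (-N) (-R) e + ?I (-R) R e + ?I R N e = ?I (-N) N e"
        using pos by eventually_elim (intro split[symmetric] N continuous_intros cf, auto)
    qed
    obtain B1 where B1: "\<forall>\<^sub>F e in at_right 0. integral {-N..-R} (\<lambda>y. norm (f (Complex (-e) y))) \<le> B1"
      using integral_outside_contour_small(2)[OF hol NR lo] by blast
    obtain B2 where B2: "\<forall>\<^sub>F e in at_right 0. integral {R..N} (\<lambda>y. norm (f (Complex (-e) y))) \<le> B2"
      using integral_outside_contour_small(2)[OF hol N up] by blast
    have "\<forall>\<^sub>F e in at_right 0. integral {-N..N} (\<lambda>y. norm (f (Complex (-e) y))) \<le> B1 + B + B2"
      using B1 B2 bdd pos
    proof eventually_elim
      case (elim e)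
      have "integral {-N..N} (\<lambda>y. norm (f (Complex (-e) y))) = integral {-N..-R} (\<lambda>y. norm (f (Complex (-e) y)))
          + integral {-R..R} (\<lambda>y. norm (f (Complex (-e) y))) + integral {R..N} (\<lambda>y. norm (f (Complex (-e) y)))"
        using elim by (intro split N continuous_intros cf) auto
      then show ?case using elim by linarith
    qed
    then show "\<exists>B. \<forall>\<^sub>F e in at_right 0. integral {-N..N} (\<lambda>y. norm (f (Complex (-e) y))) \<le> B" by blast
  qed
  show ?thesis
  proof (rule analytic_continuation_open[of rhp "- contour c" f "\<lambda>_. 0"])
    show "rhp \<noteq> {}" by (auto intro!: exI[of _ 1])
  qed (use rhp0 hol k rhp_open open_minus_contour connected_minus_contour in \<open>auto simp: contour_iff[OF c_pos]\<close>)
qed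

end

section \<open>Limits in mean\<close>

text \<open>
  Convergence in \<open>L^p\<close> to a \<open>p\<close>-integrable limit, for representatives rather than classes of functions.
\<close>

definition Lp_lim :: "nat \<Rightarrow> 'b measure \<Rightarrow> 'e filter \<Rightarrow> ('e \<Rightarrow> 'b \<Rightarrow> complex) \<Rightarrow> ('b \<Rightarrow> complex) \<Rightarrow> bool" where
  "Lp_lim p M F X x \<longleftrightarrow> x \<in> borel_measurable M \<and> (\<forall>\<^sub>F e in F. X e \<in> borel_measurable M) \<and>
     (\<integral>\<^sup>+y. ennreal (norm (x y) ^ p) \<partial>M) < \<infinity> \<and>
     ((\<lambda>e. \<integral>\<^sup>+y. ennreal (norm (X e y - x y) ^ p) \<partial>M) \<longlongrightarrow> 0) F"

lemma Lp_lim_cong_AE: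
  assumes "Lp_lim p M F X x" "x' \<in> borel_measurable M" "AE y in M. x y = x' y"
  shows "Lp_lim p M F X x'"
proof -
  have "(\<integral>\<^sup>+y. ennreal (norm (x y) ^ p) \<partial>M) = (\<integral>\<^sup>+y. ennreal (norm (x' y) ^ p) \<partial>M)"
    using assms(3) by (intro nn_integral_cong_AE) (auto elim: eventually_mono)
  moreover have "(\<integral>\<^sup>+y. ennreal (norm (X e y - x y) ^ p) \<partial>M) = (\<integral>\<^sup>+y. ennreal (norm (X e y - x' y) ^ p) \<partial>M)" for e
    using assms(3) by (intro nn_integral_cong_AE) (auto elim: eventually_mono)
  ultimately show ?thesis using assms(1,2) by (simp add: Lp_lim_def)
qed

lemma nn_integral_norm_diff_power_le:
  fixes u v :: "'b \<Rightarrow> complex"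
  assumes p: "p = 1 \<or> p = 2" and [measurable]: "u \<in> borel_measurable M" "v \<in> borel_measurable M"
  shows "(\<integral>\<^sup>+y. ennreal (norm (u y - v y) ^ p) \<partial>M)
    \<le> 2 * ((\<integral>\<^sup>+y. ennreal (norm (u y) ^ p) \<partial>M) + (\<integral>\<^sup>+y. ennreal (norm (v y) ^ p) \<partial>M))"
proof -
  have le: "norm (x - z) ^ p \<le> 2 * (norm x ^ p + norm z ^ p)" for x z :: complex
  proof (cases "p = 1")
    case True
    have "norm (x - z) \<le> norm x + norm z" by (rule norm_triangle_ineq4)
    also have "norm x + norm z \<le> 2 * (norm x + norm z)"
      by (simp add: add_nonneg_nonneg)
    finally show ?thesis using True by simp
  next
    case False
    have "norm (x - z) ^ 2 \<le> (norm x + norm z) ^ 2"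
      by (intro power_mono norm_triangle_ineq4) auto
    also have "\<dots> \<le> 2 * (norm x ^ 2 + norm z ^ 2)"
      using sum_squares_bound[of "norm x" "norm z"] by (simp add: power2_eq_square algebra_simps)
    finally show ?thesis using False p by simp
  qed
  have "(\<integral>\<^sup>+y. ennreal (norm (u y - v y) ^ p) \<partial>M) \<le> (\<integral>\<^sup>+y. 2 * (ennreal (norm (u y) ^ p) + ennreal (norm (v y) ^ p)) \<partial>M)"
  proof (intro nn_integral_mono)
    fix y
    have "ennreal (2 * (norm (u y) ^ p + norm (v y) ^ p)) = ennreal 2 * ennreal (norm (u y) ^ p + norm (v y) ^ p)"
      by (intro ennreal_mult) auto
    also have "ennreal (norm (u y) ^ p + norm (v y) ^ p) = ennreal (norm (u y) ^ p) + ennreal (norm (v y) ^ p)"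
      by (intro ennreal_plus) auto
    finally have "2 * (ennreal (norm (u y) ^ p) + ennreal (norm (v y) ^ p)) = ennreal (2 * (norm (u y) ^ p + norm (v y) ^ p))"
      by simp
    then show "ennreal (norm (u y - v y) ^ p) \<le> 2 * (ennreal (norm (u y) ^ p) + ennreal (norm (v y) ^ p))"
      by (simp only:) (rule ennreal_leI[OF le])
  qed
  then show ?thesis by (simp add: nn_integral_cmult nn_integral_add)
qed

lemma Lp_lim_diff:
  assumes p: "p = 1 \<or> p = 2" and X: "Lp_lim p M F X x" and Y: "Lp_lim p M F Y y"
  shows "Lp_lim p M F (\<lambda>e t. X e t - Y e t) (\<lambda>t. x t - y t)"
proof -
  note [measurable] = X[unfolded Lp_lim_def, THEN conjunct1] Y[unfolded Lp_lim_def, THEN conjunct1]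
  have ev: "\<forall>\<^sub>F e in F. X e \<in> borel_measurable M" "\<forall>\<^sub>F e in F. Y e \<in> borel_measurable M"
    using X Y by (auto simp: Lp_lim_def)
  have fin: "(\<integral>\<^sup>+t. ennreal (norm (x t - y t) ^ p) \<partial>M) < \<infinity>"
    by (rule le_less_trans[OF nn_integral_norm_diff_power_le[OF p]])
      (use X Y in \<open>auto simp: Lp_lim_def ennreal_mult_less_top\<close>)
  let ?I = "\<lambda>e. \<integral>\<^sup>+t. ennreal (norm (X e t - x t) ^ p) \<partial>M"
  let ?J = "\<lambda>e. \<integral>\<^sup>+t. ennreal (norm (Y e t - y t) ^ p) \<partial>M"
  have "((\<lambda>e. 2 * (?I e + ?J e)) \<longlongrightarrow> 2 * (0 + 0)) F"
    using X Y by (intro ennreal_tendsto_cmult tendsto_add) (auto simp: Lp_lim_def)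
  then have lim: "((\<lambda>e. 2 * (?I e + ?J e)) \<longlongrightarrow> 0) F" by simp
  have "((\<lambda>e. \<integral>\<^sup>+t. ennreal (norm (X e t - Y e t - (x t - y t)) ^ p) \<partial>M) \<longlongrightarrow> 0) F"
  proof (rule tendsto_sandwich[OF _ _ tendsto_const lim])
    show "\<forall>\<^sub>F e in F. (\<integral>\<^sup>+t. ennreal (norm (X e t - Y e t - (x t - y t)) ^ p) \<partial>M) \<le> 2 * (?I e + ?J e)"
      using ev
    proof eventually_elim
      case (elim e)
      note [measurable] = elim
      have "X e t - Y e t - (x t - y t) = (X e t - x t) - (Y e t - y t)" for t by simp
      then show ?case
        by (simp only:) (rule nn_integral_norm_diff_power_le[OF p], auto)
    qed
  qed simp
  moreover have "\<forall>\<^sub>F e in F. (\<lambda>t. X e t - Y e t) \<in> borel_measurable M"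
    using ev by eventually_elim simp
  ultimately show ?thesis using fin by (simp add: Lp_lim_def)
qed

lemma ennreal_tendsto_0_square:
  fixes A B :: "'e \<Rightarrow> ennreal"
  assumes "(B \<longlongrightarrow> 0) F" "\<forall>\<^sub>F e in F. (A e)\<^sup>2 \<le> B e"
  shows "(A \<longlongrightarrow> 0) F"
proof (rule order_tendstoI)
  fix \<delta> :: ennreal assume "0 < \<delta>"
  then have "0 < \<delta>\<^sup>2" by (simp add: power2_eq_square ennreal_zero_less_mult_iff)
  then have "\<forall>\<^sub>F e in F. B e < \<delta>\<^sup>2" using assms(1) by (rule order_tendstoD(2)[rotated])
  with assms(2) show "\<forall>\<^sub>F e in F. A e < \<delta>"
  proof eventually_elim
    case (elim e)
    show ?case
    proof (rule ccontr)
      assume "\<not> A e < \<delta>"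
      then have "\<delta>\<^sup>2 \<le> (A e)\<^sup>2" by (intro power_mono) auto
      then show False using elim by (metis leD order_trans)
    qed
  qed
qed simp

lemma Cauchy_Schwarz_norm:
  fixes u v :: "'b \<Rightarrow> complex"
  assumes [measurable]: "u \<in> borel_measurable M" "v \<in> borel_measurable M"
  shows "(\<integral>\<^sup>+t. ennreal (norm (u t * v t)) \<partial>M)\<^sup>2
    \<le> (\<integral>\<^sup>+t. ennreal (norm (u t) ^ 2) \<partial>M) * (\<integral>\<^sup>+t. ennreal (norm (v t) ^ 2) \<partial>M)"
  using Cauchy_Schwarz_nn_integral[of "\<lambda>t. ennreal (norm (u t))" M "\<lambda>t. ennreal (norm (v t))"]
  by (simp add: norm_mult ennreal_mult ennreal_power)

text \<open>
  Write \<open>X Y - x y = (X - x) (Y - y) + x (Y - y) + (X - x) y\<close> and apply the Cauchy-Schwarz inequality to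
  each summand.
\<close>

lemma L2_lim_mult:
  assumes X: "Lp_lim 2 M F X x" and Y: "Lp_lim 2 M F Y y"
  shows "Lp_lim 1 M F (\<lambda>e t. X e t * Y e t) (\<lambda>t. x t * y t)"
proof -
  note [measurable] = X[unfolded Lp_lim_def, THEN conjunct1] Y[unfolded Lp_lim_def, THEN conjunct1]
  have ev: "\<forall>\<^sub>F e in F. X e \<in> borel_measurable M" "\<forall>\<^sub>F e in F. Y e \<in> borel_measurable M"
    using X Y by (auto simp: Lp_lim_def)
  let ?x = "\<integral>\<^sup>+t. ennreal (norm (x t) ^ 2) \<partial>M" and ?y = "\<integral>\<^sup>+t. ennreal (norm (y t) ^ 2) \<partial>M"
  let ?X = "\<lambda>e. \<integral>\<^sup>+t. ennreal (norm (X e t - x t) ^ 2) \<partial>M" and ?Y = "\<lambda>e. \<integral>\<^sup>+t. ennreal (norm (Y e t - y t) ^ 2) \<partial>M"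
  have fin: "?x < \<infinity>" "?y < \<infinity>" and lim: "(?X \<longlongrightarrow> 0) F" "(?Y \<longlongrightarrow> 0) F"
    using X Y by (auto simp: Lp_lim_def)
  have "(\<integral>\<^sup>+t. ennreal (norm (x t * y t)) \<partial>M)\<^sup>2 < \<infinity>"
    by (rule le_less_trans[OF Cauchy_Schwarz_norm]) (use fin in \<open>auto simp: ennreal_mult_less_top\<close>)
  then have finxy: "(\<integral>\<^sup>+t. ennreal (norm (x t * y t)) \<partial>M) < \<infinity>"
    by (auto simp: power2_eq_square ennreal_mult_less_top)
  let ?A = "\<lambda>e. \<integral>\<^sup>+t. ennreal (norm ((X e t - x t) * (Y e t - y t))) \<partial>M"
  let ?B = "\<lambda>e. \<integral>\<^sup>+t. ennreal (norm (x t * (Y e t - y t))) \<partial>M"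
  let ?C = "\<lambda>e. \<integral>\<^sup>+t. ennreal (norm ((X e t - x t) * y t)) \<partial>M"
  have A: "(?A \<longlongrightarrow> 0) F"
  proof (rule ennreal_tendsto_0_square)
    show "((\<lambda>e. ?X e * ?Y e) \<longlongrightarrow> 0) F"
      using tendsto_mult_ennreal[OF lim] by simp
    show "\<forall>\<^sub>F e in F. (?A e)\<^sup>2 \<le> ?X e * ?Y e"
      using ev by eventually_elim (rule Cauchy_Schwarz_norm, auto)
  qed
  have B: "(?B \<longlongrightarrow> 0) F"
  proof (rule ennreal_tendsto_0_square)
    show "((\<lambda>e. ?x * ?Y e) \<longlongrightarrow> 0) F"
      using ennreal_tendsto_cmult[OF _ lim(2), of ?x] fin by simp
    show "\<forall>\<^sub>F e in F. (?B e)\<^sup>2 \<le> ?x * ?Y e"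
      using ev by eventually_elim (rule Cauchy_Schwarz_norm, auto)
  qed
  have C: "(?C \<longlongrightarrow> 0) F"
  proof (rule ennreal_tendsto_0_square)
    show "((\<lambda>e. ?X e * ?y) \<longlongrightarrow> 0) F"
      using ennreal_tendsto_cmult[OF _ lim(1), of ?y] fin by (simp add: mult.commute)
    show "\<forall>\<^sub>F e in F. (?C e)\<^sup>2 \<le> ?X e * ?y"
      using ev by eventually_elim (rule Cauchy_Schwarz_norm, auto)
  qed
  have "((\<lambda>e. ?A e + ?B e + ?C e) \<longlongrightarrow> 0 + 0 + 0) F"
    by (intro tendsto_add A B C)
  then have sum: "((\<lambda>e. ?A e + ?B e + ?C e) \<longlongrightarrow> 0) F" by simp
  have "((\<lambda>e. \<integral>\<^sup>+t. ennreal (norm (X e t * Y e t - x t * y t)) \<partial>M) \<longlongrightarrow> 0) F"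
  proof (rule tendsto_sandwich[OF _ _ tendsto_const sum])
    show "\<forall>\<^sub>F e in F. (\<integral>\<^sup>+t. ennreal (norm (X e t * Y e t - x t * y t)) \<partial>M) \<le> ?A e + ?B e + ?C e"
      using ev
    proof eventually_elim
      case (elim e)
      note [measurable] = elim
      have "norm (X e t * Y e t - x t * y t)
          \<le> norm ((X e t - x t) * (Y e t - y t)) + norm (x t * (Y e t - y t)) + norm ((X e t - x t) * y t)" for t
      proof -
        have "X e t * Y e t - x t * y t
            = (X e t - x t) * (Y e t - y t) + x t * (Y e t - y t) + (X e t - x t) * y t"
          by (simp add: algebra_simps)
        then show ?thesis by (simp only:) (intro norm_triangle_mono order_refl)
      qed
      then have "(\<integral>\<^sup>+t. ennreal (norm (X e t * Y e t - x t * y t)) \<partial>M)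
          \<le> (\<integral>\<^sup>+t. ennreal (norm ((X e t - x t) * (Y e t - y t))) + ennreal (norm (x t * (Y e t - y t)))
              + ennreal (norm ((X e t - x t) * y t)) \<partial>M)"
        by (intro nn_integral_mono) (simp add: ennreal_leI flip: ennreal_plus)
      also have "\<dots> = ?A e + ?B e + ?C e"
        by (simp add: nn_integral_add)
      finally show ?case .
    qed
  qed simp
  moreover have "\<forall>\<^sub>F e in F. (\<lambda>t. X e t * Y e t) \<in> borel_measurable M"
    using ev by eventually_elim simp
  ultimately show ?thesis using finxy by (simp add: Lp_lim_def)
qed

lemma L1_lim_mult_uniform:
  assumes X: "Lp_lim 1 M F X x"
    and W: "\<forall>\<^sub>F e in F. W e \<in> borel_measurable M" and v: "v \<in> borel_measurable M"
    and B: "\<forall>\<^sub>F e in F. \<forall>t\<in>space M. norm (W e t) \<le> B" "\<And>t. t \<in> space M \<Longrightarrow> norm (v t) \<le> B"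
    and unif: "\<And>\<delta>. \<delta> > 0 \<Longrightarrow> \<forall>\<^sub>F e in F. \<forall>t\<in>space M. norm (W e t - v t) \<le> \<delta>"
  shows "Lp_lim 1 M F (\<lambda>e t. X e t * W e t) (\<lambda>t. x t * v t)"
proof -
  note [measurable] = X[unfolded Lp_lim_def, THEN conjunct1] v
  have ev: "\<forall>\<^sub>F e in F. X e \<in> borel_measurable M" using X by (auto simp: Lp_lim_def)
  let ?x = "\<integral>\<^sup>+t. ennreal (norm (x t)) \<partial>M"
  let ?X = "\<lambda>e. \<integral>\<^sup>+t. ennreal (norm (X e t - x t)) \<partial>M"
  have fin: "?x < \<infinity>" and lim: "(?X \<longlongrightarrow> 0) F"
    using X by (auto simp: Lp_lim_def)
  define C where "C = max B 0"
  have C: "0 \<le> C" "B \<le> C" by (auto simp: C_def)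
  have "(\<integral>\<^sup>+t. ennreal (norm (x t * v t)) \<partial>M) \<le> (\<integral>\<^sup>+t. ennreal C * ennreal (norm (x t)) \<partial>M)"
  proof (rule nn_integral_mono)
    fix t assume "t \<in> space M"
    then have "norm (x t) * norm (v t) \<le> norm (x t) * C"
      using B(2)[of t] C by (intro mult_left_mono) auto
    then show "ennreal (norm (x t * v t)) \<le> ennreal C * ennreal (norm (x t))"
      using C by (simp add: norm_mult ennreal_leI mult.commute flip: ennreal_mult)
  qed
  also have "\<dots> = ennreal C * ?x" by (rule nn_integral_cmult) simp
  also have "\<dots> < \<infinity>" using fin by (simp add: ennreal_mult_less_top)
  finally have finxw: "(\<integral>\<^sup>+t. ennreal (norm (x t * v t)) \<partial>M) < \<infinity>" .
  have bound: "\<forall>\<^sub>F e in F. (\<integral>\<^sup>+t. ennreal (norm (X e t * W e t - x t * v t)) \<partial>M) \<le> ennreal C * ?X e + ennreal \<delta> * ?x"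
    if "\<delta> > 0" for \<delta>
    using ev W B(1) unif[OF that]
  proof eventually_elim
    case (elim e)
    note [measurable] = elim(1,2)
    have "norm (X e t * W e t - x t * v t) \<le> C * norm (X e t - x t) + \<delta> * norm (x t)" if "t \<in> space M" for t
    proof -
      have "X e t * W e t - x t * v t = (X e t - x t) * W e t + x t * (W e t - v t)"
        by (simp add: algebra_simps)
      moreover have "norm ((X e t - x t) * W e t) \<le> C * norm (X e t - x t)"
        unfolding norm_mult using elim(3) that C
        by (subst mult.commute) (intro mult_right_mono, auto intro: order_trans)
      moreover have "norm (x t * (W e t - v t)) \<le> \<delta> * norm (x t)"
        unfolding norm_mult using elim(4) that by (subst mult.commute) (intro mult_right_mono, auto)
      ultimately show ?thesis by (simp only:) (intro norm_triangle_mono)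
    qed
    then have "(\<integral>\<^sup>+t. ennreal (norm (X e t * W e t - x t * v t)) \<partial>M)
        \<le> (\<integral>\<^sup>+t. ennreal C * ennreal (norm (X e t - x t)) + ennreal \<delta> * ennreal (norm (x t)) \<partial>M)"
      using C that by (intro nn_integral_mono) (simp add: ennreal_leI flip: ennreal_plus ennreal_mult)
    also have "\<dots> = ennreal C * ?X e + ennreal \<delta> * ?x"
      by (simp add: nn_integral_add nn_integral_cmult)
    finally show ?case .
  qed
  have "((\<lambda>e. \<integral>\<^sup>+t. ennreal (norm (X e t * W e t - x t * v t)) \<partial>M) \<longlongrightarrow> 0) F"
  proof (rule order_tendstoI)
    fix \<eta> :: ennreal assume "0 < \<eta>"
    then obtain z where z: "0 < z" "z < \<eta>" using dense by blast
    then obtain r where "z = ennreal r" by (cases z) auto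
    with z have r: "0 < r" "ennreal r < \<eta>" by auto
    obtain q where q: "0 \<le> q" "?x = ennreal q" using fin by (cases ?x) auto
    define \<delta> where "\<delta> = r / (2 * (q + 1))"
    have \<delta>: "\<delta> > 0" "\<delta> * q \<le> r / 2"
    proof -
      show "\<delta> > 0" using r q by (simp add: \<delta>_def)
      have "q / (q + 1) \<le> 1" using q by (simp add: divide_le_eq)
      then have "r / 2 * (q / (q + 1)) \<le> r / 2 * 1" using r by (intro mult_left_mono) auto
      then show "\<delta> * q \<le> r / 2" by (simp add: \<delta>_def)
    qed
    have "((\<lambda>e. ennreal C * ?X e) \<longlongrightarrow> 0) F"
      using ennreal_tendsto_cmult[OF _ lim, of "ennreal C"] by simp
    then have "\<forall>\<^sub>F e in F. ennreal C * ?X e < ennreal (r / 2)"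
      by (rule order_tendstoD) (use r in simp)
    with bound[OF \<delta>(1)] show "\<forall>\<^sub>F e in F. (\<integral>\<^sup>+t. ennreal (norm (X e t * W e t - x t * v t)) \<partial>M) < \<eta>"
    proof eventually_elim
      case (elim e)
      have "ennreal \<delta> * ?x \<le> ennreal (r / 2)"
        using q \<delta> by (simp add: ennreal_leI flip: ennreal_mult)
      then have "ennreal C * ?X e + ennreal \<delta> * ?x \<le> ennreal (r / 2) + ennreal (r / 2)"
        using elim by (intro add_mono) auto
      also have "\<dots> = ennreal r" using r by (simp flip: ennreal_plus)
      finally show ?case using elim(1) r(2) by (meson le_less_trans order_trans)
    qed
  qed simp
  moreover have "\<forall>\<^sub>F e in F. (\<lambda>t. X e t * W e t) \<in> borel_measurable M"
    using ev W by eventually_elim simp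
  ultimately show ?thesis using finxw by (simp add: Lp_lim_def)
qed

lemma nn_integral_lebesgue_on_continuous:
  fixes \<phi> :: "real \<Rightarrow> real"
  assumes "continuous_on {u..v} \<phi>" "\<And>y. y \<in> {u..v} \<Longrightarrow> 0 \<le> \<phi> y"
  shows "(\<integral>\<^sup>+y. ennreal (\<phi> y) \<partial>lebesgue_on {u..v}) = ennreal (integral {u..v} \<phi>)"
proof -
  have "(\<integral>\<^sup>+y. ennreal (\<phi> y) \<partial>lebesgue_on {u..v}) = (\<integral>\<^sup>+y. ennreal (\<phi> y) * indicator {u..v} y \<partial>lebesgue)"
    by (rule nn_integral_restrict_space) simp
  also have "\<dots> = (\<integral>\<^sup>+y. ennreal (indicator {u..v} y * \<phi> y) \<partial>lborel)"
    unfolding nn_integral_completion by (intro nn_integral_cong) (simp add: indicator_def)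
  also have "\<dots> = ennreal (integral {u..v} \<phi>)"
    by (rule nn_integral_has_integral_lebesgue[OF assms(2)])
      (use assms(1) in \<open>auto intro: integrable_integral integrable_continuous_interval\<close>)
  finally show ?thesis .
qed

context branch_points
begin

text \<open>
  The common limit \<open>g\<close> bounds the jump by the triangle inequality.
\<close>

lemma L1_no_jump_vanishes:
  assumes hol: "f holomorphic_on - contour c" and inf: "(f \<longlongrightarrow> 0) at_infinity" and R: "c < R"
    and p: "Lp_lim 1 (lebesgue_on {-R..R}) (at_right 0) (\<lambda>e y. f (Complex e y)) g"
    and m: "Lp_lim 1 (lebesgue_on {-R..R}) (at_right 0) (\<lambda>e y. f (Complex (- e) y)) g"
    and k: "k \<notin> contour c"
  shows "f k = 0"
proof -
  let ?M = "lebesgue_on {-R..R}"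
  note [measurable] = p[unfolded Lp_lim_def, THEN conjunct1]
  have cf: "continuous_on A (\<lambda>y. f (Complex x y))" if "x \<noteq> 0" for x A
    by (rule vertical_line_continuous[OF hol that])
  have meas: "(\<lambda>y. f (Complex x y)) \<in> borel_measurable ?M" if "x \<noteq> 0" for x
    by (rule continuous_imp_measurable_on_sets_lebesgue[OF cf[OF that]]) simp
  let ?P = "\<lambda>e. \<integral>\<^sup>+y. ennreal (norm (f (Complex e y) - g y)) \<partial>?M"
  let ?N = "\<lambda>e. \<integral>\<^sup>+y. ennreal (norm (f (Complex (- e) y) - g y)) \<partial>?M"
  let ?g = "\<integral>\<^sup>+y. ennreal (norm (g y)) \<partial>?M"
  have lim: "(?P \<longlongrightarrow> 0) (at_right 0)" "(?N \<longlongrightarrow> 0) (at_right 0)" and fin: "?g < \<infinity>"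
    using p m by (auto simp: Lp_lim_def)
  have pos: "\<forall>\<^sub>F e in at_right (0::real). 0 < e" by (simp add: eventually_at_right_less)
  have "((\<lambda>e. ?P e + ?N e) \<longlongrightarrow> 0 + 0) (at_right 0)" by (intro tendsto_add lim)
  then have sum: "((\<lambda>e. ?P e + ?N e) \<longlongrightarrow> 0) (at_right 0)" by simp
  have "((\<lambda>e. ennreal (integral {-R..R} (\<lambda>y. norm (f (Complex e y) - f (Complex (-e) y))))) \<longlongrightarrow> 0) (at_right 0)"
  proof (rule tendsto_sandwich[OF _ _ tendsto_const sum])
    show "\<forall>\<^sub>F e in at_right 0. ennreal (integral {-R..R} (\<lambda>y. norm (f (Complex e y) - f (Complex (-e) y)))) \<le> ?P e + ?N e"
      using pos
    proof eventually_elim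
      case (elim e)
      note [measurable] = meas[of e] meas[of "- e"]
      have "ennreal (integral {-R..R} (\<lambda>y. norm (f (Complex e y) - f (Complex (-e) y))))
          = (\<integral>\<^sup>+y. ennreal (norm (f (Complex e y) - f (Complex (-e) y))) \<partial>?M)"
        using elim by (intro nn_integral_lebesgue_on_continuous[symmetric] continuous_intros cf) auto
      also have "\<dots> \<le> (\<integral>\<^sup>+y. ennreal (norm (f (Complex e y) - g y)) + ennreal (norm (f (Complex (-e) y) - g y)) \<partial>?M)"
      proof (intro nn_integral_mono)
        fix y
        have "norm (f (Complex e y) - f (Complex (-e) y)) \<le> norm (f (Complex e y) - g y) + norm (f (Complex (-e) y) - g y)"
          using dist_triangle3[of "f (Complex e y)" "f (Complex (-e) y)" "g y"] by (simp add: dist_norm norm_minus_commute)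
        then show "ennreal (norm (f (Complex e y) - f (Complex (-e) y)))
            \<le> ennreal (norm (f (Complex e y) - g y)) + ennreal (norm (f (Complex (-e) y) - g y))"
          by (simp add: ennreal_leI flip: ennreal_plus)
      qed
      also have "\<dots> = ?P e + ?N e" using elim by (intro nn_integral_add) auto
      finally show ?case .
    qed
  qed simp
  then have "((\<lambda>e. ennreal (integral {-R..R} (\<lambda>y. norm (f (Complex e y) - f (Complex (-e) y))))) \<longlongrightarrow> ennreal 0) (at_right 0)"
    by simp
  then have jump: "((\<lambda>e. integral {-R..R} (\<lambda>y. norm (f (Complex e y) - f (Complex (-e) y)))) \<longlongrightarrow> 0) (at_right 0)"
    by (rule tendsto_ennrealD) (use pos in \<open>eventually_elim, auto intro!: integral_nonneg integrable_continuous_interval continuous_intros cf\<close>)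
  obtain q where q: "0 \<le> q" "?g = ennreal q" using fin by (cases ?g) auto
  have "\<forall>\<^sub>F e in at_right 0. ?N e < 1" using lim(2) by (rule order_tendstoD) simp
  then have "\<forall>\<^sub>F e in at_right 0. integral {-R..R} (\<lambda>y. norm (f (Complex (-e) y))) \<le> 1 + q"
    using pos
  proof eventually_elim
    case (elim e)
    note [measurable] = meas[of "- e"]
    have "ennreal (integral {-R..R} (\<lambda>y. norm (f (Complex (-e) y)))) = (\<integral>\<^sup>+y. ennreal (norm (f (Complex (-e) y))) \<partial>?M)"
      using elim by (intro nn_integral_lebesgue_on_continuous[symmetric] continuous_intros cf) auto
    also have "\<dots> \<le> (\<integral>\<^sup>+y. ennreal (norm (f (Complex (-e) y) - g y)) + ennreal (norm (g y)) \<partial>?M)"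
    proof (intro nn_integral_mono)
      fix y
      have "norm (f (Complex (-e) y)) \<le> norm (f (Complex (-e) y) - g y) + norm (g y)"
        using norm_triangle_ineq[of "f (Complex (-e) y) - g y" "g y"] by simp
      then show "ennreal (norm (f (Complex (-e) y))) \<le> ennreal (norm (f (Complex (-e) y) - g y)) + ennreal (norm (g y))"
        by (simp add: ennreal_leI flip: ennreal_plus)
    qed
    also have "\<dots> = ?N e + ?g" using elim by (intro nn_integral_add) auto
    also have "\<dots> \<le> 1 + ennreal q" using elim(1) q by (intro add_mono) auto
    also have "\<dots> = ennreal (1 + q)" using q by (simp add: ennreal_plus)
    finally show ?case using q by (subst (asm) ennreal_le_iff) auto
  qed
  then show ?thesis using no_jump_vanishes[OF hol inf R jump _ k] by blast
qed

end

section \<open>Uniqueness\<close>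

lemma trivial_limit_side:
  assumes "s = 1 \<or> s = - 1" "Re p = 0"
  shows "at p within side s \<noteq> bot"
proof -
  have "p islimpt side s"
  proof (rule islimptI)
    fix T assume "p \<in> T" "open T"
    then obtain e where e: "e > 0" "ball p e \<subseteq> T"
      using open_contains_ball by blast
    then have "p + of_real (s * e/2) \<in> ball p e" using assms by (auto simp: dist_norm)
    then show "\<exists>y\<in>side s. y \<in> T \<and> y \<noteq> p"
      using e assms by (intro bexI[of _ "p + of_real (s * e/2)"]) (auto simp: side_def)
  qed
  then show ?thesis by (simp add: trivial_limit_within)
qed

lemma boundary_value_eqI:
  assumes "s = 1 \<or> s = - 1" "Re p = 0" "(m \<longlongrightarrow> l) (at p within side s)"
  shows "boundary_value s m p = l"
  unfolding boundary_value_def using trivial_limit_side[OF assms(1,2)] assms(3) by (rule tendsto_Lim)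

context branch_points
begin

text \<open>
  The boundary values are measurable because they are almost everywhere limits of the continuous
  functions \<open>\<lambda>y. m (Complex (s / n) y)\<close>.
\<close>

lemma L2_boundary_values_imp_Lp_lim:
  fixes m :: "complex \<Rightarrow> complex ^ 2"
  assumes L2: "L2_boundary_values R s m" and s: "s = 1 \<or> s = - 1" and R': "R' \<le> R"
    and hol: "(\<lambda>k. m k $ j) holomorphic_on - contour c"
  shows "Lp_lim 2 (lebesgue_on {-R'..R'}) (at_right 0) (\<lambda>e y. m (Complex (s * e) y) $ j)
    (\<lambda>y. boundary_value s m (Complex 0 y) $ j)"
proof -
  let ?M = "lebesgue_on {-R'..R'}"
  define b where "b y = boundary_value s m (Complex 0 y) $ j" for y
  have restrict_le: "(\<integral>\<^sup>+y. ennreal (norm (F y $ j) ^ 2) \<partial>?M) \<le> (\<integral>\<^sup>+y\<in>{-R..R}. ennreal ((norm (F y))\<^sup>2) \<partial>lebesgue)"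
    for F :: "real \<Rightarrow> complex ^ 2"
  proof -
    have "(\<integral>\<^sup>+y. ennreal (norm (F y $ j) ^ 2) \<partial>?M) = (\<integral>\<^sup>+y. ennreal (norm (F y $ j) ^ 2) * indicator {-R'..R'} y \<partial>lebesgue)"
      by (rule nn_integral_restrict_space) simp
    also have "\<dots> \<le> (\<integral>\<^sup>+y\<in>{-R..R}. ennreal ((norm (F y))\<^sup>2) \<partial>lebesgue)"
    proof (rule nn_integral_mono)
      fix y
      have "norm (F y $ j) ^ 2 \<le> norm (F y) ^ 2"
        by (intro power_mono Finite_Cartesian_Product.norm_nth_le) auto
      then show "ennreal (norm (F y $ j) ^ 2) * indicator {-R'..R'} y \<le> ennreal ((norm (F y))\<^sup>2) * indicator {-R..R} y"
        using R' by (auto simp: indicator_def ennreal_leI)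
    qed
    finally show ?thesis .
  qed
  have cont: "continuous_on A (\<lambda>y. m (Complex x y) $ j)" if "x \<noteq> 0" for A x
    by (rule vertical_line_continuous[OF hol that])
  have meas: "b \<in> borel_measurable ?M"
  proof -
    define f where "f n y = m (Complex (s * (1 / real (Suc n))) y) $ j" for n y
    have f: "f n \<in> borel_measurable lebesgue" for n
    proof -
      have "continuous_on UNIV (f n)" unfolding f_def using s by (intro cont) auto
      then have "f n \<in> borel_measurable borel" by (rule borel_measurable_continuous_onI)
      then show ?thesis by (simp add: measurable_completion)
    qed
    have lim: "AE y in lebesgue. \<bar>y\<bar> \<le> R \<longrightarrow> lim (\<lambda>n. f n y) = b y"
      using L2[unfolded L2_boundary_values_def, THEN conjunct1]
    proof (rule eventually_mono)
      fix y assume y: "\<bar>y\<bar> \<le> R \<longrightarrow> (m \<longlongrightarrow> boundary_value s m (Complex 0 y)) (at (Complex 0 y) within side s)"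
      show "\<bar>y\<bar> \<le> R \<longrightarrow> lim (\<lambda>n. f n y) = b y"
      proof
        assume "\<bar>y\<bar> \<le> R"
        with y have "((\<lambda>k. m k $ j) \<longlongrightarrow> b y) (at (Complex 0 y) within side s)"
          unfolding b_def by (intro tendsto_vec_nth) blast
        moreover have "LIM n sequentially. Complex (s * (1 / real (Suc n))) y :> at (Complex 0 y) within side s"
          unfolding filterlim_at
        proof
          show "\<forall>\<^sub>F n in sequentially. Complex (s * (1 / real (Suc n))) y \<in> side s \<and> Complex (s * (1 / real (Suc n))) y \<noteq> Complex 0 y"
            using s by (intro always_eventually) (auto simp: side_def)
          have "(\<lambda>n. s * (1 / real (Suc n))) \<longlonglongrightarrow> s * 0"
            by (intro tendsto_intros LIMSEQ_Suc lim_1_over_n)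
          then show "(\<lambda>n. Complex (s * (1 / real (Suc n))) y) \<longlonglongrightarrow> Complex 0 y"
            by (intro tendsto_Complex) auto
        qed
        ultimately have "(\<lambda>n. f n y) \<longlonglongrightarrow> b y"
          unfolding f_def by (rule filterlim_compose)
        then show "lim (\<lambda>n. f n y) = b y" by (rule limI)
      qed
    qed
    have "(\<lambda>y. indicator {-R'..R'} y *\<^sub>R lim (\<lambda>n. f n y)) \<in> borel_measurable lebesgue"
      using f by (intro borel_measurable_scaleR borel_measurable_indicator borel_measurable_lim_metric) auto
    moreover have "AE y in lebesgue. indicator {-R'..R'} y *\<^sub>R lim (\<lambda>n. f n y) = indicator {-R'..R'} y *\<^sub>R b y"
      using lim by (rule eventually_mono) (use R' in \<open>auto simp: indicator_def\<close>)
    ultimately have "(\<lambda>y. indicator {-R'..R'} y *\<^sub>R b y) \<in> borel_measurable lebesgue"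
      by (rule borel_measurable_AE)
    then show ?thesis
      by (simp add: borel_measurable_restrict_space_iff)
  qed
  have fin: "(\<integral>\<^sup>+y. ennreal (norm (b y) ^ 2) \<partial>?M) < \<infinity>"
    unfolding b_def by (rule le_less_trans[OF restrict_le]) (use L2 in \<open>simp add: L2_boundary_values_def\<close>)
  have lim: "((\<lambda>e. \<integral>\<^sup>+y. ennreal (norm (m (Complex (s * e) y) $ j - b y) ^ 2) \<partial>?M) \<longlongrightarrow> 0) (at_right 0)"
  proof (rule tendsto_sandwich[OF _ _ tendsto_const L2[unfolded L2_boundary_values_def, THEN conjunct2, THEN conjunct2]])
    show "\<forall>\<^sub>F e in at_right 0. (\<integral>\<^sup>+y. ennreal (norm (m (Complex (s * e) y) $ j - b y) ^ 2) \<partial>?M)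
        \<le> (\<integral>\<^sup>+y\<in>{-R..R}. ennreal ((norm (m (Complex (s * e) y) - boundary_value s m (Complex 0 y)))\<^sup>2) \<partial>lebesgue)"
      unfolding b_def vector_minus_component[symmetric] by (intro always_eventually allI restrict_le)
  qed simp
  have "\<forall>\<^sub>F e in at_right (0::real). 0 < e" by (simp add: eventually_at_right_less)
  then have "\<forall>\<^sub>F e in at_right 0. (\<lambda>y. m (Complex (s * e) y) $ j) \<in> borel_measurable ?M"
    by eventually_elim (use s in \<open>auto intro!: continuous_imp_measurable_on_sets_lebesgue cont\<close>)
  with meas fin lim show ?thesis unfolding Lp_lim_def b_def by blast
qed

lemma v_mod_upper:
  fixes x :: "complex ^ 2"
  assumes "a \<le> y" "y \<le> c"
  shows "(x v* v_mod a c \<Lambda> (Complex 0 y)) $ 1 = \<i> * x $ 2" "(x v* v_mod a c \<Lambda> (Complex 0 y)) $ 2 = \<i> * x $ 1"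
proof -
  have "Complex 0 y \<in> closed_segment (\<i> * c) (\<i> * a)"
    using assms ac by (subst closed_segment_same_Re) (auto simp: closed_segment_eq_real_ivl)
  then show "(x v* v_mod a c \<Lambda> (Complex 0 y)) $ 1 = \<i> * x $ 2" "(x v* v_mod a c \<Lambda> (Complex 0 y)) $ 2 = \<i> * x $ 1"
    by (simp_all add: v_mod_def vector_matrix_mult_def sum_2)
qed

lemma v_mod_lower:
  fixes x :: "complex ^ 2"
  assumes "- c \<le> y" "y \<le> - a"
  shows "(x v* v_mod a c \<Lambda> (Complex 0 y)) $ 1 = - \<i> * x $ 2" "(x v* v_mod a c \<Lambda> (Complex 0 y)) $ 2 = - \<i> * x $ 1"
proof -
  have "Complex 0 y \<notin> closed_segment (\<i> * c) (\<i> * a)"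
    using assms ac by (subst closed_segment_same_Re) (auto simp: closed_segment_eq_real_ivl)
  moreover have "Complex 0 y \<in> closed_segment (- \<i> * a) (- \<i> * c)"
    using assms ac by (subst closed_segment_same_Re) (auto simp: closed_segment_eq_real_ivl)
  ultimately show "(x v* v_mod a c \<Lambda> (Complex 0 y)) $ 1 = - \<i> * x $ 2" "(x v* v_mod a c \<Lambda> (Complex 0 y)) $ 2 = - \<i> * x $ 1"
    by (simp_all add: v_mod_def vector_matrix_mult_def sum_2)
qed

lemma v_mod_middle:
  fixes x :: "complex ^ 2"
  assumes "\<bar>y\<bar> < a"
  shows "(x v* v_mod a c \<Lambda> (Complex 0 y)) $ 1 = exp (- 2 * pi * \<i> * \<Lambda>) * x $ 1"
    "(x v* v_mod a c \<Lambda> (Complex 0 y)) $ 2 = exp (2 * pi * \<i> * \<Lambda>) * x $ 2"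
proof -
  have "Complex 0 y \<notin> closed_segment (\<i> * c) (\<i> * a)" "Complex 0 y \<notin> closed_segment (- \<i> * a) (- \<i> * c)"
    using assms ac by ((subst closed_segment_same_Re; auto simp: closed_segment_eq_real_ivl)+)
  then show "(x v* v_mod a c \<Lambda> (Complex 0 y)) $ 1 = exp (- 2 * pi * \<i> * \<Lambda>) * x $ 1"
    "(x v* v_mod a c \<Lambda> (Complex 0 y)) $ 2 = exp (2 * pi * \<i> * \<Lambda>) * x $ 2"
    by (simp_all add: v_mod_def vector_matrix_mult_def sum_2)
qed

lemma wR_cnj:
  assumes "0 \<le> Re k"
  shows "wR (cnj k) = cnj (wR k)"
proof -
  have "csqrt (cnj k - cnj \<kappa>) = cnj (csqrt (k - \<kappa>))" if "\<kappa> \<in> G" for \<kappa>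
  proof (cases "k = \<kappa>")
    case False
    then show ?thesis
      using cnj_csqrt[OF minus_G_notin_nonpos[OF that assms]] by simp
  qed simp
  from this[OF G_members(1)] this[OF G_members(2)] this[OF G_members(3)] this[OF G_members(4)]
  show ?thesis by (simp add: wR_def prod_G)
qed

lemma wR_zero: "\<kappa> \<in> G \<Longrightarrow> wR \<kappa> = 0"
  using finite_G by (auto simp: wR_def)

text \<open>
  The values of \<open>wR\<close> at \<open>- \<i>y\<close> enter because they are the boundary values of the even function \<open>w\<close> from
  the left at \<open>\<i>y\<close>.
\<close>

lemma wR_cut:
  assumes "a \<le> \<bar>y\<bar>" "\<bar>y\<bar> \<le> c"
  shows "wR (Complex 0 (- y)) = - wR (Complex 0 y)"
proof (cases "\<bar>y\<bar> = a \<or> \<bar>y\<bar> = c")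
  case True
  then show ?thesis by (subst (1 2) wR_zero) (auto simp: G_iff)
next
  case False
  have up: "wR (Complex 0 (- t)) = - wR (Complex 0 t)" if "a < t" "t < c" for t
    using wR_cnj[of "Complex 0 t"] wR_upper_cut[OF that] by (simp add: complex_cnj Complex_eq)
  show ?thesis
  proof (cases "0 \<le> y")
    case True
    then show ?thesis using up[of y] assms False by simp
  next
    case neg: False
    then show ?thesis using up[of "- y"] assms False by simp
  qed
qed

lemma wR_no_jump:
  assumes "\<bar>y\<bar> < a \<or> c < \<bar>y\<bar>"
  shows "wR (Complex 0 (- y)) = wR (Complex 0 y)"
proof (cases "\<bar>y\<bar> < a")
  case True
  then show ?thesis using wR_middle[of y] wR_middle[of "- y"] by (simp add: Complex_eq w_modulus_def abs_minus_commute mult_ac add.commute)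
next
  case False
  then have y: "c < \<bar>y\<bar>" using assms by blast
  have "w a c (Complex 0 y) = wR (Complex 0 y)" if "c < \<bar>y\<bar>" for y
  proof (rule crhp_eqI[of "- contour c" "w a c" wR])
    show "continuous_on (- contour c \<inter> crhp) (w a c)"
      by (rule holomorphic_on_imp_continuous_on, rule holomorphic_on_subset[OF w_branch(1)[OF a_pos a_less_c]])
        (use not_cuts_if in auto)
    show "continuous_on (- contour c \<inter> crhp) wR"
      by (rule continuous_on_subset[OF wR_continuous]) auto
  qed (use that open_minus_contour w_eq_wR in \<open>auto simp: not_contour_iff\<close>)
  from this[of y] this[of "- y"] y show ?thesis
    by (simp add: w_def cut_ratio_def Complex_eq power2_eq_square)
qed

lemma w_nonzero: "k \<notin> contour c \<Longrightarrow> w a c k \<noteq> 0"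
  using off_cuts[OF a_pos a_less_c not_cuts_if, of k] by (auto simp: w_def)

lemma w_holomorphic: "w a c holomorphic_on - contour c"
  using not_cuts_if by (intro holomorphic_on_subset[OF w_branch(1)[OF a_pos a_less_c]]) auto

lemma w_right_limit:
  "\<delta> > 0 \<Longrightarrow> \<forall>\<^sub>F e in at_right 0. \<forall>y\<in>{-R..R}. norm (w a c (Complex e y) - wR (Complex 0 y)) \<le> \<delta>"
  "\<exists>B. (\<forall>\<^sub>F e in at_right 0. \<forall>y\<in>{-R..R}. norm (w a c (Complex e y)) \<le> B) \<and>
       (\<forall>y\<in>{-R..R}. norm (wR (Complex 0 y)) \<le> B)"
proof -
  define K where "K = cbox (Complex 0 (- R)) (Complex 1 R)"
  have K: "K \<subseteq> crhp" by (auto simp: K_def in_cbox_complex_iff)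
  have cK: "compact K" "continuous_on K wR"
    using continuous_on_subset[OF wR_continuous K] by (auto simp: K_def)
  have mem: "Complex x y \<in> K" if "0 \<le> x" "x \<le> 1" "y \<in> {-R..R}" for x y
    using that by (auto simp: K_def in_cbox_complex_iff)
  have ev: "\<forall>\<^sub>F e in at_right (0::real). 0 < e \<and> e < \<eta>" if "\<eta> > 0" for \<eta>
    using that by (auto simp: eventually_at_right_field)
  obtain B where B: "\<And>z. z \<in> K \<Longrightarrow> norm (wR z) \<le> B"
    using compact_imp_bounded[OF compact_continuous_image[OF cK(2,1)]] by (auto simp: bounded_iff)
  show "\<exists>B. (\<forall>\<^sub>F e in at_right 0. \<forall>y\<in>{-R..R}. norm (w a c (Complex e y)) \<le> B) \<and>
       (\<forall>y\<in>{-R..R}. norm (wR (Complex 0 y)) \<le> B)"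
  proof (intro exI conjI ballI)
    show "\<forall>\<^sub>F e in at_right 0. \<forall>y\<in>{-R..R}. norm (w a c (Complex e y)) \<le> B"
      using ev[OF zero_less_one] by eventually_elim (auto simp: w_eq_wR intro!: B mem)
    show "norm (wR (Complex 0 y)) \<le> B" if "y \<in> {-R..R}" for y
      using that by (intro B mem) auto
  qed
  assume "\<delta> > 0"
  then obtain d where d: "d > 0" "\<And>z z'. z \<in> K \<Longrightarrow> z' \<in> K \<Longrightarrow> dist z' z < d \<Longrightarrow> dist (wR z') (wR z) < \<delta>"
    using compact_uniformly_continuous[OF cK(2,1)] unfolding uniformly_continuous_on_def by metis
  have "\<forall>\<^sub>F e in at_right (0::real). 0 < e \<and> e < min 1 d" using d(1) by (intro ev) auto
  then show "\<forall>\<^sub>F e in at_right 0. \<forall>y\<in>{-R..R}. norm (w a c (Complex e y) - wR (Complex 0 y)) \<le> \<delta>"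
  proof eventually_elim
    case (elim e)
    show ?case
    proof
      fix y assume y: "y \<in> {-R..R}"
      have "Complex e y - Complex 0 y = of_real e" by (simp add: complex_eq_iff)
      then have "dist (Complex e y) (Complex 0 y) < d"
        using elim by (simp only: dist_norm norm_of_real) simp
      then have "dist (wR (Complex e y)) (wR (Complex 0 y)) < \<delta>"
        using y elim by (intro d(2) mem) auto
      then show "norm (w a c (Complex e y) - wR (Complex 0 y)) \<le> \<delta>"
        using elim by (simp add: w_eq_wR dist_norm)
    qed
  qed
qed

lemma L1_lim_mult_w:
  assumes Y: "Lp_lim 1 (lebesgue_on {-R..R}) (at_right 0) Y x" and s: "s = 1 \<or> s = - 1"
  shows "Lp_lim 1 (lebesgue_on {-R..R}) (at_right 0)
    (\<lambda>e y. Y e y * w a c (Complex (s * e) y)) (\<lambda>y. x y * wR (Complex 0 (s * y)))"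
proof -
  have w_eq: "w a c (Complex (s * e) y) = w a c (Complex e (s * y))" for e y
  proof (cases "s = 1")
    case False
    then have "Complex (s * e) y = - Complex e (s * y)" using s by (simp add: complex_eq_iff)
    then show ?thesis by (simp add: w_def cut_ratio_def)
  qed simp
  have sy: "s * y \<in> {-R..R}" if "y \<in> {-R..R}" for y using s that by auto
  obtain B where B: "\<forall>\<^sub>F e in at_right 0. \<forall>y\<in>{-R..R}. norm (w a c (Complex e y)) \<le> B"
    "\<forall>y\<in>{-R..R}. norm (wR (Complex 0 y)) \<le> B"
    using w_right_limit(2) by blast
  have cl: "continuous_on A (\<lambda>y. Complex x (s * y))" for A x
    by (auto simp: Complex_eq intro!: continuous_intros)
  show ?thesis
    unfolding w_eq
  proof (rule L1_lim_mult_uniform[OF Y])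
    have "\<forall>\<^sub>F e in at_right (0::real). 0 < e" by (simp add: eventually_at_right_less)
    then show "\<forall>\<^sub>F e in at_right 0. (\<lambda>y. w a c (Complex e (s * y))) \<in> borel_measurable (lebesgue_on {-R..R})"
    proof eventually_elim
      case (elim e)
      then show ?case
        by (intro continuous_imp_measurable_on_sets_lebesgue
            continuous_on_compose2[OF holomorphic_on_imp_continuous_on[OF w_holomorphic] cl])
          (auto simp: contour_iff[OF c_pos])
    qed
    show "(\<lambda>y. wR (Complex 0 (s * y))) \<in> borel_measurable (lebesgue_on {-R..R})"
      by (intro continuous_imp_measurable_on_sets_lebesgue continuous_on_compose2[OF wR_continuous cl]) auto
    show "\<forall>\<^sub>F e in at_right 0. \<forall>y\<in>space (lebesgue_on {-R..R}). norm (w a c (Complex e (s * y))) \<le> B"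
      using B(1) by eventually_elim (use sy in auto)
    show "norm (wR (Complex 0 (s * y))) \<le> B" if "y \<in> space (lebesgue_on {-R..R})" for y
      using B(2) sy that by auto
    show "\<forall>\<^sub>F e in at_right 0. \<forall>y\<in>space (lebesgue_on {-R..R}). norm (w a c (Complex e (s * y)) - wR (Complex 0 (s * y))) \<le> \<delta>"
      if "\<delta> > 0" for \<delta>
      using w_right_limit(1)[OF that, of R] by eventually_elim (use sy in auto)
  qed
qed

lemma boundary_value_off_contour:
  fixes m :: "complex \<Rightarrow> complex ^ 2"
  assumes hol: "\<And>j. (\<lambda>k. m k $ j) holomorphic_on - contour c" and y: "c < \<bar>y\<bar>" and s: "s = 1 \<or> s = - 1"
  shows "boundary_value s m (Complex 0 y) = m (Complex 0 y)"
proof (rule boundary_value_eqI[OF s])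
  have "Complex 0 y \<in> - contour c" using y by (simp add: not_contour_iff)
  then have "((\<lambda>k. m k $ j) \<longlongrightarrow> m (Complex 0 y) $ j) (at (Complex 0 y))" for j
    using holomorphic_on_imp_continuous_on[OF hol] open_minus_contour
    by (simp add: continuous_on_eq_continuous_at isCont_def)
  then have "(m \<longlongrightarrow> m (Complex 0 y)) (at (Complex 0 y))" by (rule vec_tendstoI)
  then show "(m \<longlongrightarrow> m (Complex 0 y)) (at (Complex 0 y) within side s)"
    by (rule tendsto_within_subset) auto
qed simp

text \<open>
  The determinant of two solutions and, for their difference, the product of the components times \<open>w\<close> are
  functions without a jump. The jump matrices act on the product of the
  components by the factor \<open>-1\<close> on the cuts, which the sign change of \<open>w\<close> compensates.
\<close>

theorem model_RHP_solution_unique: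
  fixes m m' :: "complex \<Rightarrow> complex ^ 2"
  assumes m: "model_RHP_solution a c \<Lambda> m" and m': "model_RHP_solution a c \<Lambda> m'"
    and "k \<notin> contour c"
  shows "m k = m' k"
proof -
  let ?c = "- contour c"
  have hol: "(\<lambda>k. m k $ j) holomorphic_on ?c" "(\<lambda>k. m' k $ j) holomorphic_on ?c" for j
    using m m' by (auto simp: model_RHP_solution_def)
  have lim: "((\<lambda>k. m k $ j) \<longlongrightarrow> 1) at_infinity" "((\<lambda>k. m' k $ j) \<longlongrightarrow> 1) at_infinity" for j
  proof -
    have "(m \<longlongrightarrow> vector [1, 1]) at_infinity" "(m' \<longlongrightarrow> vector [1, 1]) at_infinity"
      using m m' by (auto simp: model_RHP_solution_def)
    from tendsto_vec_nth[OF this(1), of j] tendsto_vec_nth[OF this(2), of j]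
    show "((\<lambda>k. m k $ j) \<longlongrightarrow> 1) at_infinity" "((\<lambda>k. m' k $ j) \<longlongrightarrow> 1) at_infinity"
      using exhaust_2[of j] by auto
  qed
  have sym: "m (- k) $ 1 = m k $ 2" "m (- k) $ 2 = m k $ 1" "m' (- k) $ 1 = m' k $ 2" "m' (- k) $ 2 = m' k $ 1"
    if "k \<in> ?c" for k
    using m m' that by (simp_all add: model_RHP_solution_def vector_matrix_mult_def sum_2)
  obtain R1 R2 where R12: "R1 > c" "R2 > c" "L2_boundary_values R1 1 m" "L2_boundary_values R1 (- 1) m"
    "L2_boundary_values R2 1 m'" "L2_boundary_values R2 (- 1) m'"
    using m m' by (auto simp: model_RHP_solution_def square_integrable_boundary_values_def)
  define R where "R = min R1 R2"
  have R: "R > c" using R12 by (simp add: R_def)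
  define M where "M = lebesgue_on {-R..R}"
  define b where "b s y = boundary_value s m (Complex 0 y)" for s y
  define b' where "b' s y = boundary_value s m' (Complex 0 y)" for s y
  have L: "Lp_lim 2 M (at_right 0) (\<lambda>e y. m (Complex (s * e) y) $ j) (\<lambda>y. b s y $ j)"
    "Lp_lim 2 M (at_right 0) (\<lambda>e y. m' (Complex (s * e) y) $ j) (\<lambda>y. b' s y $ j)"
    if "s = 1 \<or> s = - 1" for s j
    unfolding M_def b_def b'_def
    by (rule L2_boundary_values_imp_Lp_lim[of R1]; use that R12 hol in \<open>force simp: R_def\<close>)
      (rule L2_boundary_values_imp_Lp_lim[of R2]; use that R12 hol in \<open>force simp: R_def\<close>)
  have jump: "AE y in M. (\<bar>y\<bar> \<le> c \<longrightarrow> b 1 y = b (- 1) y v* v_mod a c \<Lambda> (Complex 0 y) \<and>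
      b' 1 y = b' (- 1) y v* v_mod a c \<Lambda> (Complex 0 y)) \<and>
      (c < \<bar>y\<bar> \<longrightarrow> b 1 y = b (- 1) y \<and> b' 1 y = b' (- 1) y)"
  proof -
    have "AE y in lebesgue. (\<bar>y\<bar> \<le> c \<longrightarrow> b 1 y = b (- 1) y v* v_mod a c \<Lambda> (Complex 0 y)) \<and>
      (\<bar>y\<bar> \<le> c \<longrightarrow> b' 1 y = b' (- 1) y v* v_mod a c \<Lambda> (Complex 0 y))"
      using m m' unfolding b_def b'_def model_RHP_solution_def by (intro AE_conjI) auto
    moreover have off: "b 1 y = b (- 1) y \<and> b' 1 y = b' (- 1) y" if "c < \<bar>y\<bar>" for y
      unfolding b_def b'_def using that by (simp add: boundary_value_off_contour hol)
    ultimately have "AE y in lebesgue. (\<bar>y\<bar> \<le> c \<longrightarrow> b 1 y = b (- 1) y v* v_mod a c \<Lambda> (Complex 0 y) \<and>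
      b' 1 y = b' (- 1) y v* v_mod a c \<Lambda> (Complex 0 y)) \<and>
      (c < \<bar>y\<bar> \<longrightarrow> b 1 y = b (- 1) y \<and> b' 1 y = b' (- 1) y)"
      by (elim eventually_mono) (use off in blast)
    then have "AE y in lebesgue. y \<in> {-R..R} \<longrightarrow> (\<bar>y\<bar> \<le> c \<longrightarrow> b 1 y = b (- 1) y v* v_mod a c \<Lambda> (Complex 0 y) \<and>
      b' 1 y = b' (- 1) y v* v_mod a c \<Lambda> (Complex 0 y)) \<and>
      (c < \<bar>y\<bar> \<longrightarrow> b 1 y = b (- 1) y \<and> b' 1 y = b' (- 1) y)"
      by (rule eventually_mono) blast
    then show ?thesis
      unfolding M_def by (subst AE_restrict_space_iff) simp_all
  qed
  have vcases: "(\<bar>y\<bar> < a \<longrightarrow> (x v* v_mod a c \<Lambda> (Complex 0 y)) $ 1 = exp (- 2 * pi * \<i> * \<Lambda>) * x $ 1 \<and>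
        (x v* v_mod a c \<Lambda> (Complex 0 y)) $ 2 = exp (2 * pi * \<i> * \<Lambda>) * x $ 2) \<and>
      (a \<le> \<bar>y\<bar> \<longrightarrow> (\<exists>\<eta>. \<eta>\<^sup>2 = - 1 \<and> (\<forall>x :: complex ^ 2. (x v* v_mod a c \<Lambda> (Complex 0 y)) $ 1 = \<eta> * x $ 2 \<and>
        (x v* v_mod a c \<Lambda> (Complex 0 y)) $ 2 = \<eta> * x $ 1)))" if "\<bar>y\<bar> \<le> c" for x :: "complex ^ 2" and y
  proof (intro conjI impI)
    assume "a \<le> \<bar>y\<bar>"
    then consider "a \<le> y" | "y \<le> - a" by linarith
    then show "\<exists>\<eta>. \<eta>\<^sup>2 = - 1 \<and> (\<forall>x :: complex ^ 2. (x v* v_mod a c \<Lambda> (Complex 0 y)) $ 1 = \<eta> * x $ 2 \<and>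
        (x v* v_mod a c \<Lambda> (Complex 0 y)) $ 2 = \<eta> * x $ 1)"
    proof cases
      case 1
      then show ?thesis using v_mod_upper[of y] that by (intro exI[of _ \<i>]) auto
    next
      case 2
      then show ?thesis using v_mod_lower[of y] that by (intro exI[of _ "- \<i>"]) auto
    qed
  qed (use v_mod_middle in auto)
  have exp1: "exp (- 2 * pi * \<i> * \<Lambda>) * exp (2 * pi * \<i> * \<Lambda>) = 1"
    by (simp flip: exp_add)
  have measM: "x \<in> borel_measurable M" if "Lp_lim p M F Y x" for p F Y and x :: "real \<Rightarrow> complex"
    using that by (simp add: Lp_lim_def)
  have s1: "(1::real) = 1 \<or> (1::real) = - 1" "(- 1::real) = 1 \<or> (- 1::real) = - 1" by auto

  \<comment> \<open>Every jump matrix has determinant 1, so the determinant of the two solutions has no jump.\<close>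
  have det0: "m k $ 1 * m' k $ 2 - m k $ 2 * m' k $ 1 = 0" if "k \<in> ?c" for k
  proof (rule L1_no_jump_vanishes[of "\<lambda>k. m k $ 1 * m' k $ 2 - m k $ 2 * m' k $ 1"])
    show "(\<lambda>k. m k $ 1 * m' k $ 2 - m k $ 2 * m' k $ 1) holomorphic_on ?c"
      by (intro holomorphic_intros hol)
    have "((\<lambda>k. m k $ 1 * m' k $ 2 - m k $ 2 * m' k $ 1) \<longlongrightarrow> 1 * 1 - 1 * 1) at_infinity"
      by (intro tendsto_intros lim)
    then show "((\<lambda>k. m k $ 1 * m' k $ 2 - m k $ 2 * m' k $ 1) \<longlongrightarrow> 0) at_infinity" by simp
    let ?g = "\<lambda>s y. b s y $ 1 * b' s y $ 2 - b s y $ 2 * b' s y $ 1"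
    have G: "Lp_lim 1 M (at_right 0) (\<lambda>e y. m (Complex (s * e) y) $ 1 * m' (Complex (s * e) y) $ 2
        - m (Complex (s * e) y) $ 2 * m' (Complex (s * e) y) $ 1) (?g s)" if "s = 1 \<or> s = - 1" for s
      by (intro Lp_lim_diff L2_lim_mult L that) simp
    from G[OF s1(1)] show "Lp_lim 1 (lebesgue_on {-R..R}) (at_right 0) (\<lambda>e y. m (Complex e y) $ 1 * m' (Complex e y) $ 2
        - m (Complex e y) $ 2 * m' (Complex e y) $ 1) (?g 1)" by (simp add: M_def)
    have "AE y in M. ?g (- 1) y = ?g 1 y"
      using jump
    proof (rule eventually_mono)
      fix y assume y: "(\<bar>y\<bar> \<le> c \<longrightarrow> b 1 y = b (- 1) y v* v_mod a c \<Lambda> (Complex 0 y) \<and>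
        b' 1 y = b' (- 1) y v* v_mod a c \<Lambda> (Complex 0 y)) \<and> (c < \<bar>y\<bar> \<longrightarrow> b 1 y = b (- 1) y \<and> b' 1 y = b' (- 1) y)"
      show "?g (- 1) y = ?g 1 y"
      proof (cases "\<bar>y\<bar> \<le> c")
        case True
        show ?thesis
        proof (cases "\<bar>y\<bar> < a")
          case mid: True
          have "?g 1 y = (exp (- 2 * pi * \<i> * \<Lambda>) * exp (2 * pi * \<i> * \<Lambda>)) * ?g (- 1) y"
            using y True vcases[OF True] mid by (simp add: algebra_simps)
          then show ?thesis unfolding exp1 by simp
        next
          case False
          then obtain \<eta> where eta: "\<eta>\<^sup>2 = - 1" "\<And>x :: complex ^ 2. (x v* v_mod a c \<Lambda> (Complex 0 y)) $ 1 = \<eta> * x $ 2"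
            "\<And>x :: complex ^ 2. (x v* v_mod a c \<Lambda> (Complex 0 y)) $ 2 = \<eta> * x $ 1"
            using vcases[OF True] by (metis not_less)
          have "?g 1 y = - \<eta>\<^sup>2 * ?g (- 1) y"
            using y True by (simp add: eta(2,3) power2_eq_square algebra_simps)
          then show ?thesis by (simp add: eta(1))
        qed
      qed (use y in auto)
    qed
    from Lp_lim_cong_AE[OF G[OF s1(2)] measM[OF G[OF s1(1)]] this]
    show "Lp_lim 1 (lebesgue_on {-R..R}) (at_right 0) (\<lambda>e y. m (Complex (- e) y) $ 1 * m' (Complex (- e) y) $ 2
        - m (Complex (- e) y) $ 2 * m' (Complex (- e) y) $ 1) (?g 1)" by (simp add: M_def)
  qed (use R that in auto)

  \<comment> \<open>By the symmetry the components of the difference are asymptotic to \<open>\<alpha> / k\<close> and \<open>- \<alpha> / k\<close>. The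
    vanishing determinant, multiplied by \<open>k\<close>, tends to \<open>2 \<alpha>\<close>; hence \<open>\<alpha> = 0\<close>.\<close>
  define n where "n j k = m k $ j - m' k $ j" for j k
  have hn: "n j holomorphic_on ?c" for j
    unfolding n_def[abs_def] by (intro holomorphic_intros hol)
  have nsym: "n 1 (- k) = n 2 k" "n 2 (- k) = n 1 k" if "k \<in> ?c" for k
    using sym[OF that] by (simp_all add: n_def)
  have inv_c: "inverse u \<in> ?c" if "u \<in> inverse_domain" "u \<noteq> 0" for u
    using inverse_in_inverse_domain_iff[of "inverse u"] that by simp
  have "((\<lambda>k. n 1 k) \<longlongrightarrow> 1 - 1) at_infinity"
    unfolding n_def by (intro tendsto_diff lim)
  then have n0: "((n 1 \<circ> inverse) \<longlongrightarrow> 0) (at 0)" by (simp add: lim_at_infinity_0)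
  have "(n 1 \<circ> inverse) holomorphic_on inverse_domain - {0}"
    by (rule holomorphic_on_compose_gen[OF _ hn]) (use inv_c in \<open>auto intro!: holomorphic_intros\<close>)
  then have "(\<lambda>u. if u = 0 then 0 else (n 1 \<circ> inverse) u) holomorphic_on inverse_domain"
    by (rule removable_singularity) (use open_inverse_domain n0 in auto)
  then obtain \<alpha> where "((\<lambda>u. if u = 0 then 0 else (n 1 \<circ> inverse) u) has_field_derivative \<alpha>) (at 0)"
    using open_inverse_domain zero_in_inverse_domain unfolding holomorphic_on_open[OF open_inverse_domain] by blast
  then have "((\<lambda>u. ((if u = 0 then 0 else (n 1 \<circ> inverse) u) - 0) / (u - 0)) \<longlongrightarrow> \<alpha>) (at 0)"
    by (simp add: has_field_derivative_iff)
  then have n1: "((\<lambda>u. n 1 (inverse u) / u) \<longlongrightarrow> \<alpha>) (at 0)"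
    by (rule Lim_transform_eventually) (auto simp: eventually_at_filter)
  have ev: "\<forall>\<^sub>F u in at 0. u \<in> inverse_domain \<and> u \<noteq> 0"
    using open_inverse_domain zero_in_inverse_domain by (auto simp: eventually_at_topological)
  have "LIM u at 0. - u :> at (0::complex)"
    by (auto simp: filterlim_at eventually_at_filter intro!: tendsto_eq_intros)
  with n1 have "((\<lambda>u. n 1 (inverse (- u)) / - u) \<longlongrightarrow> \<alpha>) (at 0)"
    by (rule filterlim_compose)
  then have "((\<lambda>u. - (n 1 (inverse (- u)) / - u)) \<longlongrightarrow> - \<alpha>) (at 0)"
    by (rule tendsto_minus)
  then have n2: "((\<lambda>u. n 2 (inverse u) / u) \<longlongrightarrow> - \<alpha>) (at 0)"
    by (rule Lim_transform_eventually) (use ev in \<open>eventually_elim, use nsym(1) inv_c in simp\<close>)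
  have lim0: "((\<lambda>u. m' (inverse u) $ j) \<longlongrightarrow> 1) (at 0)" for j
    using lim(2)[of j] by (simp add: lim_at_infinity_0 o_def)
  have "((\<lambda>u. (n 1 (inverse u) / u) * m' (inverse u) $ 2 - (n 2 (inverse u) / u) * m' (inverse u) $ 1)
      \<longlongrightarrow> \<alpha> * 1 - (- \<alpha>) * 1) (at 0)"
    by (intro tendsto_intros n1 n2 lim0)
  moreover have "\<forall>\<^sub>F u in at 0. (n 1 (inverse u) / u) * m' (inverse u) $ 2 - (n 2 (inverse u) / u) * m' (inverse u) $ 1 = 0"
    using ev
  proof eventually_elim
    case (elim u)
    then have "n 1 (inverse u) * m' (inverse u) $ 2 - n 2 (inverse u) * m' (inverse u) $ 1 = 0"
      using det0[OF inv_c[of u]] by (simp add: n_def algebra_simps)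
    then show ?case by (simp add: field_simps)
  qed
  ultimately have "((\<lambda>u. 0 :: complex) \<longlongrightarrow> \<alpha> * 1 - (- \<alpha>) * 1) (at (0::complex))"
    by (rule Lim_transform_eventually)
  then have "\<alpha> = 0"
    using tendsto_unique[OF trivial_limit_at tendsto_const[of 0]] by fastforce

  \<comment> \<open>The factor \<open>w\<close> grows like \<open>k\<^sup>2\<close>, so decay of the product at infinity needs \<open>\<alpha> = 0\<close>.\<close>
  have prod0: "n 1 k * n 2 k * w a c k = 0" if "k \<in> ?c" for k
  proof (rule L1_no_jump_vanishes[of "\<lambda>k. n 1 k * n 2 k * w a c k"])
    show "(\<lambda>k. n 1 k * n 2 k * w a c k) holomorphic_on ?c"
      by (intro holomorphic_intros hn w_holomorphic)
    have "isCont inverse_density 0"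
      using holomorphic_on_imp_continuous_on[OF inverse_density_holomorphic] zero_in_inverse_domain
        open_inverse_domain by (simp add: continuous_on_eq_continuous_at)
    then have "(inverse_density \<longlongrightarrow> - 1) (at 0)"
      by (simp add: isCont_def inverse_density_def)
    then have "((\<lambda>u. (n 1 (inverse u) / u) * (n 2 (inverse u) / u) * (- 1 / inverse_density u))
        \<longlongrightarrow> \<alpha> * (- \<alpha>) * (- 1 / - 1)) (at 0)"
      by (intro tendsto_intros n1 n2) auto
    then have "((\<lambda>u. (n 1 (inverse u) / u) * (n 2 (inverse u) / u) * (- 1 / inverse_density u)) \<longlongrightarrow> 0) (at 0)"
      using \<open>\<alpha> = 0\<close> by simp
    then have "((\<lambda>u. n 1 (inverse u) * n 2 (inverse u) * w a c (inverse u)) \<longlongrightarrow> 0) (at 0)"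
    proof (rule Lim_transform_eventually)
      show "\<forall>\<^sub>F u in at 0. (n 1 (inverse u) / u) * (n 2 (inverse u) / u) * (- 1 / inverse_density u)
          = n 1 (inverse u) * n 2 (inverse u) * w a c (inverse u)"
        using ev
      proof eventually_elim
        case (elim u)
        then have "inverse_density u = - 1 / (u\<^sup>2 * w a c (inverse u))" by (intro inverse_density_eq(3)) auto
        moreover have "w a c (inverse u) \<noteq> 0" using w_nonzero inv_c elim by auto
        ultimately show ?case using elim by (simp add: power2_eq_square)
      qed
    qed
    then show "((\<lambda>k. n 1 k * n 2 k * w a c k) \<longlongrightarrow> 0) at_infinity"
      by (simp add: lim_at_infinity_0 o_def)
    define \<nu> where "\<nu> j s y = b s y $ j - b' s y $ j" for j s y
    let ?g = "\<lambda>s y. \<nu> 1 s y * \<nu> 2 s y * wR (Complex 0 (s * y))"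
    have N: "Lp_lim 2 M (at_right 0) (\<lambda>e y. n j (Complex (s * e) y)) (\<nu> j s)" if "s = 1 \<or> s = - 1" for s j
      unfolding n_def \<nu>_def[abs_def] by (intro Lp_lim_diff L that) simp
    have G: "Lp_lim 1 M (at_right 0) (\<lambda>e y. n 1 (Complex (s * e) y) * n 2 (Complex (s * e) y) * w a c (Complex (s * e) y)) (?g s)"
      if "s = 1 \<or> s = - 1" for s
      unfolding M_def by (intro L1_lim_mult_w L2_lim_mult N[unfolded M_def] that)
    from G[OF s1(1)] show "Lp_lim 1 (lebesgue_on {-R..R}) (at_right 0)
        (\<lambda>e y. n 1 (Complex e y) * n 2 (Complex e y) * w a c (Complex e y)) (?g 1)" by (simp add: M_def)
    have "AE y in M. ?g (- 1) y = ?g 1 y"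
      using jump
    proof (rule eventually_mono)
      fix y assume y: "(\<bar>y\<bar> \<le> c \<longrightarrow> b 1 y = b (- 1) y v* v_mod a c \<Lambda> (Complex 0 y) \<and>
        b' 1 y = b' (- 1) y v* v_mod a c \<Lambda> (Complex 0 y)) \<and> (c < \<bar>y\<bar> \<longrightarrow> b 1 y = b (- 1) y \<and> b' 1 y = b' (- 1) y)"
      show "?g (- 1) y = ?g 1 y"
      proof (cases "\<bar>y\<bar> \<le> c")
        case True
        show ?thesis
        proof (cases "\<bar>y\<bar> < a")
          case mid: True
          have "\<nu> 1 1 y * \<nu> 2 1 y = (exp (- 2 * pi * \<i> * \<Lambda>) * exp (2 * pi * \<i> * \<Lambda>)) * (\<nu> 1 (- 1) y * \<nu> 2 (- 1) y)"
            using y True vcases[OF True] mid by (simp add: \<nu>_def algebra_simps)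
          then show ?thesis using wR_no_jump[of y] mid unfolding exp1 by simp
        next
          case False
          then obtain \<eta> where eta: "\<eta>\<^sup>2 = - 1" "\<And>x :: complex ^ 2. (x v* v_mod a c \<Lambda> (Complex 0 y)) $ 1 = \<eta> * x $ 2"
            "\<And>x :: complex ^ 2. (x v* v_mod a c \<Lambda> (Complex 0 y)) $ 2 = \<eta> * x $ 1"
            using vcases[OF True] by (metis not_less)
          have "\<nu> 1 1 y * \<nu> 2 1 y = \<eta>\<^sup>2 * (\<nu> 1 (- 1) y * \<nu> 2 (- 1) y)"
            using y True by (simp add: \<nu>_def eta(2,3) power2_eq_square algebra_simps)
          then show ?thesis using wR_cut[of y] True False by (simp add: eta(1))
        qed
      next
        case False
        then show ?thesis using y wR_no_jump[of y] by (simp add: \<nu>_def)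
      qed
    qed
    from Lp_lim_cong_AE[OF G[OF s1(2)] measM[OF G[OF s1(1)]] this]
    show "Lp_lim 1 (lebesgue_on {-R..R}) (at_right 0)
        (\<lambda>e y. n 1 (Complex (- e) y) * n 2 (Complex (- e) y) * w a c (Complex (- e) y)) (?g 1)" by (simp add: M_def)
  qed (use R that in auto)
  then have prod0: "n 1 k = 0 \<or> n 2 k = 0" if "k \<in> ?c" for k
    using w_nonzero that by fastforce
  have n1_0: "n 1 k = 0" if "k \<in> ?c" for k
  proof (rule ccontr)
    assume nz: "n 1 k \<noteq> 0"
    define U where "U = {z \<in> ?c. n 1 z \<noteq> 0}"
    have "open U"
    proof -
      have "U = ?c \<inter> n 1 -` (- {0})" by (auto simp: U_def)
      then show ?thesis
        using continuous_open_preimage[OF holomorphic_on_imp_continuous_on[OF hn] open_minus_contour, of "- {0}" 1]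
        by (simp add: open_Compl)
    qed
    have "n 2 z = 0" if "z \<in> ?c" for z
      by (rule analytic_continuation_open[of U ?c "n 2" "\<lambda>_. 0"])
        (use \<open>open U\<close> open_minus_contour connected_minus_contour hn prod0 that nz \<open>k \<in> ?c\<close> in \<open>auto simp: U_def\<close>)
    moreover have "- k \<in> ?c" using \<open>k \<in> ?c\<close> by (simp add: contour_iff[OF c_pos])
    ultimately have "n 1 k = 0" using nsym(2)[OF \<open>k \<in> ?c\<close>] by simp
    then show False using nz by simp
  qed
  have "k \<in> ?c" "- k \<in> ?c" using assms(3) by (simp_all add: contour_iff[OF c_pos])
  then have "n 1 k = 0" "n 2 k = 0" using n1_0 nsym(1)[of k] by auto
  then show ?thesis
    by (simp add: n_def vec_eq_iff forall_2)
qed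

end

section \<open>The model solution\<close>

lemma vec2_tendsto:
  fixes f g :: "'b \<Rightarrow> complex"
  assumes "(f \<longlongrightarrow> x) F" "(g \<longlongrightarrow> y) F"
  shows "((\<lambda>k. vector [f k, g k] :: complex ^ 2) \<longlongrightarrow> vector [x, y]) F"
proof (rule vec_tendstoI)
  fix j :: 2
  show "((\<lambda>k. (vector [f k, g k] :: complex ^ 2) $ j) \<longlongrightarrow> (vector [x, y] :: complex ^ 2) $ j) F"
    using assms exhaust_2[of j] by auto
qed

lemma vec2_continuous_on:
  fixes f g :: "'b::topological_space \<Rightarrow> complex"
  assumes "continuous_on A f" "continuous_on A g"
  shows "continuous_on A (\<lambda>k. vector [f k, g k] :: complex ^ 2)"
  using assms by (simp add: continuous_on_def vec2_tendsto)

lemma norm_vec2: "norm (v :: complex ^ 2) = sqrt ((norm (v $ 1))\<^sup>2 + (norm (v $ 2))\<^sup>2)"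
  by (simp add: norm_vec_def L2_set_def sum_2)

lemma norm_vec2_le: "norm (v :: complex ^ 2) \<le> norm (v $ 1) + norm (v $ 2)"
  unfolding norm_vec2 by (rule sqrt_sum_squares_le_sum) auto

lemma integrable_inverse_sqrt:
  assumes "0 \<le> R"
  shows "(\<integral>\<^sup>+y\<in>{-R..R}. ennreal (1 / sqrt \<bar>y - t\<bar>) \<partial>lebesgue) < \<infinity>"
proof -
  have "((\<lambda>y. 1 / sqrt \<bar>y - t\<bar>) has_integral 2 * sqrt (R - t) - 2 * sqrt (- R - t)) {-R..R}"
  proof (rule fundamental_theorem_of_calculus_interior_strong[of "{t}"])
    fix y assume "y \<in> {-R<..<R} - {t}"
    then have y: "y - t \<noteq> 0" by simp
    have "DERIV sqrt (y - t) :> 1 / (2 * sqrt \<bar>y - t\<bar>)"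
      using y by (intro DERIV_real_sqrt_generic)
        (auto simp: field_simps abs_if real_sqrt_minus[of "y - t", simplified])
    then have "((\<lambda>y. sqrt (y - t)) has_real_derivative 1 / (2 * sqrt \<bar>y - t\<bar>) * 1) (at y)"
      by (rule DERIV_chain2[where g = "\<lambda>y. y - t" and x = y]) (auto intro!: derivative_eq_intros)
    from DERIV_cmult[OF this, of 2]
    have "((\<lambda>y. 2 * sqrt (y - t)) has_real_derivative 1 / sqrt \<bar>y - t\<bar>) (at y)" by simp
    then show "((\<lambda>y. 2 * sqrt (y - t)) has_vector_derivative 1 / sqrt \<bar>y - t\<bar>) (at y)"
      by (simp add: has_real_derivative_iff_has_vector_derivative)
  qed (use assms in \<open>auto intro!: continuous_intros\<close>)
  from nn_integral_has_integral_lebesgue[OF _ this]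
  have "(\<integral>\<^sup>+y. ennreal (indicator {-R..R} y * (1 / sqrt \<bar>y - t\<bar>)) \<partial>lborel) < \<infinity>"
    by simp
  also have "(\<integral>\<^sup>+y. ennreal (indicator {-R..R} y * (1 / sqrt \<bar>y - t\<bar>)) \<partial>lborel)
      = (\<integral>\<^sup>+y\<in>{-R..R}. ennreal (1 / sqrt \<bar>y - t\<bar>) \<partial>lebesgue)"
    unfolding nn_integral_completion by (intro nn_integral_cong) (simp add: indicator_def)
  finally show ?thesis .
qed

text \<open>
  Dominated convergence along every sequence \<open>\<epsilon> \<longlongrightarrow> 0\<close>, with dominating function \<open>4 \<psi>\<close>.
\<close>

lemma L2_boundary_valuesI:
  fixes m :: "complex \<Rightarrow> complex ^ 2"
  assumes s: "s = 1 \<or> s = - 1" and Z: "finite Z"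
    and conv: "\<And>y. y \<notin> Z \<Longrightarrow> \<exists>l. (m \<longlongrightarrow> l) (at (Complex 0 y) within side s)"
    and dom: "\<And>e y. 0 < e \<Longrightarrow> e \<le> 1 \<Longrightarrow> \<bar>y\<bar> \<le> R \<Longrightarrow> y \<notin> Z \<Longrightarrow> (norm (m (Complex (s * e) y)))\<^sup>2 \<le> \<psi> y"
    and cont: "\<And>x. x \<noteq> 0 \<Longrightarrow> continuous_on UNIV (\<lambda>y. m (Complex x y))"
    and \<psi>: "\<psi> \<in> borel_measurable lebesgue" "(\<integral>\<^sup>+y\<in>{-R..R}. ennreal (\<psi> y) \<partial>lebesgue) < \<infinity>"
  shows "L2_boundary_values R s m"
proof -
  define b where "b y = boundary_value s m (Complex 0 y)" for y
  have lim: "(m \<longlongrightarrow> b y) (at (Complex 0 y) within side s)" if "y \<notin> Z" for y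
    using conv[OF that] boundary_value_eqI[OF s, of "Complex 0 y" m] by (auto simp: b_def)
  have fl: "LIM n sequentially. Complex (s * X n) y :> at (Complex 0 y) within side s"
    if "X \<longlonglongrightarrow> 0" "\<And>n. 0 < X n" for X :: "nat \<Rightarrow> real" and y
    unfolding filterlim_at
  proof
    show "\<forall>\<^sub>F n in sequentially. Complex (s * X n) y \<in> side s \<and> Complex (s * X n) y \<noteq> Complex 0 y"
      using s that(2) by (intro always_eventually) (auto simp: side_def less_imp_neq[symmetric])
    have "(\<lambda>n. s * X n) \<longlonglongrightarrow> s * 0" by (intro tendsto_intros that)
    then show "(\<lambda>n. Complex (s * X n) y) \<longlonglongrightarrow> Complex 0 y"
      by (intro tendsto_Complex) auto
  qed
  have seq: "(\<lambda>n. m (Complex (s * X n) y)) \<longlonglongrightarrow> b y"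
    if "X \<longlonglongrightarrow> 0" "\<And>n. 0 < X n" "y \<notin> Z" for X :: "nat \<Rightarrow> real" and y
    by (rule filterlim_compose[OF lim[OF that(3)] fl[OF that(1,2)]])
  have x0: "(\<lambda>n. 1 / real (Suc n)) \<longlonglongrightarrow> 0" by (intro LIMSEQ_Suc lim_1_over_n)
  have meas: "(\<lambda>y. m (Complex x y)) \<in> borel_measurable lebesgue" if "x \<noteq> 0" for x
    using borel_measurable_continuous_onI[OF cont[OF that]] by (simp add: measurable_completion)
  \<comment> \<open>A measurable representative of the boundary values, equal to them off \<open>Z\<close>.\<close>
  define b' where "b' y = lim (\<lambda>n. m (Complex (s * (1 / real (Suc n))) y))" for y
  have [measurable]: "b' \<in> borel_measurable lebesgue"
    unfolding b'_def[abs_def] using s by (intro borel_measurable_lim_metric meas) auto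
  have b': "b' y = b y" if "y \<notin> Z" for y
    unfolding b'_def by (rule limI[OF seq[OF x0 _ that]]) simp
  have AEZ: "AE y in lebesgue. y \<notin> Z"
    using Z by (intro AE_not_in) (simp add: finite_imp_null_set_lborel null_sets_completionI)
  have b_dom: "(norm (b y))\<^sup>2 \<le> \<psi> y" if "\<bar>y\<bar> \<le> R" "y \<notin> Z" for y
  proof (rule LIMSEQ_le_const2)
    show "(\<lambda>n. (norm (m (Complex (s * (1 / real (Suc n))) y)))\<^sup>2) \<longlonglongrightarrow> (norm (b y))\<^sup>2"
      by (intro tendsto_intros seq[OF x0 _ that(2)]) auto
    show "\<exists>N. \<forall>n\<ge>N. (norm (m (Complex (s * (1 / real (Suc n))) y)))\<^sup>2 \<le> \<psi> y"
    proof (intro exI allI impI)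
      show "(norm (m (Complex (s * (1 / real (Suc n))) y)))\<^sup>2 \<le> \<psi> y" for n
        by (rule dom) (use that in auto)
    qed
  qed
  have 1: "AE y in lebesgue. \<bar>y\<bar> \<le> R \<longrightarrow> (m \<longlongrightarrow> b y) (at (Complex 0 y) within side s)"
    using AEZ by (rule eventually_mono) (use lim in blast)
  have "(\<integral>\<^sup>+y\<in>{-R..R}. ennreal ((norm (b y))\<^sup>2) \<partial>lebesgue) \<le> (\<integral>\<^sup>+y\<in>{-R..R}. ennreal (\<psi> y) \<partial>lebesgue)"
    using AEZ by (intro nn_integral_mono_AE) (auto elim!: eventually_mono simp: indicator_def intro!: ennreal_leI b_dom)
  then have 2: "(\<integral>\<^sup>+y\<in>{-R..R}. ennreal ((norm (b y))\<^sup>2) \<partial>lebesgue) < \<infinity>"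
    using \<psi>(2) by (rule le_less_trans)
  have 3: "((\<lambda>e. \<integral>\<^sup>+y\<in>{-R..R}. ennreal ((norm (m (Complex (s * e) y) - b y))\<^sup>2) \<partial>lebesgue) \<longlongrightarrow> 0) (at_right 0)"
    unfolding tendsto_at_iff_sequentially
  proof (intro allI impI)
    fix X :: "nat \<Rightarrow> real" assume X: "\<forall>i. X i \<in> {0<..} - {0}" "X \<longlonglongrightarrow> 0"
    have "\<forall>\<^sub>F i in sequentially. X i < 1" using X(2) by (rule order_tendstoD) simp
    then obtain N where N: "\<And>i. N \<le> i \<Longrightarrow> X i < 1" by (auto simp: eventually_sequentially)
    define Y where "Y i = X (i + N)" for i
    have Y: "Y \<longlonglongrightarrow> 0" "\<And>i. 0 < Y i" "\<And>i. Y i \<le> 1"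
      using X N LIMSEQ_ignore_initial_segment[OF X(2), of N] by (auto simp: Y_def[abs_def] less_imp_le)
    define u where "u i y = ennreal ((norm (m (Complex (s * Y i) y) - b' y))\<^sup>2) * indicator {-R..R} y" for i y
    have dom_meas: "(\<lambda>y. ennreal (\<psi> y) * indicator {-R..R} y) \<in> borel_measurable lebesgue"
      by (intro borel_measurable_times_ennreal measurable_compose[OF \<psi>(1) measurable_ennreal] borel_measurable_indicator) auto
    have "(\<lambda>i. \<integral>\<^sup>+y. u i y \<partial>lebesgue) \<longlonglongrightarrow> (\<integral>\<^sup>+(y::real). 0 \<partial>lebesgue)"
    proof (rule nn_integral_dominated_convergence[where w = "\<lambda>y. ennreal 4 * (ennreal (\<psi> y) * indicator {-R..R} y)"])
      fix i
      have "(\<lambda>y. m (Complex (s * Y i) y)) \<in> borel_measurable lebesgue"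
        using s Y(2)[of i] by (intro meas) auto
      then have "(\<lambda>y. (norm (m (Complex (s * Y i) y) - b' y))\<^sup>2) \<in> borel_measurable lebesgue"
        by (intro borel_measurable_power borel_measurable_norm borel_measurable_diff) auto
      then show "u i \<in> borel_measurable lebesgue"
        unfolding u_def[abs_def]
        by (intro borel_measurable_times_ennreal measurable_compose[OF _ measurable_ennreal] borel_measurable_indicator) auto
      show "AE y in lebesgue. u i y \<le> ennreal 4 * (ennreal (\<psi> y) * indicator {-R..R} y)"
        using AEZ
      proof (rule eventually_mono)
        fix y assume y: "y \<notin> Z"
        show "u i y \<le> ennreal 4 * (ennreal (\<psi> y) * indicator {-R..R} y)"
        proof (cases "\<bar>y\<bar> \<le> R")
          case True
          have "(norm (m (Complex (s * Y i) y) - b y))\<^sup>2 \<le> (norm (m (Complex (s * Y i) y)) + norm (b y))\<^sup>2"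
            by (intro power_mono norm_triangle_ineq4) auto
          also have "\<dots> \<le> 2 * ((norm (m (Complex (s * Y i) y)))\<^sup>2 + (norm (b y))\<^sup>2)"
            using sum_squares_bound[of "norm (m (Complex (s * Y i) y))" "norm (b y)"]
            by (simp add: power2_eq_square algebra_simps)
          also have "\<dots> \<le> 2 * (\<psi> y + \<psi> y)"
            using True y Y by (intro mult_left_mono add_mono dom b_dom) auto
          finally have "(norm (m (Complex (s * Y i) y) - b y))\<^sup>2 \<le> 4 * \<psi> y" by simp
          then have "ennreal ((norm (m (Complex (s * Y i) y) - b y))\<^sup>2) \<le> ennreal 4 * ennreal (\<psi> y)"
            using b_dom[OF True y] by (subst ennreal_mult[symmetric]) (auto intro: ennreal_leI order_trans[OF zero_le_power2])
          then show ?thesis using True by (simp add: u_def b'[OF y] indicator_def abs_le_iff)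
        qed (auto simp: u_def indicator_def abs_le_iff)
      qed
    next
      have "(\<integral>\<^sup>+y. ennreal 4 * (ennreal (\<psi> y) * indicator {-R..R} y) \<partial>lebesgue)
          = ennreal 4 * (\<integral>\<^sup>+y\<in>{-R..R}. ennreal (\<psi> y) \<partial>lebesgue)"
        by (intro nn_integral_cmult dom_meas)
      also have "\<dots> < \<infinity>" using \<psi>(2) by (auto simp: ennreal_mult_less_top)
      finally show "(\<integral>\<^sup>+y. ennreal 4 * (ennreal (\<psi> y) * indicator {-R..R} y) \<partial>lebesgue) < \<infinity>" .
      show "AE y in lebesgue. (\<lambda>i. u i y) \<longlonglongrightarrow> 0"
        using AEZ
      proof (rule eventually_mono)
        fix y assume y: "y \<notin> Z"
        have "(\<lambda>i. (norm (m (Complex (s * Y i) y) - b' y))\<^sup>2) \<longlonglongrightarrow> (norm (b y - b y))\<^sup>2"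
          unfolding b'[OF y] by (intro tendsto_intros seq Y y)
        then have "(\<lambda>i. ennreal ((norm (m (Complex (s * Y i) y) - b' y))\<^sup>2)) \<longlonglongrightarrow> ennreal 0"
          by (intro tendsto_ennrealI) simp
        then show "(\<lambda>i. u i y) \<longlonglongrightarrow> 0"
          by (auto simp: u_def indicator_def)
      qed
    qed (use dom_meas in auto)
    moreover have "(\<integral>\<^sup>+y. u i y \<partial>lebesgue)
        = (\<integral>\<^sup>+y\<in>{-R..R}. ennreal ((norm (m (Complex (s * Y i) y) - b y))\<^sup>2) \<partial>lebesgue)" for i
      using AEZ by (intro nn_integral_cong_AE) (auto elim!: eventually_mono simp: u_def b')
    ultimately have "(\<lambda>i. \<integral>\<^sup>+y\<in>{-R..R}. ennreal ((norm (m (Complex (s * X (i + N)) y) - b y))\<^sup>2) \<partial>lebesgue) \<longlonglongrightarrow> 0"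
      by (simp add: Y_def)
    then show "((\<lambda>e. \<integral>\<^sup>+y\<in>{-R..R}. ennreal ((norm (m (Complex (s * e) y) - b y))\<^sup>2) \<partial>lebesgue) \<circ> X) \<longlonglongrightarrow> 0"
      unfolding o_def by (rule LIMSEQ_offset)
  qed
  show ?thesis
    using 1 2 3 unfolding L2_boundary_values_def b_def by blast
qed

context branch_points
begin

text \<open>
  \<open>E_s\<close> is a quotient of two values of this product. It is more symmetric than the theta
  function: it is even and has period \<open>1/2\<close>.
\<close>

definition theta_prod :: "complex \<Rightarrow> complex" where
  "theta_prod z = theta3 (z + 1/2) (tau a c) * theta3 z (tau a c)"

lemma tau_ReIm: "Re (tau a c) = 0" "Im (tau a c) = T" "0 < Im (tau a c)"
  using T_pos by (simp_all add: tau_eq)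

lemma theta_prod_holomorphic: "theta_prod holomorphic_on A"
proof -
  have "(\<lambda>z. theta3 (z + 1/2) (tau a c)) holomorphic_on UNIV"
  proof -
    have "((\<lambda>z. theta3 z (tau a c)) \<circ> (\<lambda>z. z + 1/2)) holomorphic_on UNIV"
      by (rule holomorphic_on_compose_gen[OF _ theta3_holomorphic[OF tau_ReIm(3), of UNIV]])
        (auto intro!: holomorphic_intros)
    then show ?thesis by (simp add: o_def)
  qed
  then have "theta_prod holomorphic_on UNIV"
    unfolding theta_prod_def[abs_def] by (intro holomorphic_intros theta3_holomorphic tau_ReIm)
  then show ?thesis by (rule holomorphic_on_subset) auto
qed

lemma theta_prod_continuous: "continuous_on A theta_prod"
  by (rule holomorphic_on_imp_continuous_on[OF theta_prod_holomorphic])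

lemma theta_prod_plus_half: "theta_prod (z + 1/2) = theta_prod z"
  using theta3_plus_1[of z] by (simp add: theta_prod_def add.assoc)

lemma theta_prod_minus: "theta_prod (- z) = theta_prod z"
proof -
  have "theta3 (- z + 1/2) (tau a c) = theta3 (- (- z + 1/2) + 1) (tau a c)"
    by (simp only: theta3_plus_1 theta3_minus)
  also have "- (- z + 1/2) + 1 = z + 1/2" by simp
  finally show ?thesis by (simp add: theta_prod_def theta3_minus)
qed

lemma theta_prod_plus_tau: "theta_prod (z + tau a c) = exp (- (2 * tau a c + 4 * z + 1) * (of_real pi * \<i>)) * theta_prod z"
proof -
  have "theta_prod (z + tau a c) = (exp (- (tau a c + 2 * (z + 1/2)) * (of_real pi * \<i>)) * exp (- (tau a c + 2 * z) * (of_real pi * \<i>))) * theta_prod z"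
    using theta3_plus_period[of "z + 1/2" "tau a c"] theta3_plus_period[of z "tau a c"]
    by (simp add: theta_prod_def algebra_simps)
  also have "exp (- (tau a c + 2 * (z + 1/2)) * (of_real pi * \<i>)) * exp (- (tau a c + 2 * z) * (of_real pi * \<i>))
      = exp (- (2 * tau a c + 4 * z + 1) * (of_real pi * \<i>))"
    unfolding exp_add[symmetric] by (rule arg_cong[of _ _ exp]) (simp add: algebra_simps)
  finally show ?thesis .
qed

lemma theta_prod_nonzero:
  assumes "\<bar>Im z\<bar> < T / 2 \<or> \<bar>Im z\<bar> = T / 2 \<and> 0 < Re z \<and> Re z < 1/2"
  shows "theta_prod z \<noteq> 0"
proof
  assume "theta_prod z = 0"
  then consider "theta3 (z + 1/2) (tau a c) = 0" | "theta3 z (tau a c) = 0"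
    by (auto simp: theta_prod_def)
  then have "\<bar>Im z\<bar> = T / 2 \<and> (Re z \<in> \<int> \<or> Re z - 1/2 \<in> \<int>)"
  proof cases
    case 1
    then show ?thesis
      using theta3_zero_closed_strip[OF tau_ReIm(1) _ tau_ReIm(3), of "z + 1/2"] assms by (auto simp: tau_ReIm)
  next
    case 2
    then show ?thesis
      using theta3_zero_closed_strip[OF tau_ReIm(1) _ tau_ReIm(3), of z] assms by (auto simp: tau_ReIm)
  qed
  then have z: "0 < Re z" "Re z < 1/2" "Re z \<in> \<int> \<or> Re z - 1/2 \<in> \<int>" using assms by auto
  then obtain n :: int where "Re z = of_int n \<or> Re z - 1/2 = of_int n"
    by (auto elim!: Ints_cases)
  moreover have "real_of_int n \<ge> 1 \<or> real_of_int n \<le> 0" by (cases "n \<ge> 1") auto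
  moreover have "real_of_int n \<ge> 0 \<or> real_of_int n \<le> - 1" by (cases "n \<ge> 0") auto
  ultimately show False using z by linarith
qed

text \<open>
  Both points are mapped to the simple zero \<open>\<tau> / 2\<close> by the symmetries of the product.
\<close>

lemma theta_prod_lower_bound:
  obtains C r where "C > 0" "r > 0"
    "\<And>z z0. norm (z - z0) < r \<Longrightarrow> z0 = - tau a c / 2 \<or> z0 = 1/2 - tau a c / 2 \<Longrightarrow> C * norm (z - z0) \<le> norm (theta_prod z)"
proof -
  let ?t = "tau a c"
  define \<theta> where "\<theta> z = theta3 z ?t" for z
  define D where "D = deriv \<theta> (1/2 + ?t/2) * \<theta> (?t/2)"
  have dth: "(\<theta> has_field_derivative deriv \<theta> z) (at z)" for z
    unfolding \<theta>_def[abs_def] by (rule theta3_has_field_derivative[OF tau_ReIm(3)])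
  have "\<theta> (?t/2) \<noteq> 0"
  proof
    assume "\<theta> (?t/2) = 0"
    then have "Re (?t/2) - 1/2 \<in> \<int>"
      unfolding \<theta>_def using theta3_zero_closed_strip[OF tau_ReIm(1) _ tau_ReIm(3), of "?t/2"] tau_ReIm by auto
    then show False by (auto simp: tau_ReIm elim!: Ints_cases)
  qed
  then have D: "D \<noteq> 0"
    using theta3_simple_zero[OF tau_ReIm(3)] by (simp add: D_def \<theta>_def[abs_def])
  have "(\<theta> has_field_derivative deriv \<theta> (1/2 + ?t/2)) (at (?t/2 + 1/2))"
    using dth[of "1/2 + ?t/2"] by (simp add: add.commute)
  then have "((\<lambda>z. \<theta> (z + 1/2)) has_field_derivative deriv \<theta> (1/2 + ?t/2)) (at (?t/2))"
    by (simp add: DERIV_shift)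
  from DERIV_mult[OF this dth]
  have "(theta_prod has_field_derivative D) (at (?t/2))"
    using theta3_zero[of ?t] by (simp add: theta_prod_def[abs_def] \<theta>_def[abs_def] D_def add.commute)
  moreover have Den0: "theta_prod (?t/2) = 0"
    using theta3_zero[of ?t] by (simp add: theta_prod_def add.commute)
  ultimately have "((\<lambda>h. norm (theta_prod (?t/2 + h) / h)) \<longlongrightarrow> norm D) (at 0)"
    by (intro tendsto_norm) (simp add: DERIV_def)
  then have "\<forall>\<^sub>F h in at 0. norm D / 2 < norm (theta_prod (?t/2 + h) / h)"
    by (rule order_tendstoD) (use D in simp)
  then obtain r where r: "r > 0" "\<And>h. h \<noteq> 0 \<Longrightarrow> norm h < r \<Longrightarrow> norm D / 2 < norm (theta_prod (?t/2 + h) / h)"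
    unfolding eventually_at by (auto simp: dist_norm)
  have low: "norm D / 2 * norm h \<le> norm (theta_prod (?t/2 + h))" if "norm h < r" for h
    using r(2)[OF _ that] by (cases "h = 0") (auto simp: norm_divide field_simps)
  show thesis
  proof (rule that[of "norm D / 2" r])
    fix z z0 assume z: "norm (z - z0) < r" and z0: "z0 = - ?t / 2 \<or> z0 = 1/2 - ?t / 2"
    have "theta_prod z = theta_prod (?t/2 + (z0 - z))"
    proof (cases "z0 = - ?t / 2")
      case True
      then show ?thesis using theta_prod_minus[of z] by simp
    next
      case False
      then have "?t/2 + (z0 - z) = - z + 1/2" using z0 by simp
      then show ?thesis by (simp only: theta_prod_plus_half theta_prod_minus)
    qed
    then show "norm D / 2 * norm (z - z0) \<le> norm (theta_prod z)"
      using low[of "z0 - z"] z by (simp add: norm_minus_commute)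
  qed (use D r in auto)
qed

lemma E_s_eq: "E_s a c \<Lambda> z = theta_prod (z - of_real \<Lambda> / 2) / theta_prod z"
  by (simp add: E_s_def theta_prod_def)

lemma E_s_plus_half: "E_s a c \<Lambda> (z + 1/2) = E_s a c \<Lambda> z"
  using theta_prod_plus_half[of "z - of_real \<Lambda> / 2"] theta_prod_plus_half[of z] by (simp add: E_s_eq algebra_simps)

lemma E_s_half_minus: "E_s a c \<Lambda> (1/2 - z) = E_s a c \<Lambda> (- z)" "E_s a c \<Lambda> (- (1/2 - z)) = E_s a c \<Lambda> z"
  using E_s_plus_half[of \<Lambda> "- z"] E_s_plus_half[of \<Lambda> "- (1/2 - z)"] by (simp_all add: algebra_simps)

lemma E_s_plus_tau: "E_s a c \<Lambda> (z + tau a c) = exp (2 * pi * \<i> * \<Lambda>) * E_s a c \<Lambda> z"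
proof -
  let ?e = "\<lambda>z. exp (- (2 * tau a c + 4 * z + 1) * (of_real pi * \<i>))"
  have "E_s a c \<Lambda> (z + tau a c) = (?e (z - of_real \<Lambda> / 2) / ?e z) * E_s a c \<Lambda> z"
    using theta_prod_plus_tau[of "z - of_real \<Lambda> / 2"] theta_prod_plus_tau[of z] by (simp add: E_s_eq algebra_simps)
  also have "?e (z - of_real \<Lambda> / 2) / ?e z = exp (2 * pi * \<i> * \<Lambda>)"
    unfolding exp_diff[symmetric] by (rule arg_cong[of _ _ exp]) (simp add: algebra_simps)
  finally show ?thesis .
qed

lemma E_s_quarter_nonzero: "E_s a c \<Lambda> (1/4) \<noteq> 0"
  using T_pos by (simp add: E_s_eq theta_prod_nonzero)

text \<open>
  Only at \<open>\<i>a\<close> and \<open>- \<i>a\<close> does the Abel map reach the corners \<open>- \<tau> / 2\<close> and \<open>1/2 - \<tau> / 2\<close>, where the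
  zeros are: elsewhere it is inside the strip or in the open edge between the corners.
\<close>

lemma theta_prod_AR_nonzero:
  assumes "0 \<le> Re k" "k \<noteq> \<i> * a" "k \<noteq> - \<i> * a"
  shows "theta_prod (AR k) \<noteq> 0"
proof (cases "Re k = 0")
  case False
  then show ?thesis
    using Im_Ab_less[of k] AR_eq_Ab[of k] assms by (intro theta_prod_nonzero) (auto simp: not_contour_iff)
next
  case True
  then have k: "k = \<i> * Im k" by (simp add: complex_eq_iff)
  have "\<bar>Im k\<bar> \<noteq> a" using True assms by (auto simp: complex_eq_iff abs_if split: if_splits)
  then consider "\<bar>Im k\<bar> < a" | "a < \<bar>Im k\<bar>" by linarith
  then show ?thesis
  proof cases
    case 1
    then show ?thesis
      using Im_AR_middle[of "Im k"] Re_AR_middle[of "Im k"] T_pos k by (intro theta_prod_nonzero) auto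
  next
    case 2
    then show ?thesis
      using Im_AR_outside[of "Im k"] T_pos k by (intro theta_prod_nonzero disjI1) auto
  qed
qed

lemma theta_prod_Ab_nonzero:
  assumes "k \<notin> contour c"
  shows "theta_prod (Ab k) \<noteq> 0"
proof (cases "0 \<le> Re k")
  case True
  moreover have "k \<noteq> \<i> * a" "k \<noteq> - \<i> * a"
    using assms ac by (auto simp: not_contour_iff)
  ultimately show ?thesis
    using theta_prod_AR_nonzero[of k] AR_eq_Ab[of k] assms by auto
next
  case False
  then have "theta_prod (AR (- k)) \<noteq> 0" by (intro theta_prod_AR_nonzero) (auto simp: complex_eq_iff)
  moreover have "AR (- k) = - Ab k + 1/2"
    using False assms Ab_minus[of k] AR_eq_Ab[of "- k"] by (simp add: not_contour_iff)
  ultimately show ?thesis by (simp only: theta_prod_plus_half theta_prod_minus) simp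
qed

definition fourth_root :: "complex \<Rightarrow> complex \<Rightarrow> complex" where
  "fourth_root \<kappa> k = csqrt (csqrt (k - \<kappa>))"

lemma gammaR_fourth_root: "gammaR k = fourth_root (\<i> * a) k * fourth_root (- \<i> * a) k / (fourth_root (\<i> * c) k * fourth_root (- \<i> * c) k)"
  by (simp add: gammaR_def fourth_root_def)

lemma fourth_root_continuous: "\<kappa> \<in> G \<Longrightarrow> continuous_on crhp (fourth_root \<kappa>)"
  unfolding fourth_root_def[abs_def] by (rule continuous_on_csqrt_csqrt_minus_G)

lemma fourth_root_eq_0_iff: "fourth_root \<kappa> k = 0 \<longleftrightarrow> k = \<kappa>"
  by (simp only: fourth_root_def csqrt_eq_0) simp

lemma norm_fourth_root: "norm (fourth_root \<kappa> k) = sqrt (sqrt (norm (k - \<kappa>)))"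
  by (simp only: fourth_root_def norm_csqrt)

definition zeta16 :: complex where "zeta16 = csqrt zeta8"

lemma zeta16: "zeta16\<^sup>2 = zeta8" "zeta16 * cnj zeta16 = 1"
proof -
  show "zeta16\<^sup>2 = zeta8" unfolding zeta16_def by (rule power2_csqrt)
  have "(norm zeta8)\<^sup>2 = 1" unfolding zeta8_def cmod_def by (simp add: power2_eq_square)
  then have "norm zeta8 = 1 \<or> norm zeta8 = - 1" by (simp only: power2_eq_1_iff)
  then have "norm zeta8 = 1" using norm_ge_zero[of zeta8] by linarith
  then have "norm zeta16 = 1" unfolding zeta16_def norm_csqrt by simp
  then show "zeta16 * cnj zeta16 = 1" by (simp add: mult_cnj_norm)
qed

lemma csqrt_of_real_mult:
  assumes "0 \<le> s"
  shows "csqrt (of_real s * z) = of_real (sqrt s) * csqrt z"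
proof (cases "s = 0")
  case False
  show ?thesis
  proof (rule csqrt_unique)
    have "(complex_of_real (sqrt s))\<^sup>2 = of_real s" using assms by (simp flip: of_real_power)
    then show "(of_real (sqrt s) * csqrt z)\<^sup>2 = of_real s * z"
      by (simp only: power_mult_distrib power2_csqrt)
    show "0 < Re (of_real (sqrt s) * csqrt z) \<or> Re (of_real (sqrt s) * csqrt z) = 0 \<and> 0 \<le> Im (of_real (sqrt s) * csqrt z)"
      using csqrt_principal[of z] assms False
      by (simp del: csqrt.simps add: Re_divide_of_real zero_less_mult_iff) auto
  qed
qed simp

lemma csqrt_csqrt_imaginary:
  assumes "0 \<le> x"
  shows "csqrt (csqrt (\<i> * of_real x)) = of_real (sqrt (sqrt x)) * zeta16"
    and "csqrt (csqrt (\<i> * of_real (- x))) = of_real (sqrt (sqrt x)) * cnj zeta16"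
proof -
  have "csqrt (cnj zeta8) = cnj zeta16"
    unfolding zeta16_def by (rule csqrt_cnj_rhp) (simp add: zeta8_def)
  then show "csqrt (csqrt (\<i> * of_real x)) = of_real (sqrt (sqrt x)) * zeta16"
    "csqrt (csqrt (\<i> * of_real (- x))) = of_real (sqrt (sqrt x)) * cnj zeta16"
    unfolding csqrt_imaginary[OF assms] using assms by (simp_all add: csqrt_of_real_mult zeta16_def del: csqrt.simps)
qed

lemma fourth_root_imaginary:
  "y \<ge> t \<Longrightarrow> fourth_root (\<i> * of_real t) (\<i> * of_real y) = of_real (sqrt (sqrt \<bar>y - t\<bar>)) * zeta16"
  "y \<le> t \<Longrightarrow> fourth_root (\<i> * of_real t) (\<i> * of_real y) = of_real (sqrt (sqrt \<bar>y - t\<bar>)) * cnj zeta16"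
proof -
  have *: "\<i> * complex_of_real y - \<i> * of_real t = \<i> * of_real (y - t)" by (simp add: algebra_simps)
  show "y \<ge> t \<Longrightarrow> fourth_root (\<i> * of_real t) (\<i> * of_real y) = of_real (sqrt (sqrt \<bar>y - t\<bar>)) * zeta16"
    using csqrt_csqrt_imaginary(1)[of "y - t"] unfolding fourth_root_def * by (simp del: csqrt.simps)
  show "y \<le> t \<Longrightarrow> fourth_root (\<i> * of_real t) (\<i> * of_real y) = of_real (sqrt (sqrt \<bar>y - t\<bar>)) * cnj zeta16"
    using csqrt_csqrt_imaginary(2)[of "t - y"] unfolding fourth_root_def * by (simp del: csqrt.simps)
qed

lemma fourth_root_minus_imaginary:
  "fourth_root (\<i> * of_real t) (- (\<i> * of_real y)) = cnj (fourth_root (- (\<i> * of_real t)) (\<i> * of_real y))"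
proof (cases "y \<ge> - t")
  case True
  then show ?thesis using fourth_root_imaginary(1)[of "- t" y] fourth_root_imaginary(2)[of "- y" t] by (simp add: abs_minus_commute add.commute)
next
  case False
  then show ?thesis using fourth_root_imaginary(2)[of y "- t"] fourth_root_imaginary(1)[of t "- y"] by (simp add: abs_minus_commute add.commute)
qed

lemma gammaR_minus_imaginary: "gammaR (- (\<i> * of_real y)) = cnj (gammaR (\<i> * of_real y))"
  using fourth_root_minus_imaginary[of a y] fourth_root_minus_imaginary[of "- a" y] fourth_root_minus_imaginary[of c y] fourth_root_minus_imaginary[of "- c" y]
  by (simp add: gammaR_fourth_root mult.commute)

text \<open>
  Going down the axis, the phase of \<open>gammaR\<close> changes at each branch point. On the upper cut it is
  \<open>exp (\<i> \<pi> / 4)\<close>, and at the opposite point it is the conjugate of this.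
\<close>

lemma gammaR_upper:
  assumes "a < y" "y < c"
  shows "gammaR (\<i> * y) = \<i> * gammaR (- (\<i> * y))"
proof -
  define r where "r = sqrt (sqrt \<bar>y - a\<bar>) * sqrt (sqrt \<bar>y + a\<bar>) / (sqrt (sqrt \<bar>y - c\<bar>) * sqrt (sqrt \<bar>y + c\<bar>))"
  have "gammaR (\<i> * y) = of_real r * ((zeta16 * zeta16) / (zeta16 * cnj zeta16))"
    using fourth_root_imaginary(1)[of a y] fourth_root_imaginary(1)[of "- a" y] fourth_root_imaginary(2)[of y c] fourth_root_imaginary(1)[of "- c" y] assms ac
    by (simp add: gammaR_fourth_root r_def mult_ac)
  then have g: "gammaR (\<i> * y) = of_real r * zeta8"
    by (simp add: zeta16(2) flip: zeta16(1) power2_eq_square)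
  have "zeta8 = \<i> * cnj zeta8" by (simp add: zeta8_def complex_eq_iff)
  then show ?thesis unfolding gammaR_minus_imaginary g by simp
qed

lemma gammaR_middle:
  assumes "\<bar>y\<bar> < a"
  shows "gammaR (- (\<i> * y)) = gammaR (\<i> * y)"
proof -
  define r where "r = sqrt (sqrt \<bar>y - a\<bar>) * sqrt (sqrt \<bar>y + a\<bar>) / (sqrt (sqrt \<bar>y - c\<bar>) * sqrt (sqrt \<bar>y + c\<bar>))"
  have "gammaR (\<i> * y) = of_real r * ((zeta16 * cnj zeta16) / (zeta16 * cnj zeta16))"
    using fourth_root_imaginary(2)[of y a] fourth_root_imaginary(1)[of "- a" y] fourth_root_imaginary(2)[of y c] fourth_root_imaginary(1)[of "- c" y] assms ac
    by (simp add: gammaR_fourth_root r_def mult_ac)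
  then have "gammaR (\<i> * y) = of_real r" by (simp add: zeta16)
  then show ?thesis unfolding gammaR_minus_imaginary by simp
qed

text \<open>
  The continuous extension of \<open>m_mod\<close> from the right to the imaginary axis. From the left, the symmetry
  gives \<open>swap2 (m_right (- k))\<close>, so that the jump at \<open>k\<close> compares \<open>m_right\<close> at \<open>k\<close> and \<open>- k\<close>.
\<close>

definition m_right :: "real \<Rightarrow> complex \<Rightarrow> complex ^ 2" where
  "m_right \<Lambda> k = vector [gammaR k / E_s a c \<Lambda> (1/4) * E_s a c \<Lambda> (AR k),
                     gammaR k / E_s a c \<Lambda> (1/4) * E_s a c \<Lambda> (- AR k)]"

lemma m_mod_component:
  assumes "k \<notin> contour c"
  shows "m_mod a c \<Lambda> k $ 1 = gamma_tilde a c k / E_s a c \<Lambda> (1/4) * E_s a c \<Lambda> (Ab k)"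
    "m_mod a c \<Lambda> k $ 2 = gamma_tilde a c k / E_s a c \<Lambda> (1/4) * E_s a c \<Lambda> (- Ab k)"
  using assms by (simp_all add: m_mod_def N_s_def Lim_abel_upper abel_upper_eq)

lemma vec2_eqI: "x $ 1 = y $ 1 \<Longrightarrow> x $ 2 = y $ 2 \<Longrightarrow> x = (y :: complex ^ 2)"
  by (simp add: vec_eq_iff forall_2)

lemma m_mod_eq_mp:
  assumes "0 \<le> Re k" "k \<notin> contour c"
  shows "m_mod a c \<Lambda> k = m_right \<Lambda> k"
  by (rule vec2_eqI)
    (use assms in \<open>simp_all add: m_mod_component m_right_def gamma_eq_gammaR_crhp AR_eq_Ab\<close>)

definition swap2 :: "complex ^ 2 \<Rightarrow> complex ^ 2" where "swap2 v = vector [v $ 2, v $ 1]"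

lemma swap2_component: "swap2 v $ 1 = v $ 2" "swap2 v $ 2 = v $ 1"
  by (simp_all add: swap2_def)

lemma norm_swap2: "norm (swap2 v) = norm v"
  by (simp add: norm_vec2 swap2_component add.commute)

lemma minus_not_contour: "k \<notin> contour c \<Longrightarrow> - k \<notin> contour c"
  by (simp add: not_contour_iff)

lemma m_mod_minus:
  assumes "k \<notin> contour c"
  shows "m_mod a c \<Lambda> (- k) = swap2 (m_mod a c \<Lambda> k)"
proof -
  have "gamma_tilde a c (- k) = gamma_tilde a c k" by (simp add: gamma_tilde_def cut_ratio_def)
  then show ?thesis
    using assms minus_not_contour[OF assms] E_s_half_minus[of \<Lambda> "Ab k"]
    by (intro vec2_eqI) (simp_all add: swap2_component m_mod_component Ab_minus)
qed

lemma m_mod_eq_swap_mp: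
  assumes "Re k \<le> 0" "k \<notin> contour c"
  shows "m_mod a c \<Lambda> k = swap2 (m_right \<Lambda> (- k))"
  using m_mod_minus[OF minus_not_contour[OF assms(2)], of \<Lambda>] m_mod_eq_mp[of "- k"] assms minus_not_contour
  by simp

lemma E_s_AR_continuous:
  "continuous_on (crhp - {\<i> * a, - \<i> * a}) (\<lambda>k. E_s a c \<Lambda> (AR k))"
  "continuous_on (crhp - {\<i> * a, - \<i> * a}) (\<lambda>k. E_s a c \<Lambda> (- AR k))"
proof -
  have AR: "continuous_on (crhp - {\<i> * a, - \<i> * a}) AR"
    by (rule continuous_on_subset[OF AR_continuous]) auto
  have D: "continuous_on (crhp - {\<i> * a, - \<i> * a}) (\<lambda>k. theta_prod (f k))"
    if "continuous_on (crhp - {\<i> * a, - \<i> * a}) f" for f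
    by (rule continuous_on_compose2[OF theta_prod_continuous[of UNIV] that]) auto
  show "continuous_on (crhp - {\<i> * a, - \<i> * a}) (\<lambda>k. E_s a c \<Lambda> (AR k))"
    "continuous_on (crhp - {\<i> * a, - \<i> * a}) (\<lambda>k. E_s a c \<Lambda> (- AR k))"
    unfolding E_s_eq using theta_prod_AR_nonzero
    by (intro continuous_on_divide D continuous_intros AR; simp add: theta_prod_minus)+
qed

lemma m_right_continuous: "continuous_on (crhp - G) (m_right \<Lambda>)"
proof -
  have g: "continuous_on (crhp - G) gammaR"
    by (rule continuous_on_subset[OF gammaR_continuous]) (use G_members in auto)
  have e: "continuous_on (crhp - G) (\<lambda>k. E_s a c \<Lambda> (AR k))" "continuous_on (crhp - G) (\<lambda>k. E_s a c \<Lambda> (- AR k))"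
    by (rule continuous_on_subset[OF E_s_AR_continuous(1)] continuous_on_subset[OF E_s_AR_continuous(2)];
        use G_members in auto)+
  show ?thesis
    unfolding m_right_def[abs_def] using E_s_quarter_nonzero
    by (intro vec2_continuous_on continuous_intros g e) auto
qed

lemma swap2_continuous: "continuous_on A swap2"
  unfolding swap2_def[abs_def] by (intro vec2_continuous_on continuous_intros)

lemma m_mod_continuous_up_to_boundary:
  "continuous_up_to_boundary_except c G (m_mod a c \<Lambda>)"
  unfolding continuous_up_to_boundary_except_def
proof (intro exI conjI ballI impI)
  show "continuous_on ({k. 0 \<le> Re k} - G) (m_right \<Lambda>)" by (rule m_right_continuous)
  have "continuous_on ({k. Re k \<le> 0} - G) (\<lambda>k. m_right \<Lambda> (- k))"
    by (rule continuous_on_compose2[OF m_right_continuous]) (auto simp: G_iff intro!: continuous_intros)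
  then show "continuous_on ({k. Re k \<le> 0} - G) (\<lambda>k. swap2 (m_right \<Lambda> (- k)))"
    by (rule continuous_on_compose2[OF swap2_continuous[of UNIV]]) auto
qed (auto simp: m_mod_eq_mp m_mod_eq_swap_mp)

lemma m_mod_holomorphic: "(\<lambda>k. m_mod a c \<Lambda> k $ j) holomorphic_on - contour c"
proof -
  have Ab: "Ab holomorphic_on - contour c"
    unfolding holomorphic_on_open[OF open_minus_contour] using Ab_has_field_derivative by blast
  have g: "gamma_tilde a c holomorphic_on - contour c"
    by (rule holomorphic_on_subset[OF gamma_tilde_branch(1)[OF a_pos a_less_c]]) (use not_cuts_if in auto)
  have D: "(\<lambda>k. theta_prod (f k)) holomorphic_on - contour c" if "f holomorphic_on - contour c" for f
    using holomorphic_on_compose_gen[OF that theta_prod_holomorphic[of UNIV]] by (simp add: o_def)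
  have "(\<lambda>k. gamma_tilde a c k / E_s a c \<Lambda> (1/4) * E_s a c \<Lambda> (Ab k)) holomorphic_on - contour c"
    "(\<lambda>k. gamma_tilde a c k / E_s a c \<Lambda> (1/4) * E_s a c \<Lambda> (- Ab k)) holomorphic_on - contour c"
    unfolding E_s_eq[of _ "Ab _"] E_s_eq[of _ "- Ab _"] using theta_prod_Ab_nonzero E_s_quarter_nonzero
    by (intro holomorphic_on_mult holomorphic_on_divide D g holomorphic_intros Ab; simp add: theta_prod_minus)+
  from this[THEN holomorphic_transform]
  have "(\<lambda>k. m_mod a c \<Lambda> k $ 1) holomorphic_on - contour c" "(\<lambda>k. m_mod a c \<Lambda> k $ 2) holomorphic_on - contour c"
    by (simp_all add: m_mod_component)
  then show ?thesis using exhaust_2[of j] by auto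
qed

lemma m_mod_tendsto_plus:
  assumes "Re k = 0" "k \<notin> G"
  shows "(m_mod a c \<Lambda> \<longlongrightarrow> m_right \<Lambda> k) (at k within side 1)"
proof -
  have "(m_right \<Lambda> \<longlongrightarrow> m_right \<Lambda> k) (at k within crhp - G)"
    using m_right_continuous assms by (auto simp: continuous_on_def)
  then have "(m_right \<Lambda> \<longlongrightarrow> m_right \<Lambda> k) (at k within side 1)"
    by (rule tendsto_within_subset) (auto simp: side_def G_iff)
  then show ?thesis
    by (rule Lim_transform_eventually) (auto simp: eventually_at_filter side_def m_mod_eq_mp not_contour_iff)
qed

lemma m_mod_tendsto_minus:
  assumes "Re k = 0" "k \<notin> G"
  shows "(m_mod a c \<Lambda> \<longlongrightarrow> swap2 (m_right \<Lambda> (- k))) (at k within side (- 1))"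
proof -
  have "(m_right \<Lambda> \<longlongrightarrow> m_right \<Lambda> (- k)) (at (- k) within crhp - G)"
    using m_right_continuous[unfolded continuous_on_def, rule_format, of "- k" \<Lambda>] assms by (auto simp: G_iff)
  moreover have "LIM x at k within side (- 1). - x :> at (- k) within crhp - G"
    unfolding filterlim_at by (auto simp: eventually_at_filter side_def G_iff intro!: tendsto_intros)
  ultimately have "((\<lambda>x. m_right \<Lambda> (- x)) \<longlongrightarrow> m_right \<Lambda> (- k)) (at k within side (- 1))"
    by (rule filterlim_compose)
  moreover have "isCont swap2 (m_right \<Lambda> (- k))"
    using swap2_continuous[of UNIV] by (simp add: continuous_on_eq_continuous_at)
  ultimately have "((\<lambda>x. swap2 (m_right \<Lambda> (- x))) \<longlongrightarrow> swap2 (m_right \<Lambda> (- k))) (at k within side (- 1))"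
    by (intro isCont_tendsto_compose[of _ swap2])
  then show ?thesis
    by (rule Lim_transform_eventually)
      (auto simp: eventually_at_filter side_def m_mod_eq_swap_mp not_contour_iff)
qed

lemma m_mod_boundary_values:
  assumes "Re k = 0" "k \<notin> G"
  shows "boundary_plus (m_mod a c \<Lambda>) k = m_right \<Lambda> k" "boundary_minus (m_mod a c \<Lambda>) k = swap2 (m_right \<Lambda> (- k))"
  using boundary_value_eqI[OF _ assms(1) m_mod_tendsto_plus[OF assms]]
    boundary_value_eqI[OF _ assms(1) m_mod_tendsto_minus[OF assms]] by auto

text \<open>
  The values at conjugate points are related by \<open>AR_cnj\<close>, and the real part is 0 on the upper cut.
  Since \<open>1/2 - AR (- k)\<close> is the boundary value from the left, the Abel map changes sign across the cut.
\<close>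

lemma AR_upper_shift:
  assumes "a \<le> y" "y \<le> c"
  shows "AR (- (\<i> * y)) = AR (\<i> * y) + 1/2"
  using AR_cnj[of "\<i> * y"] Re_AR_upper[OF assms] by (simp add: complex_eq_iff)

text \<open>
  Between the cuts the imaginary part of \<open>AR\<close> is constantly \<open>- T / 2\<close>; adding \<open>\<tau>\<close> changes its sign.
  So the boundary value \<open>1/2 - AR (- k)\<close> from the left exceeds the one from the right by \<open>\<tau>\<close>.
\<close>

lemma AR_middle_shift:
  assumes "\<bar>y\<bar> \<le> a"
  shows "AR (- (\<i> * y)) = 1/2 - (AR (\<i> * y) + tau a c)"
  using AR_cnj[of "\<i> * y"] Im_AR_middle[OF assms] by (simp add: complex_eq_iff tau_eq)

text \<open>
  On the cuts the Abel map changes sign, which exchanges the two components, and \<open>gammaR\<close> contributes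
  the factor \<open>\<plusminus> \<i>\<close>. Between the cuts \<open>gammaR\<close> does not jump, and the jump of the Abel map by \<open>\<tau>\<close>
  multiplies the components by the exponential factors.
\<close>

lemma m_mod_jump:
  assumes "k \<in> contour c" "k \<notin> G"
  shows "boundary_plus (m_mod a c \<Lambda>) k = boundary_minus (m_mod a c \<Lambda>) k v* v_mod a c \<Lambda> k"
proof -
  define y where "y = Im k"
  have k: "Re k = 0" "\<bar>y\<bar> \<le> c" using assms by (auto simp: contour_iff[OF c_pos] y_def)
  then have ky: "k = \<i> * y" "k = Complex 0 y" by (auto simp: y_def complex_eq_iff)
  have y: "\<bar>y\<bar> \<noteq> a" "\<bar>y\<bar> \<noteq> c" using assms(2) k by (auto simp: G_iff y_def)
  let ?e = "E_s a c \<Lambda> (1/4)"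
  have mpc: "m_right \<Lambda> z $ 1 = gammaR z / ?e * E_s a c \<Lambda> (AR z)" "m_right \<Lambda> z $ 2 = gammaR z / ?e * E_s a c \<Lambda> (- AR z)" for z
    by (simp_all add: m_right_def)
  have Emh: "E_s a c \<Lambda> (- (z + 1/2)) = E_s a c \<Lambda> (- z)" for z
    using E_s_plus_half[of \<Lambda> "- (z + 1/2)"] by (simp add: algebra_simps)
  consider "a < y" | "y < - a" | "\<bar>y\<bar> < a" using y by linarith
  then have "m_right \<Lambda> k = swap2 (m_right \<Lambda> (- k)) v* v_mod a c \<Lambda> (Complex 0 y)"
  proof cases
    case 1
    then have yc: "a \<le> y" "y \<le> c" "y < c" using k y by auto
    show ?thesis
      by (rule vec2_eqI)
        (simp_all add: v_mod_upper[OF yc(1,2)] swap2_component mpc ky(1) gammaR_upper[OF 1 yc(3)]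
          AR_upper_shift[OF yc(1,2)] E_s_plus_half Emh del: minus_add_distrib)
  next
    case 2
    then have yc: "- c \<le> y" "y \<le> - a" "a \<le> - y" "- y \<le> c" "a < - y" "- y < c" using k y by auto
    have "gammaR (\<i> * y) = - \<i> * gammaR (- (\<i> * y))"
      using gammaR_upper[OF yc(5,6)] by simp
    moreover have "AR (\<i> * y) = AR (- (\<i> * y)) + 1/2"
      using AR_upper_shift[OF yc(3,4)] by simp
    ultimately show ?thesis
      by (intro vec2_eqI)
        (simp_all add: v_mod_lower[OF yc(1,2)] swap2_component mpc ky(1) E_s_plus_half Emh del: minus_add_distrib)
  next
    case 3
    have AR: "AR (- (\<i> * y)) = 1/2 - (AR (\<i> * y) + tau a c)"
      using 3 by (intro AR_middle_shift) auto
    have E1: "E_s a c \<Lambda> (AR (- (\<i> * y))) = E_s a c \<Lambda> (- (AR (\<i> * y) + tau a c))"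
      "E_s a c \<Lambda> (- AR (- (\<i> * y))) = exp (2 * pi * \<i> * \<Lambda>) * E_s a c \<Lambda> (AR (\<i> * y))"
      unfolding AR E_s_half_minus E_s_plus_tau by simp_all
    have E2: "E_s a c \<Lambda> (- AR (\<i> * y)) = exp (2 * pi * \<i> * \<Lambda>) * E_s a c \<Lambda> (- (AR (\<i> * y) + tau a c))"
      using E_s_plus_tau[of \<Lambda> "- (AR (\<i> * y) + tau a c)"] by simp
    have ex: "exp (- 2 * pi * \<i> * \<Lambda>) * exp (2 * pi * \<i> * \<Lambda>) = 1" by (simp flip: exp_add)
    show ?thesis
    proof (rule vec2_eqI)
      have "(swap2 (m_right \<Lambda> (- k)) v* v_mod a c \<Lambda> (Complex 0 y)) $ 1
          = (exp (- 2 * pi * \<i> * \<Lambda>) * exp (2 * pi * \<i> * \<Lambda>)) * (gammaR (\<i> * y) / ?e * E_s a c \<Lambda> (AR (\<i> * y)))"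
        unfolding v_mod_middle[OF 3] swap2_component mpc ky(1) gammaR_middle[OF 3] E1 by (simp add: mult_ac)
      then show "m_right \<Lambda> k $ 1 = (swap2 (m_right \<Lambda> (- k)) v* v_mod a c \<Lambda> (Complex 0 y)) $ 1"
        unfolding ex mpc ky(1) by simp
      show "m_right \<Lambda> k $ 2 = (swap2 (m_right \<Lambda> (- k)) v* v_mod a c \<Lambda> (Complex 0 y)) $ 2"
        unfolding v_mod_middle[OF 3] swap2_component mpc ky(1) gammaR_middle[OF 3] E1 E2 by (simp add: mult_ac)
    qed
  qed
  then show ?thesis
    unfolding m_mod_boundary_values[OF k(1) assms(2)] ky(2)[symmetric] by simp
qed

lemma m_mod_at_infinity: "(m_mod a c \<Lambda> \<longlongrightarrow> vector [1, 1]) at_infinity"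
proof -
  let ?e = "E_s a c \<Lambda> (1/4)"
  have g: "(gamma_tilde a c \<longlongrightarrow> 1) at_infinity"
  proof -
    have "((\<lambda>u. (1 + (complex_of_real a)\<^sup>2 * u\<^sup>2) / (1 + (complex_of_real c)\<^sup>2 * u\<^sup>2))
        \<longlongrightarrow> (1 + (complex_of_real a)\<^sup>2 * 0\<^sup>2) / (1 + (complex_of_real c)\<^sup>2 * 0\<^sup>2)) (at 0)"
      by (intro tendsto_intros) auto
    then have "((\<lambda>u. (1 + (complex_of_real a)\<^sup>2 * u\<^sup>2) / (1 + (complex_of_real c)\<^sup>2 * u\<^sup>2)) \<longlongrightarrow> 1) (at 0)"
      by simp
    then have "((\<lambda>u. cut_ratio a c (inverse u)) \<longlongrightarrow> 1) (at 0)"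
    proof (rule Lim_transform_eventually)
      have "(1 + (complex_of_real a)\<^sup>2 * u\<^sup>2) / (1 + (complex_of_real c)\<^sup>2 * u\<^sup>2) = cut_ratio a c (inverse u)"
        if "u \<noteq> 0" for u
      proof -
        have *: "1 + (complex_of_real s)\<^sup>2 * u\<^sup>2 = u\<^sup>2 * ((inverse u)\<^sup>2 + (complex_of_real s)\<^sup>2)" for s
          using that by (simp add: field_simps)
        show ?thesis unfolding * cut_ratio_def using that by simp
      qed
      then show "\<forall>\<^sub>F u in at 0. (1 + (complex_of_real a)\<^sup>2 * u\<^sup>2) / (1 + (complex_of_real c)\<^sup>2 * u\<^sup>2) = cut_ratio a c (inverse u)"
        by (simp add: eventually_at_filter)
    qed
    then have "(cut_ratio a c \<longlongrightarrow> 1) at_infinity" by (simp add: lim_at_infinity_0 o_def)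
    then have "((\<lambda>k. cut_ratio a c k powr (1/4)) \<longlongrightarrow> 1 powr (1/4)) at_infinity"
      by (intro tendsto_powr_complex tendsto_const) auto
    then show ?thesis by (simp add: gamma_tilde_def[abs_def])
  qed
  have nz: "theta_prod (1/4) \<noteq> 0" using T_pos by (intro theta_prod_nonzero) auto
  have Dlim: "((\<lambda>k. theta_prod (f k)) \<longlongrightarrow> theta_prod z) at_infinity" if "(f \<longlongrightarrow> z) at_infinity" for f z
    using theta_prod_continuous[of UNIV] that
    by (intro isCont_tendsto_compose[of _ theta_prod]) (simp add: continuous_on_eq_continuous_at)
  have E: "((\<lambda>k. E_s a c \<Lambda> (Ab k)) \<longlongrightarrow> ?e) at_infinity"
    unfolding E_s_eq using nz by (intro tendsto_divide Dlim tendsto_intros Ab_at_infinity)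
  have "((\<lambda>k. E_s a c \<Lambda> (- Ab k)) \<longlongrightarrow> E_s a c \<Lambda> (- (1/4))) at_infinity"
    unfolding E_s_eq using nz by (intro tendsto_divide Dlim tendsto_intros Ab_at_infinity) (simp only: theta_prod_minus, simp)
  also have "E_s a c \<Lambda> (- (1/4)) = ?e"
    using E_s_plus_half[of \<Lambda> "- (1/4)"] by simp
  finally have E': "((\<lambda>k. E_s a c \<Lambda> (- Ab k)) \<longlongrightarrow> ?e) at_infinity" .
  have "((\<lambda>k. vector [gamma_tilde a c k / ?e * E_s a c \<Lambda> (Ab k), gamma_tilde a c k / ?e * E_s a c \<Lambda> (- Ab k)] :: complex ^ 2)
      \<longlongrightarrow> vector [1 / ?e * ?e, 1 / ?e * ?e]) at_infinity"
    using E_s_quarter_nonzero by (intro vec2_tendsto tendsto_intros g E E') auto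
  then have "((\<lambda>k. vector [gamma_tilde a c k / ?e * E_s a c \<Lambda> (Ab k), gamma_tilde a c k / ?e * E_s a c \<Lambda> (- Ab k)] :: complex ^ 2)
      \<longlongrightarrow> vector [1, 1]) at_infinity"
    using E_s_quarter_nonzero[of \<Lambda>] by simp
  then show ?thesis
  proof (rule Lim_transform_eventually)
    show "\<forall>\<^sub>F k in at_infinity. vector [gamma_tilde a c k / ?e * E_s a c \<Lambda> (Ab k), gamma_tilde a c k / ?e * E_s a c \<Lambda> (- Ab k)]
        = m_mod a c \<Lambda> k"
      using eventually_not_contour by eventually_elim (intro vec2_eqI; simp add: m_mod_component)
  qed
qed

subsection \<open>Fourth root singularities\<close>

lemma eventually_norm_bounded:
  fixes h :: "complex \<Rightarrow> complex"
  assumes "continuous_on A h" "\<kappa> \<in> A" "A = B - F" "finite F"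
  shows "\<exists>K>0. \<forall>\<^sub>F k in at \<kappa> within B. norm (h k) \<le> K"
proof -
  have "(h \<longlongrightarrow> h \<kappa>) (at \<kappa> within A)" using assms(1,2) by (auto simp: continuous_on_def)
  then have "((\<lambda>k. norm (h k)) \<longlongrightarrow> norm (h \<kappa>)) (at \<kappa> within A)" by (rule tendsto_norm)
  then have "\<forall>\<^sub>F k in at \<kappa> within A. norm (h k) < norm (h \<kappa>) + 1"
    by (rule order_tendstoD) simp
  moreover have "at \<kappa> within A = at \<kappa> within B"
  proof (rule at_within_nhd)
    show "\<kappa> \<in> - (F - {\<kappa>})" "open (- (F - {\<kappa>}))"
      using assms(4) by (blast, simp only: open_Compl finite_imp_closed finite_Diff)
    show "A \<inter> - (F - {\<kappa>}) - {\<kappa>} = B \<inter> - (F - {\<kappa>}) - {\<kappa>}" using assms(3) by auto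
  qed
  ultimately show ?thesis
    by (intro exI[of _ "norm (h \<kappa>) + 1"]) (auto elim: eventually_mono intro: add_nonneg_pos)
qed

lemma gammaR_local_bound:
  assumes "\<kappa> \<in> G"
  shows "\<exists>K>0. \<forall>\<^sub>F k in at \<kappa> within crhp. norm (gammaR k) \<le>
    (if \<bar>Im \<kappa>\<bar> = a then K * sqrt (sqrt (norm (k - \<kappa>))) else K / sqrt (sqrt (norm (k - \<kappa>))))"
proof -
  note qc = fourth_root_continuous[OF G_members(1)] fourth_root_continuous[OF G_members(2)] fourth_root_continuous[OF G_members(3)] fourth_root_continuous[OF G_members(4)]
  have crhp: "0 \<le> Re \<kappa>" using Re_G[OF assms] by simp
  have ia: "\<i> * complex_of_real a \<noteq> \<i> * c" "\<i> * complex_of_real a \<noteq> - \<i> * c" "\<i> * complex_of_real a \<noteq> - \<i> * a"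
    "- \<i> * complex_of_real a \<noteq> \<i> * c" "- \<i> * complex_of_real a \<noteq> - \<i> * c" "\<i> * complex_of_real c \<noteq> - \<i> * c"
    using ac by (auto simp: complex_eq_iff)
  consider "\<kappa> = \<i> * a" | "\<kappa> = - \<i> * a" | "\<kappa> = \<i> * c" | "\<kappa> = - \<i> * c"
    using assms by (auto simp: exceptional_points_def)
  then show ?thesis
  proof cases
    case 1
    define h where "h k = fourth_root (- \<i> * a) k / (fourth_root (\<i> * c) k * fourth_root (- \<i> * c) k)" for k
    have "continuous_on (crhp - {\<i> * c, - \<i> * c}) h"
      unfolding h_def[abs_def]
      by (intro continuous_on_divide continuous_on_mult continuous_on_subset[OF qc(2)]
          continuous_on_subset[OF qc(3)] continuous_on_subset[OF qc(4)]) (auto simp: fourth_root_eq_0_iff)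
    from eventually_norm_bounded[OF this, of \<kappa> crhp "{\<i> * c, - \<i> * c}"] 1 ia
    obtain K where K: "K > 0" "\<forall>\<^sub>F k in at \<kappa> within crhp. norm (h k) \<le> K" by auto
    have "norm (gammaR k) = sqrt (sqrt (norm (k - \<kappa>))) * norm (h k)" for k
      unfolding gammaR_fourth_root h_def using 1 by (simp add: norm_mult norm_divide norm_fourth_root)
    then show ?thesis
      using K 1 ac by (intro exI[of _ K]) (auto elim!: eventually_mono simp: mult.commute intro!: mult_right_mono)
  next
    case 2
    define h where "h k = fourth_root (\<i> * a) k / (fourth_root (\<i> * c) k * fourth_root (- \<i> * c) k)" for k
    have "continuous_on (crhp - {\<i> * c, - \<i> * c}) h"
      unfolding h_def[abs_def]
      by (intro continuous_on_divide continuous_on_mult continuous_on_subset[OF qc(1)]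
          continuous_on_subset[OF qc(3)] continuous_on_subset[OF qc(4)]) (auto simp: fourth_root_eq_0_iff)
    from eventually_norm_bounded[OF this, of \<kappa> crhp "{\<i> * c, - \<i> * c}"] 2 ia
    obtain K where K: "K > 0" "\<forall>\<^sub>F k in at \<kappa> within crhp. norm (h k) \<le> K" by auto
    have "norm (gammaR k) = sqrt (sqrt (norm (k - \<kappa>))) * norm (h k)" for k
      unfolding gammaR_fourth_root h_def using 2 by (simp add: norm_mult norm_divide norm_fourth_root)
    then show ?thesis
      using K 2 ac by (intro exI[of _ K]) (auto elim!: eventually_mono simp: mult.commute intro!: mult_right_mono)
  next
    case 3
    define h where "h k = fourth_root (\<i> * a) k * fourth_root (- \<i> * a) k / fourth_root (- \<i> * c) k" for k
    have "continuous_on (crhp - {- \<i> * c}) h"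
      unfolding h_def[abs_def]
      by (intro continuous_on_divide continuous_on_mult continuous_on_subset[OF qc(1)]
          continuous_on_subset[OF qc(2)] continuous_on_subset[OF qc(4)]) (auto simp: fourth_root_eq_0_iff)
    from eventually_norm_bounded[OF this, of \<kappa> crhp "{- \<i> * c}"] 3 ia
    obtain K where K: "K > 0" "\<forall>\<^sub>F k in at \<kappa> within crhp. norm (h k) \<le> K" by auto
    have "norm (gammaR k) = norm (h k) / sqrt (sqrt (norm (k - \<kappa>)))" for k
      unfolding gammaR_fourth_root h_def using 3 by (simp add: norm_mult norm_divide norm_fourth_root)
    then show ?thesis
      using K 3 ac by (intro exI[of _ K]) (auto elim!: eventually_mono intro!: divide_right_mono)
  next
    case 4
    define h where "h k = fourth_root (\<i> * a) k * fourth_root (- \<i> * a) k / fourth_root (\<i> * c) k" for k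
    have "continuous_on (crhp - {\<i> * c}) h"
      unfolding h_def[abs_def]
      by (intro continuous_on_divide continuous_on_mult continuous_on_subset[OF qc(1)]
          continuous_on_subset[OF qc(2)] continuous_on_subset[OF qc(3)]) (auto simp: fourth_root_eq_0_iff)
    from eventually_norm_bounded[OF this, of \<kappa> crhp "{\<i> * c}"] 4 ia
    obtain K where K: "K > 0" "\<forall>\<^sub>F k in at \<kappa> within crhp. norm (h k) \<le> K" by auto
    have "norm (gammaR k) = norm (h k) / sqrt (sqrt (norm (k - \<kappa>)))" for k
      unfolding gammaR_fourth_root h_def using 4 by (simp add: norm_mult norm_divide norm_fourth_root mult.commute)
    then show ?thesis
      using K 4 ac by (intro exI[of _ K]) (auto elim!: eventually_mono intro!: divide_right_mono)
  qed
qed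

lemma AR_ia: "AR (\<i> * a) = - tau a c / 2" "AR (- \<i> * a) = 1/2 - tau a c / 2"
proof -
  show "AR (\<i> * a) = - tau a c / 2"
    using Re_AR_upper[of a] Im_AR_middle[of a] ac by (simp add: complex_eq_iff tau_eq)
  then show "AR (- \<i> * a) = 1/2 - tau a c / 2"
    using AR_upper_shift[of a] ac by simp
qed

text \<open>
  Near \<open>\<i>a\<close> and \<open>- \<i>a\<close> the denominator of \<open>E_s\<close> is at least a multiple of the distance of \<open>AR\<close> to a simple
  zero, which in turn is at least a multiple of the square root of the distance to the branch point.
\<close>

lemma E_s_local_bound:
  assumes \<kappa>: "\<kappa> \<in> G" and s: "s = 1 \<or> s = (- 1 :: complex)"
  shows "\<exists>K>0. \<forall>\<^sub>F k in at \<kappa> within crhp. norm (E_s a c \<Lambda> (s * AR k)) \<le>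
    (if \<bar>Im \<kappa>\<bar> = a then K / sqrt (norm (k - \<kappa>)) else K)"
proof (cases "\<bar>Im \<kappa>\<bar> = a")
  case True
  have crhp: "\<kappa> \<in> crhp" using Re_G[OF \<kappa>] by simp
  have "continuous_on crhp (\<lambda>k. theta_prod (s * AR k - of_real \<Lambda> / 2))"
    by (rule continuous_on_compose2[OF theta_prod_continuous[of UNIV]])
      (auto intro!: continuous_intros AR_continuous)
  from eventually_norm_bounded[OF this crhp, of crhp "{}"]
  obtain B where B: "B > 0" "\<forall>\<^sub>F k in at \<kappa> within crhp. norm (theta_prod (s * AR k - of_real \<Lambda> / 2)) \<le> B"
    by auto
  obtain C r where C: "C > 0" "r > 0"
    "\<And>z z0. norm (z - z0) < r \<Longrightarrow> z0 = - tau a c / 2 \<or> z0 = 1/2 - tau a c / 2 \<Longrightarrow> C * norm (z - z0) \<le> norm (theta_prod z)"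
    by (rule theta_prod_lower_bound) blast
  obtain C' r' where C': "C' > 0" "r' > 0"
    "\<And>k. 0 \<le> Re k \<Longrightarrow> norm (k - \<kappa>) < r' \<Longrightarrow> C' * sqrt (norm (k - \<kappa>)) \<le> norm (AR k - AR \<kappa>)"
    by (rule AR_sqrt_lower_bound[OF \<kappa>]) blast
  have "\<kappa> = \<i> * a \<or> \<kappa> = - \<i> * a"
    using True Re_G[OF \<kappa>] by (auto simp: complex_eq_iff abs_if split: if_splits)
  then have AR\<kappa>: "AR \<kappa> = - tau a c / 2 \<or> AR \<kappa> = 1/2 - tau a c / 2" using AR_ia by auto
  have "(AR \<longlongrightarrow> AR \<kappa>) (at \<kappa> within crhp)" using AR_continuous crhp by (auto simp: continuous_on_def)
  then have e1: "\<forall>\<^sub>F k in at \<kappa> within crhp. dist (AR k) (AR \<kappa>) < r" using C(2) by (rule tendstoD)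
  have e2: "\<forall>\<^sub>F k in at \<kappa> within crhp. k \<in> crhp \<and> k \<noteq> \<kappa> \<and> norm (k - \<kappa>) < r'"
    unfolding eventually_at using C'(2) by (intro exI[of _ r']) (auto simp: dist_norm)
  have "\<forall>\<^sub>F k in at \<kappa> within crhp. norm (E_s a c \<Lambda> (s * AR k)) \<le> B / (C * C') / sqrt (norm (k - \<kappa>))"
    using B(2) e1 e2
  proof eventually_elim
    case (elim k)
    have "C * (C' * sqrt (norm (k - \<kappa>))) \<le> C * norm (AR k - AR \<kappa>)"
      using C'(3)[of k] elim C by (intro mult_left_mono) auto
    also have "\<dots> \<le> norm (theta_prod (AR k))"
      using elim AR\<kappa> by (intro C(3)) (auto simp: dist_norm)
    finally have "C * C' * sqrt (norm (k - \<kappa>)) \<le> norm (theta_prod (s * AR k))"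
      using s by (auto simp: theta_prod_minus mult.assoc)
    moreover have "0 < C * C' * sqrt (norm (k - \<kappa>))" using C C' elim by auto
    ultimately have "norm (E_s a c \<Lambda> (s * AR k)) \<le> B / (C * C' * sqrt (norm (k - \<kappa>)))"
      unfolding E_s_eq norm_divide using elim(1) B(1) by (intro frac_le) auto
    then show ?case by simp
  qed
  then show ?thesis using True B(1) C(1) C'(1) by (intro exI[of _ "B / (C * C')"]) auto
next
  case False
  have "continuous_on (crhp - {\<i> * a, - \<i> * a}) (\<lambda>k. E_s a c \<Lambda> (s * AR k))"
    using s E_s_AR_continuous[of \<Lambda>] by auto
  moreover have "\<kappa> \<in> crhp - {\<i> * a, - \<i> * a}" using False Re_G[OF \<kappa>] a_pos by auto
  ultimately obtain K where "K > 0" "\<forall>\<^sub>F k in at \<kappa> within crhp. norm (E_s a c \<Lambda> (s * AR k)) \<le> K"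
    using eventually_norm_bounded[of "crhp - {\<i> * a, - \<i> * a}" "\<lambda>k. E_s a c \<Lambda> (s * AR k)" \<kappa> crhp "{\<i> * a, - \<i> * a}"]
    by auto
  then show ?thesis using False by auto
qed

text \<open>
  At \<open>\<i>a\<close> and \<open>- \<i>a\<close> the exponents add up to \<open>1/4 - 1/2 = - 1/4\<close>, at \<open>\<i>c\<close> and \<open>- \<i>c\<close> to \<open>- 1/4 + 0\<close>.
\<close>

lemma m_right_local_bound:
  assumes \<kappa>: "\<kappa> \<in> G"
  shows "\<exists>K>0. \<forall>\<^sub>F k in at \<kappa> within crhp. norm (m_right \<Lambda> k) \<le> K / sqrt (sqrt (norm (k - \<kappa>)))"
proof -
  define e where "e = norm (E_s a c \<Lambda> (1/4))"
  have e: "e > 0" using E_s_quarter_nonzero by (simp add: e_def)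
  have component: "\<exists>K>0. \<forall>\<^sub>F k in at \<kappa> within crhp.
      norm (gammaR k / E_s a c \<Lambda> (1/4) * E_s a c \<Lambda> (s * AR k)) \<le> K / sqrt (sqrt (norm (k - \<kappa>)))"
    if s: "s = 1 \<or> s = (- 1 :: complex)" for s
  proof -
    obtain K1 where K1: "K1 > 0" "\<forall>\<^sub>F k in at \<kappa> within crhp. norm (gammaR k) \<le>
      (if \<bar>Im \<kappa>\<bar> = a then K1 * sqrt (sqrt (norm (k - \<kappa>))) else K1 / sqrt (sqrt (norm (k - \<kappa>))))"
      using gammaR_local_bound[OF \<kappa>] by blast
    obtain K2 where K2: "K2 > 0" "\<forall>\<^sub>F k in at \<kappa> within crhp. norm (E_s a c \<Lambda> (s * AR k)) \<le>
      (if \<bar>Im \<kappa>\<bar> = a then K2 / sqrt (norm (k - \<kappa>)) else K2)"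
      using E_s_local_bound[OF \<kappa> s] by blast
    have ne: "\<forall>\<^sub>F k in at \<kappa> within crhp. k \<noteq> \<kappa>" by (simp add: eventually_at_filter)
    have "\<forall>\<^sub>F k in at \<kappa> within crhp. norm (gammaR k / E_s a c \<Lambda> (1/4) * E_s a c \<Lambda> (s * AR k))
        \<le> K1 / e * K2 / sqrt (sqrt (norm (k - \<kappa>)))"
      using K1(2) K2(2) ne
    proof eventually_elim
      case (elim k)
      define \<rho> where "\<rho> = sqrt (sqrt (norm (k - \<kappa>)))"
      have \<rho>: "\<rho> > 0" "sqrt (norm (k - \<kappa>)) = \<rho> * \<rho>" using elim(3) by (auto simp: \<rho>_def)
      have "norm (gammaR k) * norm (E_s a c \<Lambda> (s * AR k)) \<le> K1 * K2 / \<rho>"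
      proof (cases "\<bar>Im \<kappa>\<bar> = a")
        case True
        have "norm (gammaR k) \<le> K1 * \<rho>" using elim(1) True by (simp add: \<rho>_def)
        moreover have "norm (E_s a c \<Lambda> (s * AR k)) \<le> K2 / (\<rho> * \<rho>)"
          using elim(2) True unfolding \<rho>(2)[symmetric] by simp
        ultimately have "norm (gammaR k) * norm (E_s a c \<Lambda> (s * AR k)) \<le> (K1 * \<rho>) * (K2 / (\<rho> * \<rho>))"
          using K1(1) \<rho>(1) by (intro mult_mono) auto
        then show ?thesis using \<rho>(1) by simp
      next
        case False
        have "norm (gammaR k) \<le> K1 / \<rho>" "norm (E_s a c \<Lambda> (s * AR k)) \<le> K2"
          using elim(1,2) False by (simp_all add: \<rho>_def)
        then have "norm (gammaR k) * norm (E_s a c \<Lambda> (s * AR k)) \<le> (K1 / \<rho>) * K2"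
          using K1(1) \<rho>(1) by (intro mult_mono) auto
        then show ?thesis by simp
      qed
      then have "norm (gammaR k) * norm (E_s a c \<Lambda> (s * AR k)) / e \<le> (K1 * K2 / \<rho>) / e"
        using e by (intro divide_right_mono) auto
      then show ?case by (simp add: norm_mult norm_divide e_def \<rho>_def mult.commute)
    qed
    then show ?thesis using K1(1) K2(1) e by (intro exI[of _ "K1 / e * K2"]) auto
  qed
  obtain K1 where K1: "K1 > 0" "\<forall>\<^sub>F k in at \<kappa> within crhp.
      norm (gammaR k / E_s a c \<Lambda> (1/4) * E_s a c \<Lambda> (1 * AR k)) \<le> K1 / sqrt (sqrt (norm (k - \<kappa>)))"
    using component[of 1] by auto
  obtain K2 where K2: "K2 > 0" "\<forall>\<^sub>F k in at \<kappa> within crhp.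
      norm (gammaR k / E_s a c \<Lambda> (1/4) * E_s a c \<Lambda> (- 1 * AR k)) \<le> K2 / sqrt (sqrt (norm (k - \<kappa>)))"
    using component[of "- 1"] by auto
  have "\<forall>\<^sub>F k in at \<kappa> within crhp. norm (m_right \<Lambda> k) \<le> (K1 + K2) / sqrt (sqrt (norm (k - \<kappa>)))"
    using K1(2) K2(2)
  proof eventually_elim
    case (elim k)
    then show ?case using norm_vec2_le[of "m_right \<Lambda> k"] by (simp add: m_right_def add_divide_distrib)
  qed
  then show ?thesis using K1(1) K2(1) by (intro exI[of _ "K1 + K2"]) auto
qed

lemma G_minus: "\<kappa> \<in> G \<Longrightarrow> - \<kappa> \<in> G"
  by (auto simp: exceptional_points_def)

lemma m_mod_fourth_root:
  assumes \<kappa>: "\<kappa> \<in> G"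
  shows "(\<lambda>k. norm (m_mod a c \<Lambda> k)) \<in> O[at \<kappa> within - contour c](\<lambda>k. norm (k - \<kappa>) powr (- 1/4))"
proof -
  have pw: "x powr (- 1/4) = 1 / sqrt (sqrt x)" if "x \<ge> 0" for x
    using that by (simp add: powr_half_sqrt[symmetric] powr_powr powr_minus_divide)
  obtain K1 where K1: "K1 > 0" "\<forall>\<^sub>F k in at \<kappa> within crhp. norm (m_right \<Lambda> k) \<le> K1 / sqrt (sqrt (norm (k - \<kappa>)))"
    using m_right_local_bound[OF \<kappa>] by blast
  obtain K2 where K2: "K2 > 0" "\<forall>\<^sub>F k in at (- \<kappa>) within crhp. norm (m_right \<Lambda> k) \<le> K2 / sqrt (sqrt (norm (k - - \<kappa>)))"
    using m_right_local_bound[OF G_minus[OF \<kappa>]] by blast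
  obtain d1 where d1: "d1 > 0" "\<And>k. k \<in> crhp \<Longrightarrow> k \<noteq> \<kappa> \<Longrightarrow> dist k \<kappa> < d1 \<Longrightarrow> norm (m_right \<Lambda> k) \<le> K1 / sqrt (sqrt (norm (k - \<kappa>)))"
    using K1(2) unfolding eventually_at by blast
  obtain d2 where d2: "d2 > 0" "\<And>k. k \<in> crhp \<Longrightarrow> k \<noteq> - \<kappa> \<Longrightarrow> dist k (- \<kappa>) < d2 \<Longrightarrow> norm (m_right \<Lambda> k) \<le> K2 / sqrt (sqrt (norm (k - - \<kappa>)))"
    using K2(2) unfolding eventually_at by blast
  have bound: "norm (m_mod a c \<Lambda> k) \<le> max K1 K2 * (norm (k - \<kappa>) powr (- 1/4))"
    if k: "k \<notin> contour c" "k \<noteq> \<kappa>" "dist k \<kappa> < min d1 d2" for k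
  proof -
    define \<rho> where "\<rho> = sqrt (sqrt (norm (k - \<kappa>)))"
    have \<rho>: "\<rho> > 0" using k by (simp add: \<rho>_def)
    have "norm (m_mod a c \<Lambda> k) \<le> max K1 K2 / \<rho>"
    proof (cases "0 \<le> Re k")
      case True
      then have "norm (m_mod a c \<Lambda> k) \<le> K1 / \<rho>"
        using d1(2)[of k] k m_mod_eq_mp[of k \<Lambda>] by (simp add: \<rho>_def)
      also have "\<dots> \<le> max K1 K2 / \<rho>" using \<rho> by (intro divide_right_mono) auto
      finally show ?thesis .
    next
      case False
      have "- k - - \<kappa> = - (k - \<kappa>)" by simp
      then have n: "norm (- k - - \<kappa>) = norm (k - \<kappa>)" by (simp only: norm_minus_cancel)
      then have "norm (m_right \<Lambda> (- k)) \<le> K2 / \<rho>"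
        using d2(2)[of "- k"] k False by (simp add: \<rho>_def dist_norm)
      moreover have "norm (m_mod a c \<Lambda> k) = norm (m_right \<Lambda> (- k))"
        using m_mod_eq_swap_mp[of k \<Lambda>] False k by (simp add: norm_swap2)
      moreover have "K2 / \<rho> \<le> max K1 K2 / \<rho>" using \<rho> by (intro divide_right_mono) auto
      ultimately show ?thesis by linarith
    qed
    then show ?thesis unfolding \<rho>_def pw[OF norm_ge_zero] by simp
  qed
  have "\<forall>\<^sub>F k in at \<kappa> within - contour c. norm (m_mod a c \<Lambda> k) \<le> max K1 K2 * (norm (k - \<kappa>) powr (- 1/4))"
    unfolding eventually_at using d1(1) d2(1) bound by (intro exI[of _ "min d1 d2"]) auto
  then show ?thesis by (intro bigoI[of _ "max K1 K2"]) simp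
qed

text \<open>
  The local bounds hold in discs around the branch points, and the rest of the rectangle is compact.
\<close>

lemma m_right_bounded_by_singularities:
  assumes "0 < R"
  obtains K where "\<And>k. 0 \<le> Re k \<Longrightarrow> Re k \<le> 1 \<Longrightarrow> \<bar>Im k\<bar> \<le> R \<Longrightarrow> k \<notin> G \<Longrightarrow>
    norm (m_right \<Lambda> k) \<le> K * (1 + (\<Sum>\<kappa>\<in>G. 1 / sqrt (sqrt (norm (k - \<kappa>)))))" "K \<ge> 0"
proof -
  have "\<forall>\<kappa>\<in>G. \<exists>K d. K > 0 \<and> d > 0 \<and> (\<forall>k\<in>crhp. k \<noteq> \<kappa> \<longrightarrow> dist k \<kappa> < d \<longrightarrow>
      norm (m_right \<Lambda> k) \<le> K / sqrt (sqrt (norm (k - \<kappa>))))"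
  proof
    fix \<kappa> assume "\<kappa> \<in> G"
    from m_right_local_bound[OF this, of \<Lambda>]
    show "\<exists>K d. K > 0 \<and> d > 0 \<and> (\<forall>k\<in>crhp. k \<noteq> \<kappa> \<longrightarrow> dist k \<kappa> < d \<longrightarrow>
      norm (m_right \<Lambda> k) \<le> K / sqrt (sqrt (norm (k - \<kappa>))))"
      unfolding eventually_at by blast
  qed
  then obtain K d where Kd: "\<And>\<kappa>. \<kappa> \<in> G \<Longrightarrow> K \<kappa> > 0 \<and> d \<kappa> > 0 \<and> (\<forall>k\<in>crhp. k \<noteq> \<kappa> \<longrightarrow> dist k \<kappa> < d \<kappa> \<longrightarrow>
      norm (m_right \<Lambda> k) \<le> K \<kappa> / sqrt (sqrt (norm (k - \<kappa>))))"
    by metis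
  define Q where "Q = cbox (Complex 0 (- R)) (Complex 1 R) - (\<Union>\<kappa>\<in>G. ball \<kappa> (d \<kappa>))"
  have "compact Q" unfolding Q_def by (intro compact_diff compact_cbox open_UN) auto
  moreover have "Q \<subseteq> crhp - G"
    using Kd by (auto simp: Q_def in_cbox_complex_iff)
  then have "continuous_on Q (m_right \<Lambda>)" by (rule continuous_on_subset[OF m_right_continuous])
  ultimately obtain B where B: "\<And>k. k \<in> Q \<Longrightarrow> norm (m_right \<Lambda> k) \<le> B"
    using compact_imp_bounded[OF compact_continuous_image] by (force simp: bounded_iff)
  define C where "C = \<bar>B\<bar> + (\<Sum>\<kappa>\<in>G. K \<kappa>)"
  have Ks: "0 \<le> (\<Sum>\<kappa>\<in>G. K \<kappa>)" using Kd by (intro sum_nonneg) (auto simp: less_imp_le)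
  have C: "C \<ge> 0" "B \<le> C" using Ks by (auto simp: C_def)
  have KC: "K \<kappa> \<le> C" if "\<kappa> \<in> G" for \<kappa>
    using member_le_sum[OF that _ finite_G, of K] Kd by (auto simp: C_def less_imp_le)
  show thesis
  proof (rule that[OF _ C(1)])
    fix k assume k: "0 \<le> Re k" "Re k \<le> 1" "\<bar>Im k\<bar> \<le> R" "k \<notin> G"
    let ?f = "\<lambda>\<kappa>. 1 / sqrt (sqrt (norm (k - \<kappa>)))"
    have nn: "0 \<le> (\<Sum>\<kappa>\<in>G. ?f \<kappa>)" by (intro sum_nonneg) auto
    show "norm (m_right \<Lambda> k) \<le> C * (1 + (\<Sum>\<kappa>\<in>G. ?f \<kappa>))"
    proof (cases "k \<in> Q")
      case True
      then have "norm (m_right \<Lambda> k) \<le> C * 1" using B[OF True] C by simp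
      also have "\<dots> \<le> C * (1 + (\<Sum>\<kappa>\<in>G. ?f \<kappa>))" using C nn by (intro mult_left_mono) auto
      finally show ?thesis .
    next
      case False
      then obtain \<kappa> where \<kappa>: "\<kappa> \<in> G" "dist k \<kappa> < d \<kappa>"
        using k by (auto simp: Q_def in_cbox_complex_iff dist_commute)
      then have "norm (m_right \<Lambda> k) \<le> K \<kappa> * ?f \<kappa>" using Kd[OF \<kappa>(1)] k by auto
      also have "\<dots> \<le> C * (1 + (\<Sum>\<kappa>\<in>G. ?f \<kappa>))"
      proof (rule mult_mono[OF KC[OF \<kappa>(1)] _ C(1)])
        have "?f \<kappa> \<le> (\<Sum>\<kappa>\<in>G. ?f \<kappa>)" by (rule member_le_sum[OF \<kappa>(1) _ finite_G]) auto
        then show "?f \<kappa> \<le> 1 + (\<Sum>\<kappa>\<in>G. ?f \<kappa>)" by simp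
      qed auto
      finally show ?thesis .
    qed
  qed
qed

text \<open>
  The square of a fourth root singularity is integrable along the axis, so the squares of the bounds of
  \<open>m_right_bounded_by_singularities\<close> give a dominating function independent of the distance to the axis.
\<close>

lemma m_mod_L2_boundary_values:
  assumes s: "s = 1 \<or> s = - 1" and R: "0 < R"
  shows "L2_boundary_values R s (m_mod a c \<Lambda>)"
proof -
  obtain K where K: "\<And>k. 0 \<le> Re k \<Longrightarrow> Re k \<le> 1 \<Longrightarrow> \<bar>Im k\<bar> \<le> R \<Longrightarrow> k \<notin> G \<Longrightarrow>
    norm (m_right \<Lambda> k) \<le> K * (1 + (\<Sum>\<kappa>\<in>G. 1 / sqrt (sqrt (norm (k - \<kappa>)))))" "K \<ge> 0"
    by (rule m_right_bounded_by_singularities[OF R, of \<Lambda>]) blast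
  define Z where "Z = {a, - a, c, - c}"
  define \<psi> where "\<psi> y = 5 * K\<^sup>2 * (1 + (\<Sum>t\<in>Z. 1 / sqrt \<bar>y - t\<bar>))" for y
  have ZG: "(\<Sum>\<kappa>\<in>G. g (Im \<kappa>)) = (\<Sum>t\<in>Z. g t)" for g :: "real \<Rightarrow> real"
    by (rule sum.reindex_bij_witness[of _ "\<lambda>t. \<i> * of_real t" Im])
      (use ac in \<open>auto simp: Z_def G_iff complex_eq_iff abs_if split: if_splits\<close>)
  have cardG: "card G = 4"
  proof -
    have "card G = (\<Sum>\<kappa>\<in>G. 1)" by simp
    also have "\<dots> = (\<Sum>t\<in>Z. 1)"
      by (rule sum.reindex_bij_witness[of _ "\<lambda>t. \<i> * of_real t" Im])
        (use ac in \<open>auto simp: Z_def G_iff complex_eq_iff abs_if split: if_splits\<close>)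
    also have "\<dots> = 4" using ac by (simp add: Z_def card_insert_if)
    finally show ?thesis .
  qed
  have even\<psi>: "\<psi> (- y) = \<psi> y" for y
  proof -
    have "(\<Sum>t\<in>Z. 1 / sqrt \<bar>- y - t\<bar>) = (\<Sum>t\<in>Z. 1 / sqrt \<bar>y - t\<bar>)"
      by (rule sum.reindex_bij_witness[of _ uminus uminus]) (auto simp: Z_def abs_minus_commute add.commute)
    then show ?thesis by (simp add: \<psi>_def)
  qed
  have mp2: "(norm (m_right \<Lambda> (Complex e y)))\<^sup>2 \<le> \<psi> y" if "0 < e" "e \<le> 1" "\<bar>y\<bar> \<le> R" "y \<notin> Z" for e y
  proof -
    let ?f = "\<lambda>\<kappa>. 1 / sqrt (sqrt (norm (Complex e y - \<kappa>)))"
    have "norm (m_right \<Lambda> (Complex e y)) \<le> K * (1 + (\<Sum>\<kappa>\<in>G. ?f \<kappa>))"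
      using that by (intro K) (auto simp: G_iff)
    then have "(norm (m_right \<Lambda> (Complex e y)))\<^sup>2 \<le> (K * (1 + (\<Sum>\<kappa>\<in>G. ?f \<kappa>)))\<^sup>2"
      by (intro power_mono) auto
    also have "\<dots> = K\<^sup>2 * (1 + (\<Sum>\<kappa>\<in>G. ?f \<kappa>))\<^sup>2" by (rule power_mult_distrib)
    \<comment> \<open>The Cauchy-Schwarz inequality for five summands.\<close>
    also have "(1 + (\<Sum>\<kappa>\<in>G. ?f \<kappa>))\<^sup>2 \<le> 5 * (1 + (\<Sum>\<kappa>\<in>G. (?f \<kappa>)\<^sup>2))"
    proof -
      have "(\<Sum>\<kappa>\<in>G. ?f \<kappa>)\<^sup>2 \<le> 4 * (\<Sum>\<kappa>\<in>G. (?f \<kappa>)\<^sup>2)"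
        using sum_squared_le_sum_of_squares[of ?f G] finite_G cardG by simp
      moreover have "4 * 2 * (\<Sum>\<kappa>\<in>G. ?f \<kappa>) \<le> 4 * 4 + (\<Sum>\<kappa>\<in>G. ?f \<kappa>)\<^sup>2"
        using sum_squares_bound[of 4 "(\<Sum>\<kappa>\<in>G. ?f \<kappa>)"] by (simp add: power2_eq_square)
      ultimately show ?thesis by (simp add: power2_sum)
    qed
    also have "(\<Sum>\<kappa>\<in>G. (?f \<kappa>)\<^sup>2) \<le> (\<Sum>\<kappa>\<in>G. 1 / sqrt \<bar>y - Im \<kappa>\<bar>)"
    proof (rule sum_mono)
      fix \<kappa> assume "\<kappa> \<in> G"
      then have "y - Im \<kappa> \<noteq> 0" using that by (auto simp: G_iff Z_def abs_if split: if_splits)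
      moreover have "\<bar>y - Im \<kappa>\<bar> \<le> norm (Complex e y - \<kappa>)"
        using abs_Im_le_cmod[of "Complex e y - \<kappa>"] by simp
      ultimately show "(?f \<kappa>)\<^sup>2 \<le> 1 / sqrt \<bar>y - Im \<kappa>\<bar>"
        by (simp add: power_divide frac_le)
    qed
    finally have "(norm (m_right \<Lambda> (Complex e y)))\<^sup>2 \<le>
        K\<^sup>2 * (5 * (1 + (\<Sum>\<kappa>\<in>G. 1 / sqrt \<bar>y - Im \<kappa>\<bar>)))"
      by (simp add: mult_left_mono)
    then show ?thesis
      by (simp add: \<psi>_def ZG[of "\<lambda>t. 1 / sqrt \<bar>y - t\<bar>"] algebra_simps)
  qed
  show ?thesis
  proof (rule L2_boundary_valuesI[OF s, of Z _ _ \<psi>])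
    show "finite Z" by (simp add: Z_def)
    show "\<exists>l. (m_mod a c \<Lambda> \<longlongrightarrow> l) (at (Complex 0 y) within side s)" if "y \<notin> Z" for y
    proof -
      have "Complex 0 y \<notin> G" using that by (auto simp: G_iff Z_def abs_if split: if_splits)
      then show ?thesis using m_mod_tendsto_plus[of "Complex 0 y"] m_mod_tendsto_minus[of "Complex 0 y"] s by auto
    qed
    show "(norm (m_mod a c \<Lambda> (Complex (s * e) y)))\<^sup>2 \<le> \<psi> y" if "0 < e" "e \<le> 1" "\<bar>y\<bar> \<le> R" "y \<notin> Z" for e y
    proof (cases "s = 1")
      case True
      then show ?thesis using mp2[OF that] that m_mod_eq_mp[of "Complex e y" \<Lambda>] by (simp add: not_contour_iff)
    next
      case False
      then have "Complex (s * e) y = - Complex e (- y)" using s by (simp add: complex_eq_iff)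
      moreover have "- y \<notin> Z" using that(4) by (auto simp: Z_def)
      ultimately show ?thesis
        using mp2[of e "- y"] that m_mod_eq_swap_mp[of "- Complex e (- y)" \<Lambda>]
        by (simp add: not_contour_iff norm_swap2 even\<psi>)
    qed
    show "continuous_on UNIV (\<lambda>y. m_mod a c \<Lambda> (Complex x y))" if "x \<noteq> 0" for x
    proof -
      have "continuous_on UNIV (\<lambda>y. m_mod a c \<Lambda> (Complex x y) $ j)" for j
        by (rule vertical_line_continuous[OF m_mod_holomorphic that])
      then show ?thesis unfolding continuous_on_def by (auto intro!: vec_tendstoI)
    qed
    show "\<psi> \<in> borel_measurable lebesgue"
      unfolding \<psi>_def[abs_def] by (intro measurable_completion) measurable
    have "(\<integral>\<^sup>+y\<in>{-R..R}. ennreal (\<psi> y) \<partial>lebesgue)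
        = (\<integral>\<^sup>+y. ennreal (5 * K\<^sup>2) * (indicator {-R..R} y + (\<Sum>t\<in>Z. ennreal (1 / sqrt \<bar>y - t\<bar>) * indicator {-R..R} y)) \<partial>lebesgue)"
    proof (intro nn_integral_cong)
      fix y
      have "ennreal (\<psi> y) = ennreal (5 * K\<^sup>2) * (1 + (\<Sum>t\<in>Z. ennreal (1 / sqrt \<bar>y - t\<bar>)))"
        unfolding \<psi>_def by (simp add: ennreal_mult sum_nonneg ennreal_plus sum_ennreal)
      then show "ennreal (\<psi> y) * indicator {-R..R} y
          = ennreal (5 * K\<^sup>2) * (indicator {-R..R} y + (\<Sum>t\<in>Z. ennreal (1 / sqrt \<bar>y - t\<bar>) * indicator {-R..R} y))"
        by (simp add: indicator_def)
    qed
    also have "\<dots> = ennreal (5 * K\<^sup>2) * ((\<integral>\<^sup>+y. indicator {-R..R} y \<partial>lebesgue)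
        + (\<Sum>t\<in>Z. \<integral>\<^sup>+y\<in>{-R..R}. ennreal (1 / sqrt \<bar>y - t\<bar>) \<partial>lebesgue))"
    proof -
      have [measurable]: "(\<lambda>y. ennreal (1 / sqrt \<bar>y - t\<bar>) * indicator {-R..R} y) \<in> borel_measurable lebesgue" for t
        by (intro measurable_completion) measurable
      have [measurable]: "(indicator {-R..R} :: real \<Rightarrow> ennreal) \<in> borel_measurable lebesgue"
        by (intro borel_measurable_indicator) simp
      show ?thesis
        by (subst nn_integral_cmult, simp, subst nn_integral_add, simp, simp, subst nn_integral_sum, simp, simp)
    qed
    also have "\<dots> < \<infinity>"
    proof -
      have "(\<Sum>t\<in>Z. \<integral>\<^sup>+y\<in>{-R..R}. ennreal (1 / sqrt \<bar>y - t\<bar>) \<partial>lebesgue) < \<infinity>"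
        using integrable_inverse_sqrt[of R] R by (simp add: Z_def)
      moreover have "(\<integral>\<^sup>+y. indicator {-R..R} y \<partial>lebesgue) < \<infinity>"
        using R by (subst nn_integral_indicator) auto
      ultimately show ?thesis by (simp add: ennreal_mult_less_top)
    qed
    finally show "(\<integral>\<^sup>+y\<in>{-R..R}. ennreal (\<psi> y) \<partial>lebesgue) < \<infinity>" .
  qed
qed

theorem m_mod_solution: "model_RHP_solution a c \<Lambda> (m_mod a c \<Lambda>)"
  unfolding model_RHP_solution_def
proof (intro conjI allI ballI)
  show "(\<lambda>k. m_mod a c \<Lambda> k $ j) holomorphic_on - contour c" for j by (rule m_mod_holomorphic)
  show "square_integrable_boundary_values c (m_mod a c \<Lambda>)"
    unfolding square_integrable_boundary_values_def
    using m_mod_L2_boundary_values c_pos by (intro exI[of _ "c + 1"]) auto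
  have "AE y in lebesgue. y \<notin> Im ` G"
    using finite_G by (intro AE_not_in) (simp add: finite_imp_null_set_lborel null_sets_completionI)
  then show "AE y in lebesgue. \<bar>y\<bar> \<le> c \<longrightarrow> boundary_plus (m_mod a c \<Lambda>) (Complex 0 y) =
      boundary_minus (m_mod a c \<Lambda>) (Complex 0 y) v* v_mod a c \<Lambda> (Complex 0 y)"
  proof (rule eventually_mono)
    fix y assume "y \<notin> Im ` G"
    then have "Complex 0 y \<notin> G" by force
    then show "\<bar>y\<bar> \<le> c \<longrightarrow> boundary_plus (m_mod a c \<Lambda>) (Complex 0 y) =
      boundary_minus (m_mod a c \<Lambda>) (Complex 0 y) v* v_mod a c \<Lambda> (Complex 0 y)"
      using m_mod_jump by (simp add: contour_iff[OF c_pos])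
  qed
  show "m_mod a c \<Lambda> (- k) = m_mod a c \<Lambda> k v* vector [vector [0, 1], vector [1, 0]]" if "k \<in> - contour c" for k
    using that by (intro vec2_eqI) (simp_all add: m_mod_minus swap2_component vector_matrix_mult_def sum_2)
  show "(m_mod a c \<Lambda> \<longlongrightarrow> vector [1, 1]) at_infinity" by (rule m_mod_at_infinity)
qed

end

theorem lemma2p4:
  fixes a c \<Lambda> :: real
  assumes "0 < a" and "a < c"
  shows "model_RHP_solution a c \<Lambda> (m_mod a c \<Lambda>) \<and>
    (\<forall>m. model_RHP_solution a c \<Lambda> m \<longrightarrow> (\<forall>k\<in>- contour c. m k = m_mod a c \<Lambda> k)) \<and>
    continuous_up_to_boundary_except c (exceptional_points a c) (m_mod a c \<Lambda>) \<and>
    (\<forall>k\<in>contour c - exceptional_points a c.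
       boundary_plus (m_mod a c \<Lambda>) k = boundary_minus (m_mod a c \<Lambda>) k v* v_mod a c \<Lambda> k) \<and>
    (\<forall>\<kappa>\<in>exceptional_points a c.
       (\<lambda>k. norm (m_mod a c \<Lambda> k)) \<in> O[at \<kappa> within - contour c](\<lambda>k. norm (k - \<kappa>) powr (- 1/4)))"
proof -
  interpret branch_points a c using assms by unfold_locales
  show ?thesis
    using m_mod_solution model_RHP_solution_unique m_mod_continuous_up_to_boundary m_mod_jump m_mod_fourth_root
    by blast
qed

end
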